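(* Let $k,\ell$ be integers with $k\geq 7$ and $k/2\leq \ell\leq k-1$. Then there exist a real $\epsilon>0$ and an integer $n_0=n_0(k,\epsilon)$ such that the following holds. Let $\mathcal{H}$ be a $k$-graph on $n$ vertices with $n\geq n_0$ and $n\in k\mathbb{N}$. If $\mathcal{H}$ is $\epsilon$-close to some $\mathcal{B}_{n,k}$ or some $\overline{\mathcal{B}}_{n,k}$, and $\delta_\ell(\mathcal{H})>\delta(n,k,\ell)$, then $\mathcal{H}$ contains a Hamilton $(\ell,k-\ell)$-cycle.
   Context: A $k$-graph on a finite vertex set $V$ is a family $\mathcal{H}\subseteq\binom{V}{k}$. For an $\ell$-set $S\subseteq V$, $\deg_{\mathcal{H}}(S)$ is the number of edges of $\mathcal{H}$ containing $S$, and $\delta_\ell(\mathcal{H})$ is the minimum of $\deg_{\mathcal{H}}(S)$ over all $\ell$-subsets $S$ of $V$. A Hamilton $(\ell,k-\ell)$-cycle in $\mathcal{H}$ is given by a partition $(L_0,R_0,L_1,R_1,\ldots,L_{t-1},R_{t-1})$ of $V(\mathcal{H})$ with $|L_i|=\ell$, $|R_i|=k-\ell$ such that $L_i\cup R_i$ and $R_i\cup L_{i+1}$ (subscripts modulo $t$) are edges of $\mathcal{H}$ for all $i=0,1,\ldots,t-1$. For a partition $V=A\cup B$ of an $n$-element set, $\mathcal{B}_{n,k}(A,B)$ is the $k$-graph on $V$ whose edges are all $k$-subsets of $V$ meeting $A$ in an odd number of vertices, and $\overline{\mathcal{B}}_{n,k}(A,B)$ is its complement, whose edges are all $k$-subsets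 meeting $A$ in an even number of vertices. $\mathcal{B}_{n,k}$ and $\overline{\mathcal{B}}_{n,k}$ (without $A,B$) denote these $k$-graphs for a partition with $|A|=\lceil n/2\rceil$, $|B|=\lfloor n/2\rfloor$. For $k\mid n$, $\mathcal{H}_{ext}(n,k)$ is the family consisting of all $\mathcal{B}_{n,k}(A,B)$ for which $n/k-|A|$ is odd and all $\overline{\mathcal{B}}_{n,k}(A,B)$ for which $|A|$ is odd (over all partitions $V=A\cup B$, $|V|=n$), and $\delta(n,k,\ell)=\max_{\mathcal{G}\in\mathcal{H}_{ext}(n,k)}\delta_\ell(\mathcal{G})$. For $k$-graphs $\mathcal{H},\mathcal{H}'$ on $n$ vertices, $\mathcal{H}$ is $\epsilon$-close to $\mathcal{H}'$ if $\mathcal{H}$ can be made a copy of $\mathcal{H}'$ by adding and deleting at most $\epsilon n^k$ edges. *)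

theory Defs
  imports Complex_Main "HOL-Library.Ramsey" "HOL-Library.Disjoint_Sets"
begin

text \<open>
  A hypergraph is given by its vertex set \<open>V\<close> and its edge set \<open>H\<close>; it is a \<open>k\<close>-graph
  on \<open>V\<close> if \<open>V\<close> is finite and \<open>H\<close> is a subset of \<open>nsets V k\<close>, written \<open>[V]\<^bsup>k\<^esup>\<close>.
\<close>

definition kgraph :: "nat \<Rightarrow> 'a set \<Rightarrow> 'a set set \<Rightarrow> bool" where
  "kgraph k V H \<longleftrightarrow> finite V \<and> H \<subseteq> [V]\<^bsup>k\<^esup>"

definition deg :: "'a set set \<Rightarrow> 'a set \<Rightarrow> nat" where
  "deg H S = card {e \<in> H. S \<subseteq> e}"

text \<open>Meaningful for finite \<open>V\<close> with \<open>l \<le> card V\<close>; otherwise the minimum is over an empty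
  or infinite set.\<close>

definition min_degree :: "nat \<Rightarrow> 'a set \<Rightarrow> 'a set set \<Rightarrow> nat" where
  "min_degree l V H = Min (deg H ` [V]\<^bsup>l\<^esup>)"

definition hamilton_cycle ::
  "nat \<Rightarrow> nat \<Rightarrow> 'a set \<Rightarrow> 'a set set \<Rightarrow> nat \<Rightarrow> (nat \<Rightarrow> 'a set) \<Rightarrow> (nat \<Rightarrow> 'a set) \<Rightarrow> bool"
where
  "hamilton_cycle a b V H t L R \<longleftrightarrow>
     t > 0 \<and>
     (\<forall>i<t. L i \<in> [V]\<^bsup>a\<^esup> \<and> R i \<in> [V]\<^bsup>b\<^esup>) \<and>
     disjoint_family_on L {..<t} \<and>
     disjoint_family_on R {..<t} \<and>
     (\<forall>i<t. \<forall>j<t. L i \<inter> R j = {}) \<and>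
     (\<Union>i<t. L i \<union> R i) = V \<and>
     (\<forall>i<t. L i \<union> R i \<in> H \<and> R i \<union> L (Suc i mod t) \<in> H)"

definition has_hamilton_cycle :: "nat \<Rightarrow> nat \<Rightarrow> 'a set \<Rightarrow> 'a set set \<Rightarrow> bool" where
  "has_hamilton_cycle a b V H \<longleftrightarrow> (\<exists>t L R. hamilton_cycle a b V H t L R)"

definition bipartition :: "'a set \<Rightarrow> 'a set \<Rightarrow> 'a set \<Rightarrow> bool" where
  "bipartition V A B \<longleftrightarrow> A \<union> B = V \<and> A \<inter> B = {}"

text \<open>\<open>odd_graph k A B\<close> is $\mathcal{B}_{n,k}(A,B)$ and \<open>even_graph k A B\<close> is
  $\overline{\mathcal{B}}_{n,k}(A,B)$, both on the vertex set \<open>A \<union> B\<close>.\<close>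

definition odd_graph :: "nat \<Rightarrow> 'a set \<Rightarrow> 'a set \<Rightarrow> 'a set set" where
  "odd_graph k A B = {e \<in> [A \<union> B]\<^bsup>k\<^esup>. odd (card (e \<inter> A))}"

definition even_graph :: "nat \<Rightarrow> 'a set \<Rightarrow> 'a set \<Rightarrow> 'a set set" where
  "even_graph k A B = {e \<in> [A \<union> B]\<^bsup>k\<^esup>. even (card (e \<inter> A))}"

lemma even_graph_complement: "even_graph k A B = [A \<union> B]\<^bsup>k\<^esup> - odd_graph k A B"
  by (auto simp: even_graph_def odd_graph_def)

definition balanced_bipartition :: "'a set \<Rightarrow> 'a set \<Rightarrow> 'a set \<Rightarrow> bool" where
  "balanced_bipartition V A B \<longleftrightarrow> bipartition V A B \<and>
     int (card A) = \<lceil>real (card V) / 2\<rceil> \<and> int (card B) = \<lfloor>real (card V) / 2\<rfloor>"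

text \<open>The members of $\mathcal{H}_{ext}(n,k)$ on a given vertex set \<open>V\<close> of size \<open>n\<close>, where
  \<open>k\<close> divides \<open>n\<close>. The parity of $n/k - |A|$ is taken over the integers, to avoid truncated
  subtraction.\<close>

definition H_ext :: "'a set \<Rightarrow> nat \<Rightarrow> 'a set set set" where
  "H_ext V k =
     {odd_graph k A B | A B. bipartition V A B \<and> odd (int (card V div k) - int (card A))} \<union>
     {even_graph k A B | A B. bipartition V A B \<and> odd (card A)}"

text \<open>The minimum degree is invariant under isomorphism, so \<open>{..<n}\<close> may serve as the
  \<open>n\<close>-element vertex set.\<close>

definition ext_threshold :: "nat \<Rightarrow> nat \<Rightarrow> nat \<Rightarrow> nat" where
  "ext_threshold n k l = Max (min_degree l {..<n} ` H_ext {..<n} k)"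

text \<open>The copy of \<open>H'\<close> is its image under a bijection \<open>f\<close> of the vertex sets; the edges to be
  added and deleted together form the symmetric difference.\<close>

definition eps_close ::
  "real \<Rightarrow> nat \<Rightarrow> 'a set \<Rightarrow> 'a set set \<Rightarrow> 'b set \<Rightarrow> 'b set set \<Rightarrow> bool"
where
  "eps_close \<epsilon> k V H V' H' \<longleftrightarrow>
     (\<exists>f. bij_betw f V' V \<and>
          (let C = (\<lambda>e. f ` e) ` H'
           in real (card (sym_diff C H)) \<le> \<epsilon> * real (card V) ^ k))"

end

theory Submission
  imports Defs "HOL-Library.FuncSet" "HOL-Combinatorics.Permutations"
begin

text \<open>
  Let \<open>H\<close> be close to the parity graph of \<open>(A, B)\<close>. The few vertices whose link is far from that of the
  parity graph are redistributed between \<open>A\<close> and \<open>B\<close> so that each of them lies in many right edges. If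
  \<open>card A\<close> then has the wrong parity, the parity graph of the new partition is in
  $\mathcal{H}_{ext}$, so by the degree condition every \<open>l\<close>-set of one type lies in an edge of \<open>H\<close> of the
  wrong parity. Either some \<open>l\<close>-set has many wrong extensions, or there are so many wrong edges that
  two of them meet in exactly \<open>k - l\<close> vertices (or are disjoint, if \<open>l = k - l\<close>), by the theorem of Frankl
  and Fueredi on one forbidden intersection. In both cases a short sequence of blocks containing two
  wrong edges repairs the parity.

  This sequence and all exceptional vertices are absorbed greedily into one short path of blocks. On
  the remaining vertices each vertex misses only \<open>\<delta> n^(k-1)\<close> right edges, hence by the lopsided local
  lemma a random permutation of these vertices that respects \<open>A\<close> and \<open>B\<close> maps a fixed sequence of blocks
  to one that closes the cycle with positive probability.
\<close>

section \<open>Set systems with a forbidden intersection\<close>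

text \<open>Parity is made local: numbers \<open>a\<close>, \<open>b\<close> with
  \<open>a + b + p\<close> even are fixed, and, modulo 2, every \<open>L i\<close> is to have
  \<open>a\<close> and every \<open>R i\<close> to have \<open>b\<close> vertices in
  \<open>A\<close>. Consecutive blocks then always form a right set, blocks can be chosen without
  looking ahead, and the global parity condition shrinks to the single bit \<open>w\<close> carried
  by a path. The constants satisfy 1/n << \<delta> << \<eta> << g << 1/k: \<open>g\<close> is a
  density at which a family of sets is rich enough to choose from, \<eta> bounds the missing edges
  at a typical set, \<delta> those at a vertex. Degrees in a parity graph depend only on the type of
  the set, that is, on its number of vertices in \<open>A\<close>. Hence wrong edges are forced at a
  whole type, of order n^l sets. An edge contains at most 2^k of these, so there are of order n^l
  wrong edges, while the forbidden intersection bound has order n^(l-1).\<close>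

text \<open>A theorem of Frankl and Katona. For \<open>x \<in> X\<close> and \<open>y \<in> C x\<close>, the traces on \<open>C x - {y}\<close> of the other
  sets through \<open>y\<close> satisfy the hypothesis again, so by induction the degree of \<open>y\<close> is at most
  \<open>card (C x)\<close>. Summing \<open>1 / card (C x)\<close> over all incidences gives the result.\<close>

lemma frankl_katona:
  fixes C :: "'i \<Rightarrow> 'b set"
  assumes "finite X" "finite Y" "\<And>x. x \<in> X \<Longrightarrow> C x \<subseteq> Y"
    and "\<And>J. J \<subseteq> X \<Longrightarrow> J \<noteq> {} \<Longrightarrow> card (\<Inter>x\<in>J. C x) + 1 \<noteq> card J"
  shows "card X \<le> card Y"
  using assms
proof (induction "card Y" arbitrary: X Y C rule: less_induct)
  case less
  define D where "D y = {x \<in> X. y \<in> C x}" for y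
  have finC: "finite (C x)" if "x \<in> X" for x
    using less.prems that finite_subset by metis
  have finD: "finite (D y)" for y
    using less.prems(1) by (simp add: D_def)
  have le: "card (D y) \<le> card (C x)" if x: "x \<in> X" and y: "y \<in> C x" for x y
  proof -
    have "card (D y - {x}) \<le> card (C x - {y})"
    proof (rule less.hyps)
      have "C x - {y} \<subset> Y" using less.prems(3)[OF x] y by blast
      then show "card (C x - {y}) < card Y"
        using less.prems(2) psubset_card_mono by blast
      show "finite (D y - {x})" "finite (C x - {y})" using finD finC x by auto
      show "C z \<inter> (C x - {y}) \<subseteq> C x - {y}" for z by blast
      fix J assume J: "J \<subseteq> D y - {x}" "J \<noteq> {}"
      have finJ: "finite J" using J finD finite_subset by (metis finite_Diff)
      \<comment> \<open>Passing from \<open>J\<close> to \<open>insert x J\<close> adds the single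
        point \<open>y\<close> to the intersection and one index, so both sides of the forbidden
        equation grow by one and the hypothesis is inherited.\<close>
      have I: "(\<Inter>z\<in>insert x J. C z) = insert y (\<Inter>z\<in>J. C z \<inter> (C x - {y}))"
        using J y by (auto simp: D_def)
      have "y \<notin> (\<Inter>z\<in>J. C z \<inter> (C x - {y}))" using J(2) by blast
      moreover have "finite (\<Inter>z\<in>J. C z \<inter> (C x - {y}))"
        using J(2) finC[OF x] by (meson finite_Diff finite_INT finite_Int ex_in_conv)
      ultimately have "card (\<Inter>z\<in>insert x J. C z) = card (\<Inter>z\<in>J. C z \<inter> (C x - {y})) + 1"
        unfolding I by simp
      moreover have "insert x J \<subseteq> X" using J x by (auto simp: D_def)
      moreover have "card (insert x J) = card J + 1"
        using J finJ by (subst card_insert_disjoint) auto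
      ultimately show "card (\<Inter>z\<in>J. C z \<inter> (C x - {y})) + 1 \<noteq> card J"
        using less.prems(4)[of "insert x J"] by auto
    qed
    moreover have "x \<in> D y" using x y by (simp add: D_def)
    ultimately show ?thesis
      using y finC[OF x] finD[of y] by (metis One_nat_def card_Diff_singleton card_gt_0_iff
          Suc_pred add_le_cancel_right Suc_le_mono emptyE)
  qed
  \<comment> \<open>The hypothesis for a singleton \<open>J\<close> says that \<open>C x\<close> is
    nonempty, which makes the weights below sum to 1.\<close>
  have ne: "card (C x) > 0" if "x \<in> X" for x
    using less.prems(4)[of "{x}"] that by auto
  have "real (card X) = (\<Sum>x\<in>X. \<Sum>y\<in>C x. 1 / real (card (C x)))"
  proof -
    have "(\<Sum>y\<in>C x. 1 / real (card (C x))) = 1" if "x \<in> X" for x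
      using ne[OF that] by simp
    then show ?thesis by simp
  qed
  also have "\<dots> \<le> (\<Sum>x\<in>X. \<Sum>y\<in>C x. 1 / real (card (D y)))"
  proof (intro sum_mono)
    fix x y assume xy: "x \<in> X" "y \<in> C x"
    then have "card (D y) > 0" using finD card_gt_0_iff by (fastforce simp: D_def)
    then show "1 / real (card (C x)) \<le> 1 / real (card (D y))"
      using le[OF xy] by (simp add: frac_le)
  qed
  also have "\<dots> = (\<Sum>x\<in>X. \<Sum>y\<in>{y \<in> Y. y \<in> C x}. 1 / real (card (D y)))"
    using less.prems(3) by (intro sum.cong) auto
  also have "\<dots> = (\<Sum>y\<in>Y. \<Sum>x\<in>D y. 1 / real (card (D y)))"
    unfolding D_def by (rule sum.swap_restrict) (use less.prems in auto)
  also have "\<dots> \<le> (\<Sum>y\<in>Y. 1)"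
    by (intro sum_mono) auto
  finally show ?case by simp
qed

text \<open>Let \<open>S\<close> be a minimal set that is contained in no member of \<open>\<I>\<close>. For \<open>x \<in> S\<close> some member contains
  \<open>S - {x}\<close>; the previous lemma applies to the traces of these members outside \<open>S\<close>, after adding dummy
  points (if \<open>card S > m\<close>) or removing a common point (if \<open>card S = m\<close>).\<close>

lemma intersection_closed_member:
  fixes \<I> :: "nat set set"
  assumes sub: "\<And>P. P \<in> \<I> \<Longrightarrow> P \<subset> {..<k}"
    and closed: "\<And>P Q. P \<in> \<I> \<Longrightarrow> Q \<in> \<I> \<Longrightarrow> P \<inter> Q \<in> \<I>"
    and cover: "\<And>R. R \<subseteq> {..<k} \<Longrightarrow> card R < l \<Longrightarrow> \<exists>P\<in>\<I>. R \<subseteq> P"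
    and k: "k = l + m" "m \<le> l" "l > 0"
  shows "\<exists>P\<in>\<I>. card P = m \<or> (l = m \<and> P = {})"
proof (rule ccontr)
  assume "\<not> ?thesis"
  then have no_m: "\<And>P. P \<in> \<I> \<Longrightarrow> card P \<noteq> m" and no_0: "l = m \<Longrightarrow> {} \<notin> \<I>" by auto
  have closedI: "(\<Inter>x\<in>J. P x) \<in> \<I>" if "finite J" "J \<noteq> {}" "\<And>x. x \<in> J \<Longrightarrow> P x \<in> \<I>" for J :: "nat set" and P
    using that by (induction J rule: finite_ne_induct) (auto intro: closed)
  define hit where "hit S \<longleftrightarrow> S \<subseteq> {..<k} \<and> (\<forall>P\<in>\<I>. \<not> S \<subseteq> P)" for S
  have "hit {..<k}" using sub by (auto simp: hit_def)
  then obtain S where S: "hit S" "\<And>T. hit T \<Longrightarrow> card S \<le> card T"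
    using ex_has_least_nat[of hit _ card] by blast
  have Sk: "S \<subseteq> {..<k}" and finS: "finite S"
    using S(1) finite_subset by (auto simp: hit_def)
  have cS: "l \<le> card S" using cover[OF Sk] S(1) by (auto simp: hit_def not_less[symmetric])
  have "\<exists>P\<in>\<I>. S - {x} \<subseteq> P" if "x \<in> S" for x
  proof (rule ccontr)
    assume "\<not> ?thesis"
    then have "hit (S - {x})" using Sk by (auto simp: hit_def)
    then have "card S \<le> card (S - {x})" by (rule S(2))
    then show False using that finS by (metis card_Diff1_less not_le)
  qed
  then obtain P where P: "\<And>x. x \<in> S \<Longrightarrow> P x \<in> \<I> \<and> S - {x} \<subseteq> P x" by metis
  have xP: "x \<notin> P x" if "x \<in> S" for x
    using P[OF that] S(1) by (auto simp: hit_def)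
  define C where "C x = P x - S" for x
  have inter: "card (\<Inter>x\<in>J. P x) = card S - card J + card (\<Inter>x\<in>J. C x) \<and> (\<Inter>x\<in>J. P x) \<in> \<I>
      \<and> finite (\<Inter>x\<in>J. C x)"
    if J: "J \<subseteq> S" "J \<noteq> {}" for J
  proof -
    have finJ: "finite J" using J finS finite_subset by blast
    have I: "(\<Inter>x\<in>J. P x) \<in> \<I>" using closedI[OF finJ J(2)] P J by blast
    have eq: "(\<Inter>x\<in>J. P x) = (S - J) \<union> (\<Inter>x\<in>J. C x)"
      using J P xP by (auto simp: C_def)
    have f: "finite (\<Inter>x\<in>J. C x)"
      using sub[OF I] eq finite_subset[of "\<Inter>x\<in>J. C x" "{..<k}"] by auto
    have "(S - J) \<inter> (\<Inter>x\<in>J. C x) = {}" using J by (auto simp: C_def)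
    then show ?thesis
      unfolding eq using I eq f finS J finJ by (simp add: card_Un_disjoint card_Diff_subset)
  qed
  have CY: "C x \<subseteq> {..<k} - S" if "x \<in> S" for x
    using P[OF that] sub by (auto simp: C_def)
  have cY: "card ({..<k} - S) = k - card S" using Sk finS by (simp add: card_Diff_subset)
  have Slek: "card S \<le> k" using card_mono[OF _ Sk] by simp
  have Jc: "card J \<le> card S" if "J \<subseteq> S" for J using card_mono[OF finS that] .
  show False
  proof (cases "card S > m")
    case True
    \<comment> \<open>The number of dummy points is chosen so that the equation forbidden in
      \<open>frankl_katona\<close> becomes exactly \<open>card (\<Inter>x\<in>J. P x) = m\<close>.
      The conclusion would then bound \<open>card S\<close> by \<open>l - 1\<close>.\<close>
    define dm where "dm = {k..<k + (card S - m - 1)}"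
    have "card S \<le> card (({..<k} - S) \<union> dm)"
    proof (rule frankl_katona[where C = "\<lambda>x. C x \<union> dm"])
      fix J assume J: "J \<subseteq> S" "J \<noteq> {}"
      have eq: "(\<Inter>x\<in>J. C x \<union> dm) = (\<Inter>x\<in>J. C x) \<union> dm" by blast
      have "(\<Inter>x\<in>J. C x) \<inter> dm = {}" using J CY by (fastforce simp: dm_def)
      then have "card (\<Inter>x\<in>J. C x \<union> dm) = card (\<Inter>x\<in>J. C x) + (card S - m - 1)"
        unfolding eq using inter[OF J] by (simp add: card_Un_disjoint dm_def)
      moreover have "card (\<Inter>x\<in>J. P x) \<noteq> m" using inter[OF J] no_m by blast
      ultimately show "card (\<Inter>x\<in>J. C x \<union> dm) + 1 \<noteq> card J"
        using inter[OF J] True Jc[OF J(1)] by linarith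
    qed (use finS CY in \<open>auto simp: dm_def\<close>)
    also have "\<dots> \<le> (k - card S) + (card S - m - 1)"
      using card_Un_le[of "{..<k} - S" dm] cY by (simp add: dm_def)
    finally show False using k cS True Slek by linarith
  next
    case False
    \<comment> \<open>The inequalities l \<le> \<open>card S\<close> \<le> m \<le> l collapse; dummy
      points would be needed in number -1.\<close>
    then have lm: "l = m" "card S = m" using cS k by auto
    have finI: "finite \<I>" using sub by (intro finite_subset[of \<I> "Pow {..<k}"]) auto
    have neI: "\<I> \<noteq> {}" using cover[of "{}"] k by auto
    have "\<Inter>\<I> \<in> \<I>"
      using finI neI
    proof -
      have "\<Inter>\<J> \<in> \<I>" if "finite \<J>" "\<J> \<noteq> {}" "\<J> \<subseteq> \<I>" for \<J>
        using that by (induction \<J> rule: finite_ne_induct) (auto intro: closed)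
      then show ?thesis using finI neI by blast
    qed
    \<comment> \<open>Since the empty pattern is excluded when \<open>l = m\<close>, the smallest
      member of \<I> has a point. Deleting this common point plays the part of -1 dummy
      points.\<close>
    then obtain v where v: "v \<in> \<Inter>\<I>" using no_0[OF lm(1)] by (metis ex_in_conv)
    have vS: "v \<notin> S" using xP P v by blast
    have vk: "v < k" using v neI sub by blast
    have "card S \<le> card ({..<k} - S - {v})"
    proof (rule frankl_katona[where C = "\<lambda>x. C x - {v}"])
      fix J assume J: "J \<subseteq> S" "J \<noteq> {}"
      have "v \<in> (\<Inter>x\<in>J. C x)" using v vS P J by (auto simp: C_def)
      moreover have "(\<Inter>x\<in>J. C x - {v}) = (\<Inter>x\<in>J. C x) - {v}" using J by blast
      ultimately have "card (\<Inter>x\<in>J. C x - {v}) + 1 = card (\<Inter>x\<in>J. C x)"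
        using inter[OF J] by (metis Suc_eq_plus1 card_Suc_Diff1)
      moreover have "card (\<Inter>x\<in>J. P x) \<noteq> m" using inter[OF J] no_m by blast
      ultimately show "card (\<Inter>x\<in>J. C x - {v}) + 1 \<noteq> card J"
        using inter[OF J] lm Jc[OF J(1)] by linarith
    qed (use finS CY in auto)
    also have "\<dots> = k - card S - 1" using vS vk cY by (simp add: card_Diff_singleton)
    finally show False using lm k by linarith
  qed
qed

section \<open>Rainbow and homogeneous subfamilies\<close>

lemma card_nsets_le:
  assumes "finite V"
  shows "card ([V]\<^bsup>r\<^esup>) \<le> card V ^ r"
proof (cases "r \<le> card V")
  case True
  then show ?thesis using binomial_le_pow[OF True] by (simp add: card_nsets assms)
next
  case False
  then show ?thesis using assms by (simp add: card_nsets binomial_eq_0)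
qed

text \<open>Pigeonhole inside every fibre of \<open>g\<close> separately; the winners are collected
  in \<open>h\<close>. It serves once with constant \<open>g\<close>, to select a single colour
  pattern, and once to make a covering point depend on the kernel only.\<close>

lemma popular_value:
  fixes f :: "'a \<Rightarrow> 'b" and g :: "'a \<Rightarrow> 'c"
  assumes fin: "finite A" and small: "\<And>y. card (f ` {a \<in> A. g a = y}) \<le> q"
  shows "\<exists>h. card A \<le> q * card {a \<in> A. f a = h (g a)}"
proof -
  have "\<exists>z. card {a \<in> A. g a = y} \<le> q * card {a \<in> A. g a = y \<and> f a = z}" for y
  proof (rule ccontr)
    let ?B = "{a \<in> A. g a = y}"
    assume "\<not> ?thesis"
    then have less: "q * card {a \<in> A. g a = y \<and> f a = z} < card ?B" for z
      by (meson not_le)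
    have finB: "finite ?B" using fin by simp
    have "card ?B > 0" using less[of undefined] by linarith
    then have "?B \<noteq> {}" by fastforce
    then have ne: "f ` ?B \<noteq> {}" by blast
    have "q * card ?B = q * (\<Sum>z\<in>f ` ?B. card {a \<in> ?B. f a = z})"
      using card_image_le[OF finB] sum.image_gen[OF finB, of "\<lambda>_. 1::nat" f] by simp
    also have "\<dots> = (\<Sum>z\<in>f ` ?B. q * card {a \<in> A. g a = y \<and> f a = z})"
      by (simp add: sum_distrib_left conj_assoc)
    also have "\<dots> < (\<Sum>z\<in>f ` ?B. card ?B)"
      using less finB ne by (intro sum_strict_mono) auto
    also have "\<dots> \<le> q * card ?B" using small[of y] by simp
    finally show False by simp
  qed
  then obtain h where h: "\<And>y. card {a \<in> A. g a = y} \<le> q * card {a \<in> A. g a = y \<and> f a = h y}"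
    by metis
  have "card A = (\<Sum>y\<in>g ` A. card {a \<in> A. g a = y})"
    using sum.image_gen[OF fin, of "\<lambda>_. 1::nat" g] by simp
  also have "\<dots> \<le> (\<Sum>y\<in>g ` A. q * card {a \<in> A. g a = y \<and> f a = h y})"
    using h by (intro sum_mono) blast
  also have "\<dots> = q * (\<Sum>y\<in>g ` A. card {a \<in> {a \<in> A. f a = h (g a)}. g a = y})"
    unfolding sum_distrib_left
    by (intro sum.cong refl arg_cong[where f = "\<lambda>S. q * card S"]) auto
  also have "(\<Sum>y\<in>g ` A. card {a \<in> {a \<in> A. f a = h (g a)}. g a = y}) = card {a \<in> A. f a = h (g a)}"
    using sum.group[of "{a \<in> A. f a = h (g a)}" "g ` A" g "\<lambda>_. 1::nat"] fin by (auto simp: image_subset_iff)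
  finally show ?thesis by blast
qed

text \<open>A substitute for the kernel of a large sunflower: the members through \<open>Y\<close>
  cannot be hit outside \<open>Y\<close> by \<open>q\<close> points, so one of them can always be
  chosen to avoid a given small set outside \<open>Y\<close>.\<close>

definition star_kernel :: "'a set set \<Rightarrow> nat \<Rightarrow> 'a set \<Rightarrow> bool" where
  "star_kernel F q Y \<longleftrightarrow> (\<forall>U. finite U \<and> card U \<le> q \<longrightarrow> (\<exists>f\<in>F. Y \<subseteq> f \<and> f \<inter> U \<subseteq> Y))"

definition colour_part :: "('a \<Rightarrow> nat) \<Rightarrow> nat set \<Rightarrow> 'a set \<Rightarrow> 'a set" where
  "colour_part \<chi> p e = {v \<in> e. \<chi> v \<in> p}"

text \<open>Members are deleted one by one as long as one of their parts fails to be a star kernel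
  in what is left; the failure supplies a small cover. The point is that \<open>cov p Y\<close>
  depends on pattern and kernel only, not on the deleted member, so that later a pigeonhole over its
  \<open>q\<close> points is possible.\<close>

lemma delete_non_kernels:
  assumes "finite F"
  shows "\<exists>Fc P cov. Fc \<subseteq> F \<and> (\<forall>e\<in>Fc. \<forall>p\<in>\<D>. star_kernel Fc q (colour_part \<chi> p e)) \<and>
    (\<forall>e\<in>F - Fc. P e \<in> \<D>) \<and>
    (\<forall>p Y. finite (cov p Y) \<and> card (cov p Y) \<le> q \<and>
       (\<forall>e\<in>F - Fc. P e = p \<and> colour_part \<chi> p e = Y \<longrightarrow> \<not> e \<inter> cov p Y \<subseteq> Y))"
  using assms
proof (induction F rule: finite_psubset_induct)
  case (psubset F)
  show ?case
  proof (cases "\<forall>e\<in>F. \<forall>p\<in>\<D>. star_kernel F q (colour_part \<chi> p e)")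
    case True
    show ?thesis
      by (rule exI[of _ F], rule exI[of _ "\<lambda>_. {}"], rule exI[of _ "\<lambda>_ _. {}"]) (use True in auto)
  next
    case False
    then obtain e0 p0 where e0: "e0 \<in> F" "p0 \<in> \<D>" "\<not> star_kernel F q (colour_part \<chi> p0 e0)" by blast
    define Y0 where "Y0 = colour_part \<chi> p0 e0"
    have "\<exists>U. finite U \<and> card U \<le> q \<and> \<not> (\<exists>f\<in>F. Y0 \<subseteq> f \<and> f \<inter> U \<subseteq> Y0)"
      using e0(3) unfolding star_kernel_def Y0_def by (simp only: not_all not_imp conj_assoc)
    then obtain U0 where U0: "finite U0" "card U0 \<le> q"
        "\<not> (\<exists>f\<in>F. Y0 \<subseteq> f \<and> f \<inter> U0 \<subseteq> Y0)"
      by (elim exE conjE)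
    have "F - {e0} \<subset> F" using e0 by blast
    from psubset.IH[OF this] obtain Fc P cov where H: "Fc \<subseteq> F - {e0} \<and>
        (\<forall>e\<in>Fc. \<forall>p\<in>\<D>. star_kernel Fc q (colour_part \<chi> p e)) \<and>
        (\<forall>e\<in>F - {e0} - Fc. P e \<in> \<D>) \<and>
        (\<forall>p Y. finite (cov p Y) \<and> card (cov p Y) \<le> q \<and>
          (\<forall>e\<in>F - {e0} - Fc. P e = p \<and> colour_part \<chi> p e = Y \<longrightarrow> \<not> e \<inter> cov p Y \<subseteq> Y))"
      by (elim exE)
    have Fc: "Fc \<subseteq> F - {e0}" "\<forall>e\<in>Fc. \<forall>p\<in>\<D>. star_kernel Fc q (colour_part \<chi> p e)"
      and P: "\<forall>e\<in>F - {e0} - Fc. P e \<in> \<D>"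
      using H by blast+
    have cov: "finite (cov p Y)" "card (cov p Y) \<le> q" for p Y
      using H by blast+
    have cov_meets: "\<not> e \<inter> cov p Y \<subseteq> Y"
      if "e \<in> F - {e0} - Fc" "P e = p" "colour_part \<chi> p e = Y" for e p Y
      using H that by blast
    \<comment> \<open>Overwriting is harmless: \<open>U0\<close> was found for the larger family
      \<open>F\<close>, so it also serves every member that is deleted later with the same pattern
      and part.\<close>
    define cov' where "cov' p Y = (if p = p0 \<and> Y = Y0 then U0 else cov p Y)" for p Y
    have "finite (cov' p Y) \<and> card (cov' p Y) \<le> q \<and>
       (\<forall>e\<in>F - Fc. (P(e0 := p0)) e = p \<and> colour_part \<chi> p e = Y \<longrightarrow> \<not> e \<inter> cov' p Y \<subseteq> Y)" for p Y
    proof (intro conjI ballI impI)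
      show "finite (cov' p Y)" "card (cov' p Y) \<le> q" using cov U0 by (auto simp: cov'_def)
      fix e assume e: "e \<in> F - Fc" and *: "(P(e0 := p0)) e = p \<and> colour_part \<chi> p e = Y"
      show "\<not> e \<inter> cov' p Y \<subseteq> Y"
      proof (cases "p = p0 \<and> Y = Y0")
        case True
        then have "Y0 \<subseteq> e" using * by (auto simp: colour_part_def)
        moreover have "cov' p Y = U0" "Y = Y0" "e \<in> F" using True e by (simp_all add: cov'_def)
        ultimately show ?thesis using U0(3) by (simp only:) (meson)
      next
        case False
        then have "e \<noteq> e0" using * by (auto simp: Y0_def)
        then have "\<not> e \<inter> cov p Y \<subseteq> Y" using cov_meets[of e p Y] e * by auto
        then show ?thesis using False by (auto simp: cov'_def)
      qed
    qed
    moreover have "\<forall>e\<in>F - Fc. (P(e0 := p0)) e \<in> \<D>" using P e0(2) by auto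
    ultimately show ?thesis
      using Fc by (intro exI[of _ Fc] exI[of _ "P(e0 := p0)"] exI[of _ cov']) blast
  qed
qed

text \<open>Fueredi's theorem on intersection structures, with \<open>\<I>\<close> the set of colour patterns of the
  intersections.\<close>

lemma homogeneous_subfamily:
  fixes \<chi> :: "'a \<Rightarrow> nat"
  assumes "finite F" "\<And>e. e \<in> F \<Longrightarrow> inj_on \<chi> e"
    and "\<And>e f. e \<in> F \<Longrightarrow> f \<in> F \<Longrightarrow> e \<noteq> f \<Longrightarrow> \<chi> ` (e \<inter> f) \<in> \<D>"
    and "finite \<D>" "card \<D> \<le> N" and q: "q > 0"
  shows "\<exists>Fs \<I>. Fs \<subseteq> F \<and> \<I> \<subseteq> \<D> \<and> card F \<le> (2 * N * q) ^ card \<D> * card Fs \<and>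
    (\<forall>e\<in>Fs. \<forall>p\<in>\<I>. star_kernel Fs q (colour_part \<chi> p e)) \<and>
    (\<forall>e\<in>Fs. \<forall>f\<in>Fs. e \<noteq> f \<longrightarrow> \<chi> ` (e \<inter> f) \<in> \<I>)"
  using assms(1-5)
proof (induction "card \<D>" arbitrary: F \<D>)
  case 0
  then have "\<D> = {}" by simp
  then show ?case using "0.prems" by (intro exI[of _ F] exI[of _ "{}"]) auto
next
  case (Suc d)
  from delete_non_kernels[OF Suc.prems(1), of \<D> q \<chi>]
  obtain Fc P cov where H: "Fc \<subseteq> F \<and> (\<forall>e\<in>Fc. \<forall>p\<in>\<D>. star_kernel Fc q (colour_part \<chi> p e)) \<and>
    (\<forall>e\<in>F - Fc. P e \<in> \<D>) \<and>
    (\<forall>p Y. finite (cov p Y) \<and> card (cov p Y) \<le> q \<and>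
       (\<forall>e\<in>F - Fc. P e = p \<and> colour_part \<chi> p e = Y \<longrightarrow> \<not> e \<inter> cov p Y \<subseteq> Y))"
    by (elim exE)
  note Fc = H[THEN conjunct1] H[THEN conjunct2, THEN conjunct1]
  note P = H[THEN conjunct2, THEN conjunct2, THEN conjunct1, rule_format]
  note covH = H[THEN conjunct2, THEN conjunct2, THEN conjunct2, rule_format]
  have cov: "finite (cov p Y) \<and> card (cov p Y) \<le> q" for p Y
    using covH by simp
  have cov_meets: "\<not> e \<inter> cov (P e) (colour_part \<chi> (P e) e) \<subseteq> colour_part \<chi> (P e) e"
    if "e \<in> F - Fc" for e
    using covH[of "P e" "colour_part \<chi> (P e) e"] that by simp
  have B: "2 * N * q \<ge> 2" using Suc q by (simp add: Suc_le_eq)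
  show ?case
  proof (cases "card F \<le> 2 * card Fc")
    case True
    have "2 * N * q \<le> (2 * N * q) ^ card \<D>"
      using B Suc.hyps(2) by (metis One_nat_def Suc_leD le_numeral_extra(4) nat_le_linear not_less_eq_eq
          numeral_2_eq_2 power_increasing power_one_right zero_less_Suc Suc_leI le_trans one_le_numeral)
    then have "2 * card Fc \<le> (2 * N * q) ^ card \<D> * card Fc" using B by (meson mult_le_mono1 le_trans)
    then have "card F \<le> (2 * N * q) ^ card \<D> * card Fc" using True by linarith
    moreover have "\<forall>e\<in>Fc. \<forall>f\<in>Fc. e \<noteq> f \<longrightarrow> \<chi> ` (e \<inter> f) \<in> \<D>"
      using Suc.prems(3) Fc(1) by blast
    ultimately show ?thesis using Fc by blast
  next
    case False
    \<comment> \<open>If most members were deleted, one pattern can be eliminated from \<D>: a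
      factor 2 is lost here, a factor \<open>N\<close> for a common pattern and a factor
      \<open>q\<close> for the covering points.\<close>
    define D where "D = F - Fc"
    have finD: "finite D" using Suc.prems(1) by (simp add: D_def)
    have cD: "card F \<le> 2 * card D"
      using False Fc(1) Suc.prems(1) finite_subset[OF Fc(1)] by (simp add: D_def card_Diff_subset)
    have "card (P ` {e \<in> D. () = y}) \<le> N" for y
      using card_mono[OF Suc.prems(4), of "P ` {e \<in> D. () = y}"] P Suc.prems(5) by (force simp: D_def)
    from popular_value[OF finD this] obtain h where
      h: "card D \<le> N * card {e \<in> D. P e = h ()}" by blast
    define p where "p = h ()"
    define Dp where "Dp = {e \<in> D. P e = p}"
    have finDp: "finite Dp" using finD by (simp add: Dp_def)
    define Y where "Y = colour_part \<chi> p"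
    have "\<exists>z. z \<in> e \<and> z \<in> cov p (Y e) \<and> z \<notin> Y e" if "e \<in> Dp" for e
      using cov_meets[of e] that by (auto simp: Dp_def D_def Y_def)
    \<comment> \<open>\<open>zed e\<close> is a point of the cover that lies in \<open>e\<close> but
      outside its kernel.\<close>
    then obtain zed where zed: "\<And>e. e \<in> Dp \<Longrightarrow> zed e \<in> e \<and> zed e \<in> cov p (Y e) \<and> zed e \<notin> Y e"
      by metis
    have "card (zed ` {e \<in> Dp. Y e = y}) \<le> q" for y
    proof -
      have "zed ` {e \<in> Dp. Y e = y} \<subseteq> cov p y" using zed by auto
      then show ?thesis using cov[of p y] card_mono le_trans by blast
    qed
    from popular_value[OF finDp this] obtain zz where
      zz: "card Dp \<le> q * card {e \<in> Dp. zed e = zz (Y e)}" by blast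
    define D' where "D' = {e \<in> Dp. zed e = zz (Y e)}"
    have D'F: "D' \<subseteq> F" by (auto simp: D'_def Dp_def D_def)
    \<comment> \<open>If two members of \<open>D'\<close> met exactly in pattern \<open>p\<close>,
      their kernels would coincide with the intersection; then their covering points would be equal,
      hence a common point outside the kernel.\<close>
    have avoid: "\<chi> ` (e \<inter> f) \<noteq> p" if ef: "e \<in> D'" "f \<in> D'" "e \<noteq> f" for e f
    proof
      assume eq: "\<chi> ` (e \<inter> f) = p"
      have part: "Y g = e \<inter> f" if g: "g = e \<or> g = f" for g
      proof -
        have inj: "inj_on \<chi> g" using g ef D'F Suc.prems(2) by blast
        show ?thesis
          unfolding Y_def colour_part_def eq[symmetric]
          using g inj by (auto simp: inj_on_def; metis IntD1 IntD2)
      qed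
      have "zed e = zed f" using ef part by (simp add: D'_def)
      then have "zed e \<in> e \<inter> f" using zed[of e] zed[of f] ef by (auto simp: D'_def)
      then show False using zed[of e] ef part by (auto simp: D'_def)
    qed
    show ?thesis
    proof (cases "D = {}")
      case True
      then have "F = Fc" using Fc(1) by (auto simp: D_def)
      then show ?thesis using False by simp
    next
      case Dne: False
      have Dp_ne: "Dp \<noteq> {}" using h finD Dne unfolding Dp_def p_def
        by (metis card_eq_0_iff le_zero_eq mult_0_right)
      then have pD: "p \<in> \<D>" using P by (auto simp: Dp_def D_def)
      have "\<exists>Fs \<I>. Fs \<subseteq> D' \<and> \<I> \<subseteq> \<D> - {p} \<and> card D' \<le> (2 * N * q) ^ card (\<D> - {p}) * card Fs \<and>
        (\<forall>e\<in>Fs. \<forall>p\<in>\<I>. star_kernel Fs q (colour_part \<chi> p e)) \<and>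
        (\<forall>e\<in>Fs. \<forall>f\<in>Fs. e \<noteq> f \<longrightarrow> \<chi> ` (e \<inter> f) \<in> \<I>)"
      proof (rule Suc.hyps(1))
        show "d = card (\<D> - {p})" using Suc.hyps(2) pD by simp
        show "finite D'" using D'F Suc.prems(1) finite_subset by blast
        show "inj_on \<chi> e" if "e \<in> D'" for e using that D'F Suc.prems(2) by blast
        show "\<chi> ` (e \<inter> f) \<in> \<D> - {p}" if "e \<in> D'" "f \<in> D'" "e \<noteq> f" for e f
          using that D'F Suc.prems(3)[of e f] avoid[of e f] by blast
        show "finite (\<D> - {p})" using Suc.prems(4) by simp
        show "card (\<D> - {p}) \<le> N" using Suc.prems(5) pD Suc.prems(4) by simp
      qed
      then obtain Fs \<I> where H: "Fs \<subseteq> D' \<and> \<I> \<subseteq> \<D> - {p} \<and>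
        card D' \<le> (2 * N * q) ^ card (\<D> - {p}) * card Fs \<and>
        (\<forall>e\<in>Fs. \<forall>p\<in>\<I>. star_kernel Fs q (colour_part \<chi> p e)) \<and>
        (\<forall>e\<in>Fs. \<forall>f\<in>Fs. e \<noteq> f \<longrightarrow> \<chi> ` (e \<inter> f) \<in> \<I>)"
        by (elim exE)
      note Fs = H[THEN conjunct1] H[THEN conjunct2, THEN conjunct1]
        H[THEN conjunct2, THEN conjunct2, THEN conjunct1]
        H[THEN conjunct2, THEN conjunct2, THEN conjunct2, THEN conjunct1]
        H[THEN conjunct2, THEN conjunct2, THEN conjunct2, THEN conjunct2]
      have "card F \<le> 2 * (N * card Dp)" using cD h by (simp add: Dp_def p_def)
      also have "\<dots> \<le> 2 * (N * (q * card D'))" using zz by (simp add: D'_def)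
      also have "\<dots> = (2 * N * q) * card D'" by simp
      also have "\<dots> \<le> (2 * N * q) * ((2 * N * q) ^ card (\<D> - {p}) * card Fs)"
        using Fs(3) mult_le_mono2 by blast
      also have "\<dots> = (2 * N * q) ^ card \<D> * card Fs"
        using Suc.hyps(2) pD Suc.prems(4) by (simp add: card_Diff_singleton flip: Suc.hyps(2))
      finally have "card F \<le> (2 * N * q) ^ card \<D> * card Fs" .
      moreover have "Fs \<subseteq> F" "\<I> \<subseteq> \<D>" using Fs(1,2) D'F by auto
      ultimately show ?thesis using Fs(4,5) by (intro exI[of _ Fs] exI[of _ \<I>] conjI)
    qed
  qed
qed

text \<open>Averaging over all colourings of \<open>V\<close> with \<open>k\<close> colours. A fixed
  k-set is rainbow in at least the fraction k^(-k) of them, counting only the colourings that extend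
  one fixed bijection of this set with the colours.\<close>

lemma rainbow_subfamily:
  assumes V: "finite V" and F: "F \<subseteq> [V]\<^bsup>k\<^esup>" and k: "k > 0"
  shows "\<exists>\<chi>. \<chi> ` V \<subseteq> {..<k} \<and> card F \<le> k ^ k * card {e \<in> F. inj_on \<chi> e}"
proof (rule ccontr)
  assume neg: "\<not> ?thesis"
  let ?X = "V \<rightarrow>\<^sub>E {..<k}"
  have finX: "finite ?X" using V by (simp add: finite_PiE)
  have cX: "card ?X = k ^ card V" using V by (simp add: card_PiE)
  have finF: "finite F" using F V finite_subset finite_imp_finite_nsets by metis
  have Xne: "?X \<noteq> {}" using k by (auto simp: PiE_eq_empty_iff)
  have less: "k ^ k * card {e \<in> F. inj_on \<chi> e} < card F" if "\<chi> \<in> ?X" for \<chi>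
    using neg that by (auto simp: not_le PiE_def Pi_def image_subset_iff)
  have many: "k ^ card V \<le> k ^ k * card {\<chi> \<in> ?X. inj_on \<chi> e}" if "e \<in> F" for e
  proof -
    have e: "e \<subseteq> V" "finite e" "card e = k" using that F by (auto simp: nsets_def)
    obtain g where g: "bij_betw g e {..<k}"
      using e by (metis card_lessThan finite_lessThan finite_same_card_bij)
    let ?ext = "\<lambda>\<psi> v. if v \<in> e then g v else \<psi> v"
    have "inj_on ?ext ((V - e) \<rightarrow>\<^sub>E {..<k})"
    proof (rule inj_onI)
      fix \<psi> \<psi>' assume a: "\<psi> \<in> (V - e) \<rightarrow>\<^sub>E {..<k}" "\<psi>' \<in> (V - e) \<rightarrow>\<^sub>E {..<k}" "?ext \<psi> = ?ext \<psi>'"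
      show "\<psi> = \<psi>'"
      proof (rule PiE_ext[OF a(1,2)])
        fix v assume "v \<in> V - e"
        then show "\<psi> v = \<psi>' v" using fun_cong[OF a(3), of v] by simp
      qed
    qed
    moreover have "?ext ` ((V - e) \<rightarrow>\<^sub>E {..<k}) \<subseteq> {\<chi> \<in> ?X. inj_on \<chi> e}"
    proof
      fix \<chi> assume "\<chi> \<in> ?ext ` ((V - e) \<rightarrow>\<^sub>E {..<k})"
      then obtain \<psi> where \<psi>: "\<psi> \<in> (V - e) \<rightarrow>\<^sub>E {..<k}" and eq: "\<chi> = ?ext \<psi>" by blast
      have "inj_on \<chi> e" using bij_betw_imp_inj_on[OF g] by (simp add: eq inj_on_def)
      moreover have "\<chi> \<in> ?X"
        using \<psi> e(1) bij_betw_apply[OF g] by (auto simp: eq PiE_iff extensional_def)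
      ultimately show "\<chi> \<in> {\<chi> \<in> ?X. inj_on \<chi> e}" by blast
    qed
    ultimately have "card ((V - e) \<rightarrow>\<^sub>E {..<k}) \<le> card {\<chi> \<in> ?X. inj_on \<chi> e}"
      by (intro card_inj_on_le[where f = ?ext]) (use finX in simp_all)
    moreover have "card ((V - e) \<rightarrow>\<^sub>E {..<k}) = k ^ (card V - k)"
      using V e by (simp add: card_PiE card_Diff_subset)
    moreover have "k ^ card V = k ^ k * k ^ (card V - k)"
      using card_mono[OF V e(1)] e(3) by (simp flip: power_add)
    ultimately show ?thesis by simp
  qed
  have "k ^ card V * card F \<le> (\<Sum>e\<in>F. k ^ k * card {\<chi> \<in> ?X. inj_on \<chi> e})"
    using sum_mono[OF many, of F "\<lambda>e. e"] by (simp add: mult.commute)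
  also have "\<dots> = k ^ k * (\<Sum>\<chi>\<in>?X. card {e \<in> F. inj_on \<chi> e})"
    using sum.swap_restrict[OF finF finX, of "\<lambda>_ _. 1::nat" "\<lambda>e \<chi>. inj_on \<chi> e"]
    by (simp flip: sum_distrib_left)
  also have "\<dots> = (\<Sum>\<chi>\<in>?X. k ^ k * card {e \<in> F. inj_on \<chi> e})" by (simp add: sum_distrib_left)
  also have "\<dots> < (\<Sum>\<chi>\<in>?X. card F)"
    using less finX Xne by (intro sum_strict_mono) auto
  finally show False using cX by simp
qed

text \<open>In a homogeneous rainbow subfamily the realised patterns are closed under intersection.
  If the family is large, they also cover all sets of fewer than \<open>l\<close> colours, so
  \<open>intersection_closed_member\<close> yields a pattern of size \<open>m\<close> (or the empty
  one if \<open>l = m\<close>), and a star kernel realises it by two members.\<close>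

lemma forbidden_intersection:
  assumes k: "k = l + m" "m \<le> l" "m > 0"
  shows "\<exists>C::nat. \<forall>(V :: 'a set) F. finite V \<and> F \<subseteq> [V]\<^bsup>k\<^esup> \<and> card F > C * card V ^ (l - 1) \<longrightarrow>
    (\<exists>e\<in>F. \<exists>f\<in>F. e \<noteq> f \<and> (card (e \<inter> f) = m \<or> (l = m \<and> e \<inter> f = {})))"
proof -
  define \<D> where "\<D> = Pow {..<k} - {{..<k}}"
  define B where "B = (2 * 2 ^ k * (2 * k)) ^ card \<D>"
  have kpos: "k > 0" using k by simp
  have finD: "finite \<D>" by (simp add: \<D>_def)
  have cD: "card \<D> \<le> 2 ^ k"
    using card_mono[of "Pow {..<k}" \<D>] by (simp add: \<D>_def card_Pow)
  have "\<exists>e\<in>F. \<exists>f\<in>F. e \<noteq> f \<and> (card (e \<inter> f) = m \<or> (l = m \<and> e \<inter> f = {}))"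
    if V: "finite (V :: 'a set)" and F: "F \<subseteq> [V]\<^bsup>k\<^esup>" and big: "card F > (k ^ k * B) * card V ^ (l - 1)" for V F
  proof -
    have finF: "finite F" using F V finite_subset finite_imp_finite_nsets by metis
    obtain \<chi> where \<chi>: "\<chi> ` V \<subseteq> {..<k}" "card F \<le> k ^ k * card {e \<in> F. inj_on \<chi> e}"
      using rainbow_subfamily[OF V F kpos] by blast
    define F1 where "F1 = {e \<in> F. inj_on \<chi> e}"
    have F1: "e \<subseteq> V" "finite e" "card e = k" "\<chi> ` e = {..<k}" "inj_on \<chi> e" if "e \<in> F1" for e
    proof -
      show e: "e \<subseteq> V" "finite e" "card e = k" "inj_on \<chi> e"
        using that F by (auto simp: nsets_def F1_def)
      show "\<chi> ` e = {..<k}"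
        using e \<chi>(1) by (intro card_subset_eq) (auto simp: card_image)
    qed
    have "\<exists>Fs \<I>. Fs \<subseteq> F1 \<and> \<I> \<subseteq> \<D> \<and> card F1 \<le> (2 * 2 ^ k * (2 * k)) ^ card \<D> * card Fs \<and>
      (\<forall>e\<in>Fs. \<forall>p\<in>\<I>. star_kernel Fs (2 * k) (colour_part \<chi> p e)) \<and>
      (\<forall>e\<in>Fs. \<forall>f\<in>Fs. e \<noteq> f \<longrightarrow> \<chi> ` (e \<inter> f) \<in> \<I>)"
    proof (rule homogeneous_subfamily)
      show "finite F1" using finF by (simp add: F1_def)
      show "inj_on \<chi> e" if "e \<in> F1" for e using F1 that by blast
      fix e f assume ef: "e \<in> F1" "f \<in> F1" "e \<noteq> f"
      have "card (e \<inter> f) < k"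
      proof -
        have "e \<inter> f \<noteq> e" using ef F1[OF ef(1)] F1[OF ef(2)] by (metis Int_lower2 card_subset_eq)
        then show ?thesis using F1[OF ef(1)] by (metis Int_lower1 psubsetI psubset_card_mono)
      qed
      then have "card (\<chi> ` (e \<inter> f)) < k"
        using F1[OF ef(1)] card_image_le[of "e \<inter> f" \<chi>] by simp
      then have "\<chi> ` (e \<inter> f) \<noteq> {..<k}" by auto
      moreover have "\<chi> ` (e \<inter> f) \<subseteq> {..<k}" using F1[OF ef(1)] by blast
      ultimately show "\<chi> ` (e \<inter> f) \<in> \<D>" by (simp add: \<D>_def)
    qed (use finD cD kpos in auto)
    then obtain Fs \<I> where H: "Fs \<subseteq> F1 \<and> \<I> \<subseteq> \<D> \<and>
      card F1 \<le> (2 * 2 ^ k * (2 * k)) ^ card \<D> * card Fs \<and>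
      (\<forall>e\<in>Fs. \<forall>p\<in>\<I>. star_kernel Fs (2 * k) (colour_part \<chi> p e)) \<and>
      (\<forall>e\<in>Fs. \<forall>f\<in>Fs. e \<noteq> f \<longrightarrow> \<chi> ` (e \<inter> f) \<in> \<I>)"
      by (elim exE)
    have Fs: "Fs \<subseteq> F1" "\<I> \<subseteq> \<D>" "card F1 \<le> B * card Fs"
      using H by (auto simp: B_def)
    have ker: "star_kernel Fs (2 * k) (colour_part \<chi> p e)" if "e \<in> Fs" "p \<in> \<I>" for e p
      using H that by blast
    have pat: "\<chi> ` (e \<inter> f) \<in> \<I>" if "e \<in> Fs" "f \<in> Fs" "e \<noteq> f" for e f
      using H that by blast
    have "card F \<le> k ^ k * (B * card Fs)"
      using \<chi>(2) Fs(3) mult_le_mono2 order.trans unfolding F1_def by blast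
    also have "\<dots> = (k ^ k * B) * card Fs" by (rule mult.assoc[symmetric])
    finally have "(k ^ k * B) * card V ^ (l - 1) < (k ^ k * B) * card Fs"
      using big by (rule less_le_trans[rotated])
    then have cFs: "card Fs > card V ^ (l - 1)" by (rule mult_less_cancel1[THEN iffD1, THEN conjunct2])
    then have "Fs \<noteq> {}" by auto
    then obtain e where e: "e \<in> Fs" by blast
    have subV: "g \<subseteq> V" and finE: "finite g" and cardE: "card g = k" and colE: "\<chi> ` g = {..<k}"
      and injE: "inj_on \<chi> g" if "g \<in> Fs" for g
      using F1[OF subsetD[OF Fs(1) that]] by simp_all
    have Ve: "card V > 0"
      using card_mono[OF V subV[OF e]] cardE[OF e] kpos by linarith
    have part_eq: "colour_part \<chi> p f = Y" if "Y = colour_part \<chi> p g" "Y \<subseteq> f" "f \<in> Fs" "g \<in> Fs" "p \<subseteq> {..<k}" for p f g Y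
    proof -
      have f: "inj_on \<chi> f" and g: "\<chi> ` g = {..<k}" using injE colE that by blast+
      show ?thesis
      proof
        show "Y \<subseteq> colour_part \<chi> p f" using that(1,2) by (auto simp: colour_part_def)
        show "colour_part \<chi> p f \<subseteq> Y"
        proof
          fix v assume v: "v \<in> colour_part \<chi> p f"
          then have "\<chi> v \<in> \<chi> ` g" using g that(5) by (auto simp: colour_part_def)
          then obtain w where w: "w \<in> g" "\<chi> w = \<chi> v" by auto
          then have "w \<in> Y" using v that(1) by (simp add: colour_part_def)
          then show "v \<in> Y" using w v that(2) f by (auto simp: colour_part_def inj_on_def)
        qed
      qed
    qed
    have witness: "\<exists>f\<in>Fs. f \<noteq> e \<and> f \<inter> e = colour_part \<chi> p e" if p: "p \<in> \<I>" for p
    proof -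
      obtain f where f: "f \<in> Fs" "colour_part \<chi> p e \<subseteq> f" "f \<inter> e \<subseteq> colour_part \<chi> p e"
        using ker[OF e p] finE[OF e] cardE[OF e] unfolding star_kernel_def
        by (metis le_add2 mult_2)
      have "f \<inter> e = colour_part \<chi> p e" using f by (auto simp: colour_part_def)
      moreover have "colour_part \<chi> p e \<noteq> e"
      proof
        assume "colour_part \<chi> p e = e"
        then have "\<chi> ` e \<subseteq> p" by (auto simp: colour_part_def)
        then show False using colE[OF e] Fs(2) p by (auto simp: \<D>_def)
      qed
      ultimately show ?thesis using f(1) by auto
    qed
    have col_part: "\<chi> ` colour_part \<chi> p g = p" if "g \<in> Fs" "p \<subseteq> {..<k}" for p g
    proof -
      have "p \<subseteq> \<chi> ` g" using colE that by simp
      then show ?thesis by (auto simp: colour_part_def)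
    qed
    have "\<exists>P\<in>\<I>. card P = m \<or> (l = m \<and> P = {})"
    proof (rule intersection_closed_member[where k = k])
      show "P \<subset> {..<k}" if "P \<in> \<I>" for P using that Fs(2) by (auto simp: \<D>_def)
      show "k = l + m" "m \<le> l" "l > 0" using k by auto
      fix P Q assume PQ: "P \<in> \<I>" "Q \<in> \<I>"
      then have PQk: "P \<subseteq> {..<k}" "Q \<subseteq> {..<k}" using Fs(2) by (auto simp: \<D>_def)
      obtain f where f: "f \<in> Fs" "f \<noteq> e" "f \<inter> e = colour_part \<chi> P e" using witness[OF PQ(1)] by blast
      have fP: "colour_part \<chi> P f = colour_part \<chi> P e"
        using part_eq[of "colour_part \<chi> P e" P e f] f e PQk by blast
      \<comment> \<open>This is where the star parameter \<open>2 * k\<close> comes from: a member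
        \<open>g\<close> through the \<open>Q\<close>-part of \<open>f\<close> is chosen to avoid
        the rest of \<open>e \<union> f\<close>. Since \<open>f\<close> meets \<open>e\<close> in
        the \<open>P\<close>-part, \<open>g\<close> meets \<open>e\<close> exactly in the part of
        pattern \<open>P \<inter> Q\<close>.\<close>
      have "card (e \<union> f) \<le> 2 * k"
        using card_Un_le[of e f] cardE[OF e] cardE[OF f(1)] by simp
      moreover have "finite (e \<union> f)" using finE e f(1) by simp
      ultimately obtain g where g: "g \<in> Fs" "colour_part \<chi> Q f \<subseteq> g" "g \<inter> (e \<union> f) \<subseteq> colour_part \<chi> Q f"
        using ker[OF f(1) PQ(2)] unfolding star_kernel_def by blast
      have "g \<inter> e = colour_part \<chi> (P \<inter> Q) e"
      proof -
        have "g \<inter> e = colour_part \<chi> Q f \<inter> e" using g(2,3) by blast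
        also have "\<dots> = colour_part \<chi> Q f \<inter> (f \<inter> e)" by (auto simp: colour_part_def)
        also have "\<dots> = colour_part \<chi> (P \<inter> Q) e" unfolding f(3) using f(3) by (auto simp: colour_part_def)
        finally show ?thesis .
      qed
      then have im: "\<chi> ` (g \<inter> e) = P \<inter> Q" using col_part[OF e, of "P \<inter> Q"] PQk by auto
      have "g \<noteq> e"
      proof
        assume "g = e"
        then have "P \<inter> Q = {..<k}" using im colE[OF e] by simp
        then show False using PQ(1) Fs(2) by (auto simp: \<D>_def)
      qed
      then show "P \<inter> Q \<in> \<I>" using pat[OF g(1) e] im by simp
    next
      fix R assume R: "R \<subseteq> {..<k}" "card R < l"
      show "\<exists>P\<in>\<I>. R \<subseteq> P"
      proof (rule ccontr)
        assume none: "\<not> ?thesis"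
        \<comment> \<open>If no pattern contains \<open>R\<close>, the \<open>R\<close>-part is a
          private subset of each member, which leaves room for at most n^(l-1) members.\<close>
        have "inj_on (colour_part \<chi> R) Fs"
        proof (rule inj_onI, rule ccontr)
          fix a b assume ab: "a \<in> Fs" "b \<in> Fs" "colour_part \<chi> R a = colour_part \<chi> R b" "a \<noteq> b"
          have "colour_part \<chi> R a \<subseteq> a \<inter> b" using ab(3) by (auto simp: colour_part_def)
          then have "R \<subseteq> \<chi> ` (a \<inter> b)" using col_part[OF ab(1) R(1)] by (metis image_mono)
          then show False using none pat[OF ab(1,2,4)] by blast
        qed
        moreover have "colour_part \<chi> R ` Fs \<subseteq> [V]\<^bsup>card R\<^esup>"
        proof
          fix Y assume "Y \<in> colour_part \<chi> R ` Fs"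
          then obtain a where a: "a \<in> Fs" "Y = colour_part \<chi> R a" by blast
          have aF: "inj_on \<chi> a" "a \<subseteq> V" "finite a" using injE subV finE a(1) by blast+
          have "Y \<subseteq> a" using a(2) by (auto simp: colour_part_def)
          then have "card Y = card (\<chi> ` Y)" using aF by (metis card_image inj_on_subset)
          also have "\<dots> = card R" using col_part[OF a(1) R(1)] a(2) by simp
          finally show "Y \<in> [V]\<^bsup>card R\<^esup>" using \<open>Y \<subseteq> a\<close> aF finite_subset by (auto simp: nsets_def)
        qed
        ultimately have "card Fs \<le> card ([V]\<^bsup>card R\<^esup>)"
          using V by (meson card_inj_on_le finite_imp_finite_nsets)
        also have "\<dots> \<le> card V ^ card R" using card_nsets_le[OF V] .
        also have "\<dots> \<le> card V ^ (l - 1)" using R(2) Ve by (intro power_increasing) auto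
        finally show False using cFs by simp
      qed
    qed
    then obtain P where P: "P \<in> \<I>" "card P = m \<or> (l = m \<and> P = {})" by blast
    obtain f where f: "f \<in> Fs" "f \<noteq> e" "f \<inter> e = colour_part \<chi> P e" using witness[OF P(1)] by blast
    have "P \<subseteq> {..<k}" using P(1) Fs(2) by (auto simp: \<D>_def)
    then have im: "\<chi> ` (f \<inter> e) = P" using col_part[OF e] f(3) by simp
    moreover have "inj_on \<chi> (f \<inter> e)" using injE[OF e] by (meson inf_le2 inj_on_subset)
    ultimately have cP: "card (f \<inter> e) = card P" by (metis card_image)
    have "card (f \<inter> e) = m \<or> (l = m \<and> f \<inter> e = {})"
      using P(2)
    proof
      assume "l = m \<and> P = {}"
      then show ?thesis using im by blast
    qed (use cP in blast)
    moreover have "f \<in> F" "e \<in> F" using f(1) e Fs(1) by (auto simp: F1_def)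
    ultimately show ?thesis using f(2) by blast
  qed
  then show ?thesis by blast
qed

section \<open>The local lemma for random permutations\<close>

lemma card_typed_subsets:
  assumes S: "finite S"
  shows "card {Y. Y \<subseteq> S \<and> card (Y \<inter> A) = a \<and> card (Y - A) = b} =
    (card (S \<inter> A) choose a) * (card (S - A) choose b)"
proof -
  let ?P = "{Y. Y \<subseteq> S \<and> card (Y \<inter> A) = a \<and> card (Y - A) = b}"
  have "bij_betw (\<lambda>(Y, Z). Y \<union> Z) ([S \<inter> A]\<^bsup>a\<^esup> \<times> [S - A]\<^bsup>b\<^esup>) ?P"
    unfolding bij_betw_def
  proof
    show "inj_on (\<lambda>(Y, Z). Y \<union> Z) ([S \<inter> A]\<^bsup>a\<^esup> \<times> [S - A]\<^bsup>b\<^esup>)"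
      by (rule inj_on_inverseI[where g = "\<lambda>Y. (Y \<inter> A, Y - A)"]) (auto simp: nsets_def)
    show "(\<lambda>(Y, Z). Y \<union> Z) ` ([S \<inter> A]\<^bsup>a\<^esup> \<times> [S - A]\<^bsup>b\<^esup>) = ?P"
    proof
      show "(\<lambda>(Y, Z). Y \<union> Z) ` ([S \<inter> A]\<^bsup>a\<^esup> \<times> [S - A]\<^bsup>b\<^esup>) \<subseteq> ?P"
      proof clarsimp
        fix Y Z assume "Y \<in> [S \<inter> A]\<^bsup>a\<^esup>" "Z \<in> [S - A]\<^bsup>b\<^esup>"
        then have "(Y \<union> Z) \<inter> A = Y" "(Y \<union> Z) - A = Z" "Y \<subseteq> S" "Z \<subseteq> S" "card Y = a" "card Z = b"
          by (auto simp: nsets_def)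
        then show "Y \<subseteq> S \<and> Z \<subseteq> S \<and> card ((Y \<union> Z) \<inter> A) = a \<and> card (Y \<union> Z - A) = b" by simp
      qed
      show "?P \<subseteq> (\<lambda>(Y, Z). Y \<union> Z) ` ([S \<inter> A]\<^bsup>a\<^esup> \<times> [S - A]\<^bsup>b\<^esup>)"
      proof
        fix Y assume Y: "Y \<in> ?P"
        then have "finite Y" using S finite_subset by blast
        then have "(Y \<inter> A, Y - A) \<in> [S \<inter> A]\<^bsup>a\<^esup> \<times> [S - A]\<^bsup>b\<^esup>"
          using Y by (auto simp: nsets_def)
        moreover have "Y = (\<lambda>(Y, Z). Y \<union> Z) (Y \<inter> A, Y - A)" by auto
        ultimately show "Y \<in> (\<lambda>(Y, Z). Y \<union> Z) ` ([S \<inter> A]\<^bsup>a\<^esup> \<times> [S - A]\<^bsup>b\<^esup>)" by blast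
      qed
    qed
  qed
  then have "card ?P = card ([S \<inter> A]\<^bsup>a\<^esup> \<times> [S - A]\<^bsup>b\<^esup>)" by (simp add: bij_betw_same_card)
  then show ?thesis using S by (simp add: card_cartesian_product card_nsets)
qed

text \<open>The permutation is the involution that exchanges \<open>X - Y\<close> with
  \<open>Y - X\<close>, separately inside and outside \<open>A\<close>. The last property, that
  every moved point lies in \<open>X\<close> or is sent into \<open>X\<close>, is what the negative
  dependence of the events rests on.\<close>

lemma type_preserving_exchange:
  assumes X: "X \<subseteq> S" "finite S" and Y: "Y \<subseteq> S"
    and types: "card (Y \<inter> A) = card (X \<inter> A)" "card (Y - A) = card (X - A)"
  obtains \<tau> where "\<tau> permutes S" "\<And>v. \<tau> v \<in> A \<longleftrightarrow> v \<in> A" "\<tau> ` X = Y"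
    "\<And>v. v \<notin> X \<Longrightarrow> \<tau> v \<notin> X \<Longrightarrow> \<tau> v = v"
proof -
  have fin: "finite X" "finite Y" using assms finite_subset by blast+
  have eq: "card (P - Q) = card (Q - P)" if "finite P" "finite Q" "card P = card Q" for P Q :: "'a set"
    using card_Diff_subset_Int[of P Q] card_Diff_subset_Int[of Q P] that by (simp add: Int_commute)
  have "card (X \<inter> A - Y \<inter> A) = card (Y \<inter> A - X \<inter> A)" "card (X - A - (Y - A)) = card (Y - A - (X - A))"
    using eq fin types by auto
  then obtain g1 g2 where g1: "bij_betw g1 (X \<inter> A - Y \<inter> A) (Y \<inter> A - X \<inter> A)"
    and g2: "bij_betw g2 (X - A - (Y - A)) (Y - A - (X - A))"
    using fin by (metis finite_Diff finite_Int finite_same_card_bij)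
  define g where "g v = (if v \<in> A then g1 v else g2 v)" for v
  have "bij_betw g (X \<inter> A - Y \<inter> A) (Y \<inter> A - X \<inter> A)"
    using g1 by (rule bij_betw_cong[THEN iffD1, rotated]) (simp add: g_def)
  moreover have "bij_betw g (X - A - (Y - A)) (Y - A - (X - A))"
    using g2 by (rule bij_betw_cong[THEN iffD1, rotated]) (simp add: g_def)
  ultimately have "bij_betw g ((X \<inter> A - Y \<inter> A) \<union> (X - A - (Y - A))) ((Y \<inter> A - X \<inter> A) \<union> (Y - A - (X - A)))"
    by (rule bij_betw_combine) blast
  moreover have "(X \<inter> A - Y \<inter> A) \<union> (X - A - (Y - A)) = X - Y" "(Y \<inter> A - X \<inter> A) \<union> (Y - A - (X - A)) = Y - X"
    by blast+
  ultimately have g: "bij_betw g (X - Y) (Y - X)" by simp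
  have gA: "g v \<in> A \<longleftrightarrow> v \<in> A" if "v \<in> X - Y" for v
  proof (cases "v \<in> A")
    case True
    then show ?thesis using bij_betwE[OF g1] that by (auto simp: g_def)
  next
    case False
    then show ?thesis using bij_betwE[OF g2] that by (auto simp: g_def)
  qed
  define h where "h = inv_into (X - Y) g"
  have h: "bij_betw h (Y - X) (X - Y)" unfolding h_def by (rule bij_betw_inv_into[OF g])
  have hg: "h (g v) = v" if "v \<in> X - Y" for v
    using bij_betw_inv_into_left[OF g that] by (simp add: h_def)
  have gh: "g (h v) = v" if "v \<in> Y - X" for v
    using bij_betw_inv_into_right[OF g that] by (simp add: h_def)
  define \<tau> where "\<tau> v = (if v \<in> X - Y then g v else if v \<in> Y - X then h v else v)" for v
  have gm: "g v \<in> Y - X" if "v \<in> X - Y" for v using bij_betwE[OF g] that by blast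
  have hm: "h v \<in> X - Y" if "v \<in> Y - X" for v using bij_betwE[OF h] that by blast
  have inv: "\<tau> (\<tau> v) = v" for v
    using gm hm hg gh by (auto simp: \<tau>_def)
  show ?thesis
  proof
    show "\<tau> permutes S"
    proof (rule bij_imp_permutes)
      have "\<tau> v \<in> S" if "v \<in> S" for v using that gm[of v] hm[of v] assms by (auto simp: \<tau>_def)
      then show "bij_betw \<tau> S S" using inv by (intro bij_betw_byWitness[where f' = \<tau>]) auto
      show "\<tau> v = v" if "v \<notin> S" for v using that assms by (auto simp: \<tau>_def)
    qed
    have hA: "h v \<in> A \<longleftrightarrow> v \<in> A" if "v \<in> Y - X" for v
      using gA[OF hm[OF that]] gh[OF that] by simp
    show "\<tau> v \<in> A \<longleftrightarrow> v \<in> A" for v using gA hA by (simp add: \<tau>_def)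
    show "\<tau> ` X = Y"
    proof
      show "\<tau> ` X \<subseteq> Y" using gm by (auto simp: \<tau>_def)
      show "Y \<subseteq> \<tau> ` X"
      proof
        fix v assume "v \<in> Y"
        then have "\<tau> v \<in> X" using hm by (auto simp: \<tau>_def)
        then show "v \<in> \<tau> ` X" using inv[of v] by (metis imageI)
      qed
    qed
    show "\<tau> v = v" if "v \<notin> X" "\<tau> v \<notin> X" for v using that hm by (auto simp: \<tau>_def)
  qed
qed

locale typed_permutations =
  fixes S A :: "'a set"
  assumes finS: "finite S"
begin

definition perms :: "('a \<Rightarrow> 'a) set" where
  "perms = {\<phi>. \<phi> permutes S \<and> (\<forall>v. \<phi> v \<in> A \<longleftrightarrow> v \<in> A)}"

definition avoiding :: "('a set \<times> 'a set) set \<Rightarrow> ('a \<Rightarrow> 'a) set" where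
  "avoiding \<C> = {\<phi> \<in> perms. \<forall>(E, X)\<in>\<C>. \<phi> ` E \<noteq> X}"

text \<open>The number of subsets of \<open>S\<close> with the type of \<open>X\<close>. For
  \<open>E\<close> of the same type, a random member of \<open>perms\<close> maps \<open>E\<close>
  onto \<open>X\<close> with probability \<open>1 / placements X\<close>.\<close>

definition placements :: "'a set \<Rightarrow> nat" where
  "placements X = (card (S \<inter> A) choose card (X \<inter> A)) * (card (S - A) choose card (X - A))"

text \<open>The pair stands for the event that \<open>E\<close> is mapped onto \<open>X\<close>.
  Nonemptiness of \<open>E\<close> makes an event conflict with itself, so a bound on the sum over
  all conflicts also bounds its own probability.\<close>

definition event :: "'a set \<times> 'a set \<Rightarrow> bool" where
  "event = (\<lambda>(E, X). E \<subseteq> S \<and> X \<subseteq> S \<and> E \<noteq> {} \<and> card (X \<inter> A) = card (E \<inter> A) \<and> card (X - A) = card (E - A))"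

text \<open>The graph of the lopsided local lemma: events without common points, neither in the
  domain nor in the range, are negatively dependent.\<close>

definition conflict :: "'a set \<times> 'a set \<Rightarrow> 'a set \<times> 'a set \<Rightarrow> bool" where
  "conflict B C \<longleftrightarrow> fst B \<inter> fst C \<noteq> {} \<or> snd B \<inter> snd C \<noteq> {}"

lemma finite_perms: "finite perms"
  unfolding perms_def by (rule finite_subset[OF _ finite_permutations[OF finS]]) auto

lemma finite_avoiding: "finite (avoiding \<C>)"
  unfolding avoiding_def using finite_perms by simp

lemma placements_pos: "X \<subseteq> S \<Longrightarrow> placements X > 0"
  unfolding placements_def
  using finS card_mono[of "S \<inter> A" "X \<inter> A"] card_mono[of "S - A" "X - A"] by auto

text \<open>Negative dependence: composing with a permutation that exchanges \<open>X\<close> for another set of the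
  same type creates no event that is disjoint from \<open>(E, X)\<close>.\<close>

lemma placements_mult_le:
  assumes B: "event (E, X)" and disj: "\<And>E' X'. (E', X') \<in> \<C> \<Longrightarrow> E \<inter> E' = {} \<and> X \<inter> X' = {}"
  shows "placements X * card {\<phi> \<in> avoiding \<C>. \<phi> ` E = X} \<le> card (avoiding \<C>)"
proof -
  define \<X> where "\<X> = {Y. Y \<subseteq> S \<and> card (Y \<inter> A) = card (X \<inter> A) \<and> card (Y - A) = card (X - A)}"
  have ES: "E \<subseteq> S" "X \<subseteq> S" using B by (auto simp: event_def)
  have fin\<X>: "finite \<X>" unfolding \<X>_def using finS by auto
  have "card {\<phi> \<in> avoiding \<C>. \<phi> ` E = X} \<le> card {\<phi> \<in> avoiding \<C>. \<phi> ` E = Y}" if Y: "Y \<in> \<X>" for Y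
  proof -
    obtain \<tau> where \<tau>: "\<tau> permutes S" "\<And>v. \<tau> v \<in> A \<longleftrightarrow> v \<in> A" "\<tau> ` X = Y"
      "\<And>v. v \<notin> X \<Longrightarrow> \<tau> v \<notin> X \<Longrightarrow> \<tau> v = v"
      using type_preserving_exchange[OF ES(2) finS, of Y A] Y unfolding \<X>_def by blast
    have "inj_on (\<lambda>\<phi>. \<tau> \<circ> \<phi>) {\<phi> \<in> avoiding \<C>. \<phi> ` E = X}"
      using permutes_inj[OF \<tau>(1)] by (auto simp: inj_on_def fun_eq_iff dest: injD)
    moreover have "(\<lambda>\<phi>. \<tau> \<circ> \<phi>) ` {\<phi> \<in> avoiding \<C>. \<phi> ` E = X} \<subseteq> {\<phi> \<in> avoiding \<C>. \<phi> ` E = Y}"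
    proof clarify
      fix \<phi> assume \<phi>: "\<phi> \<in> avoiding \<C>" "X = \<phi> ` E"
      have p: "\<phi> permutes S" and t: "\<And>v. \<phi> v \<in> A \<longleftrightarrow> v \<in> A" using \<phi>(1) by (auto simp: avoiding_def perms_def)
      have "\<tau> \<circ> \<phi> \<in> perms" using permutes_compose[OF p \<tau>(1)] t \<tau>(2) by (simp add: perms_def)
      moreover have "(\<tau> \<circ> \<phi>) ` E' \<noteq> X'" if C: "(E', X') \<in> \<C>" for E' X'
      proof
        assume eq: "(\<tau> \<circ> \<phi>) ` E' = X'"
        have "\<tau> (\<phi> c) = \<phi> c" if "c \<in> E'" for c
        proof (rule \<tau>(4))
          have "c \<notin> E" using disj[OF C] that by blast
          then show "\<phi> c \<notin> X" using \<phi>(2) permutes_inj[OF p] by (auto dest: injD)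
          show "\<tau> (\<phi> c) \<notin> X" using disj[OF C] eq that by auto
        qed
        then have "\<phi> ` E' = X'" using eq by (auto simp: image_image)
        then show False using \<phi>(1) C by (auto simp: avoiding_def)
      qed
      ultimately show "\<tau> \<circ> \<phi> \<in> avoiding \<C> \<and> (\<tau> \<circ> \<phi>) ` E = Y"
        using \<tau>(3) \<phi>(2) by (auto simp: avoiding_def image_comp)
    qed
    ultimately show ?thesis
      using finite_avoiding by (intro card_inj_on_le[where f = "\<lambda>\<phi>. \<tau> \<circ> \<phi>"]) auto
  qed
  then have "card \<X> * card {\<phi> \<in> avoiding \<C>. \<phi> ` E = X} \<le> (\<Sum>Y\<in>\<X>. card {\<phi> \<in> avoiding \<C>. \<phi> ` E = Y})"
    using sum_mono[of \<X> "\<lambda>_. card {\<phi> \<in> avoiding \<C>. \<phi> ` E = X}"] by simp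
  also have "\<dots> = card (\<Union>Y\<in>\<X>. {\<phi> \<in> avoiding \<C>. \<phi> ` E = Y})"
    using fin\<X> finite_avoiding by (intro card_UN_disjoint[symmetric]) auto
  also have "\<dots> \<le> card (avoiding \<C>)"
    using finite_avoiding by (intro card_mono) auto
  finally show ?thesis
    using card_typed_subsets[OF finS] by (simp add: placements_def \<X>_def)
qed

context
  fixes \<B>
  assumes fin\<B>: "finite \<B>" and ev: "\<And>B. B \<in> \<B> \<Longrightarrow> event B"
    and sparse: "\<And>B. B \<in> \<B> \<Longrightarrow> (\<Sum>C | C \<in> \<B> \<and> conflict B C. 1 / real (placements (snd C))) \<le> 1/4"
begin

text \<open>The induction of the local lemma, written with cardinalities so that no conditional
  probability can be undefined: avoiding other events at most doubles the probability of an event.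
  The events that conflict with \<open>(E, X)\<close> are split off; the rest is handled by
  \<open>placements_mult_le\<close>.\<close>

lemma conditional_bound:
  assumes "\<C> \<subseteq> \<B>" "(E, X) \<in> \<B>" "(E, X) \<notin> \<C>"
  shows "real (card {\<phi> \<in> avoiding \<C>. \<phi> ` E = X}) \<le> 2 / real (placements X) * real (card (avoiding \<C>))"
  using assms
proof (induction "card \<C>" arbitrary: \<C> E X rule: less_induct)
  case less
  define \<C>1 where "\<C>1 = {C \<in> \<C>. conflict (E, X) C}"
  define \<C>2 where "\<C>2 = \<C> - \<C>1"
  have "finite \<C>" using less.prems(1) fin\<B> finite_subset by blast
  then have fin: "finite \<C>" "finite \<C>1" "finite \<C>2" by (simp_all add: \<C>1_def \<C>2_def)
  have XS: "X \<subseteq> S" using ev[OF less.prems(2)] by (simp add: event_def)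
  let ?N = "\<lambda>\<C>. real (card (avoiding \<C>))"
  have pos: "real (placements X) > 0" using placements_pos[OF XS] by simp
  have "placements X * card {\<phi> \<in> avoiding \<C>2. \<phi> ` E = X} \<le> card (avoiding \<C>2)"
    by (rule placements_mult_le[OF ev[OF less.prems(2)]]) (auto simp: \<C>2_def \<C>1_def conflict_def)
  then have a: "real (placements X) * real (card {\<phi> \<in> avoiding \<C>2. \<phi> ` E = X}) \<le> ?N \<C>2"
    by (metis of_nat_le_iff of_nat_mult)
  have "card {\<phi> \<in> avoiding \<C>. \<phi> ` E = X} \<le> card {\<phi> \<in> avoiding \<C>2. \<phi> ` E = X}"
  proof (rule card_mono)
    show "finite {\<phi> \<in> avoiding \<C>2. \<phi> ` E = X}" using finite_avoiding[of \<C>2] by simp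
    show "{\<phi> \<in> avoiding \<C>. \<phi> ` E = X} \<subseteq> {\<phi> \<in> avoiding \<C>2. \<phi> ` E = X}"
      by (auto simp: avoiding_def \<C>2_def)
  qed
  then have b: "real (placements X) * real (card {\<phi> \<in> avoiding \<C>. \<phi> ` E = X}) \<le> ?N \<C>2"
    using a pos by (meson mult_left_mono of_nat_mono order.trans less_imp_le)
  \<comment> \<open>Union bound over the conflicting events: by induction each has at most twice its
    probability given that \<C>2 is avoided, so together they remove at most 2 * 1/4, half of
    \<open>avoiding \<C>2\<close>.\<close>
  have c: "?N \<C>2 \<le> 2 * ?N \<C>"
  proof (cases "\<C>1 = {}")
    case True
    then show ?thesis by (simp add: \<C>2_def)
  next
    case False
    have sub: "avoiding \<C>2 \<subseteq> avoiding \<C> \<union> (\<Union>C\<in>\<C>1. {\<phi> \<in> avoiding \<C>2. \<phi> ` fst C = snd C})"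
    proof
      fix \<phi> assume \<phi>: "\<phi> \<in> avoiding \<C>2"
      show "\<phi> \<in> avoiding \<C> \<union> (\<Union>C\<in>\<C>1. {\<phi> \<in> avoiding \<C>2. \<phi> ` fst C = snd C})"
      proof (cases "\<exists>C\<in>\<C>1. \<phi> ` fst C = snd C")
        case False
        then have "\<phi> ` fst C \<noteq> snd C" if "C \<in> \<C>" for C
          using that \<phi> by (cases "C \<in> \<C>1") (auto simp: avoiding_def \<C>2_def case_prod_unfold)
        then show ?thesis using \<phi> by (simp add: avoiding_def case_prod_unfold)
      qed (use \<phi> in blast)
    qed
    have "card (avoiding \<C>2) \<le> card (avoiding \<C> \<union> (\<Union>C\<in>\<C>1. {\<phi> \<in> avoiding \<C>2. \<phi> ` fst C = snd C}))"
      using finite_avoiding fin by (intro card_mono sub) auto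
    also have "\<dots> \<le> card (avoiding \<C>) + card (\<Union>C\<in>\<C>1. {\<phi> \<in> avoiding \<C>2. \<phi> ` fst C = snd C})"
      by (rule card_Un_le)
    also have "\<dots> \<le> card (avoiding \<C>) + (\<Sum>C\<in>\<C>1. card {\<phi> \<in> avoiding \<C>2. \<phi> ` fst C = snd C})"
      using card_UN_le[OF fin(2)] by (intro add_left_mono)
    finally have "card (avoiding \<C>2) \<le> card (avoiding \<C>) + (\<Sum>C\<in>\<C>1. card {\<phi> \<in> avoiding \<C>2. \<phi> ` fst C = snd C})" .
    then have "?N \<C>2 \<le> ?N \<C> + (\<Sum>C\<in>\<C>1. real (card {\<phi> \<in> avoiding \<C>2. \<phi> ` fst C = snd C}))"
      by (simp only: of_nat_le_iff flip: of_nat_add of_nat_sum)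
    also have "(\<Sum>C\<in>\<C>1. real (card {\<phi> \<in> avoiding \<C>2. \<phi> ` fst C = snd C})) \<le>
        (\<Sum>C\<in>\<C>1. 2 * ?N \<C>2 * (1 / real (placements (snd C))))"
    proof (rule sum_mono)
      fix C assume C: "C \<in> \<C>1"
      have "card \<C>2 < card \<C>"
        using fin(1) False by (intro psubset_card_mono) (auto simp: \<C>1_def \<C>2_def)
      then have "real (card {\<phi> \<in> avoiding \<C>2. \<phi> ` fst C = snd C}) \<le> 2 / real (placements (snd C)) * ?N \<C>2"
        using C less.prems(1) by (intro less.hyps) (auto simp: \<C>2_def \<C>1_def)
      then show "real (card {\<phi> \<in> avoiding \<C>2. \<phi> ` fst C = snd C}) \<le> 2 * ?N \<C>2 * (1 / real (placements (snd C)))"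
        by (simp add: mult_ac)
    qed
    also have "\<dots> = 2 * ?N \<C>2 * (\<Sum>C\<in>\<C>1. 1 / real (placements (snd C)))"
      by (simp only: sum_distrib_left)
    also have "(\<Sum>C\<in>\<C>1. 1 / real (placements (snd C))) \<le> (\<Sum>C | C \<in> \<B> \<and> conflict (E, X) C. 1 / real (placements (snd C)))"
      using less.prems(1) fin\<B> by (intro sum_mono2) (auto simp: \<C>1_def)
    also have "\<dots> \<le> 1/4" by (rule sparse[OF less.prems(2)])
    finally have "?N \<C>2 \<le> ?N \<C> + 2 * ?N \<C>2 * (1/4)"
      by (smt (verit) mult_left_mono of_nat_0_le_iff)
    then show ?thesis by simp
  qed
  have "real (placements X) * real (card {\<phi> \<in> avoiding \<C>. \<phi> ` E = X}) \<le> 2 * ?N \<C>"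
    using b c by linarith
  then show ?case using pos by (simp add: field_simps)
qed

text \<open>Events are added one at a time, and each excludes at most half of the permutations that
  are still left.\<close>

lemma avoiding_nonempty: "avoiding \<B> \<noteq> {}"
proof -
  have "card (avoiding \<C>) > 0" if "finite \<C>" "\<C> \<subseteq> \<B>" for \<C>
    using that
  proof (induction \<C> rule: finite_induct)
    case empty
    have "id \<in> avoiding {}" by (simp add: avoiding_def perms_def permutes_id)
    then show ?case using finite_avoiding card_gt_0_iff by blast
  next
    case (insert B \<C>)
    obtain E X where B: "B = (E, X)" by fastforce
    have ins: "(E, X) \<in> \<B>" using insert.prems B by blast
    have evB: "event (E, X)" using ev ins by blast
    \<comment> \<open>The event is a term of its own conflict sum; hence its probability is at most
      1/4 and its conditional probability at most 1/2.\<close>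
    have self: "(E, X) \<in> {C. C \<in> \<B> \<and> conflict (E, X) C}"
      using ins evB by (auto simp: conflict_def event_def)
    have "1 / real (placements X) \<le> (\<Sum>C | C \<in> \<B> \<and> conflict (E, X) C. 1 / real (placements (snd C)))"
      using member_le_sum[OF self, of "\<lambda>C. 1 / real (placements (snd C))"] fin\<B> by simp
    then have q: "1 / real (placements X) \<le> 1/4" using sparse[OF ins] by linarith
    have "avoiding \<C> \<subseteq> avoiding (insert B \<C>) \<union> {\<phi> \<in> avoiding \<C>. \<phi> ` E = X}"
      unfolding avoiding_def B by fastforce
    then have "card (avoiding \<C>) \<le> card (avoiding (insert B \<C>) \<union> {\<phi> \<in> avoiding \<C>. \<phi> ` E = X})"
      using finite_avoiding by (intro card_mono) auto
    also have "\<dots> \<le> card (avoiding (insert B \<C>)) + card {\<phi> \<in> avoiding \<C>. \<phi> ` E = X}"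
      by (rule card_Un_le)
    finally have "real (card (avoiding \<C>)) \<le> real (card (avoiding (insert B \<C>))) + real (card {\<phi> \<in> avoiding \<C>. \<phi> ` E = X})"
      by linarith
    moreover have "real (card {\<phi> \<in> avoiding \<C>. \<phi> ` E = X}) \<le> 2 / real (placements X) * real (card (avoiding \<C>))"
      using insert B by (intro conditional_bound) auto
    moreover have "2 / real (placements X) * real (card (avoiding \<C>)) \<le> 1/2 * real (card (avoiding \<C>))"
      using q by (intro mult_right_mono) auto
    moreover have "card (avoiding \<C>) > 0" using insert by blast
    ultimately have "real (card (avoiding (insert B \<C>))) > 0" by linarith
    then show ?case by simp
  qed
  from this[OF fin\<B> order.refl] show ?thesis by auto
qed

end
end

section \<open>Counting typical sets\<close>

lemma card_containing_le:
  assumes V: "finite V" and w: "w > 0"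
  shows "card {W \<in> [V]\<^bsup>w\<^esup>. u \<in> W} \<le> card V ^ (w - 1)"
proof -
  have "inj_on (\<lambda>W. W - {u}) {W \<in> [V]\<^bsup>w\<^esup>. u \<in> W}"
    by (rule inj_on_inverseI[where g = "insert u"]) auto
  moreover have "(\<lambda>W. W - {u}) ` {W \<in> [V]\<^bsup>w\<^esup>. u \<in> W} \<subseteq> [V]\<^bsup>(w - 1)\<^esup>"
    by (auto simp: nsets_def)
  ultimately have "card {W \<in> [V]\<^bsup>w\<^esup>. u \<in> W} \<le> card ([V]\<^bsup>(w - 1)\<^esup>)"
    using V by (intro card_inj_on_le[where f = "\<lambda>W. W - {u}"]) (auto simp: finite_imp_finite_nsets)
  also have "\<dots> \<le> card V ^ (w - 1)" by (rule card_nsets_le[OF V])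
  finally show ?thesis .
qed

lemma card_meeting_le:
  assumes V: "finite V" and w: "w > 0" and U: "finite U"
  shows "card {W \<in> [V]\<^bsup>w\<^esup>. W \<inter> U \<noteq> {}} \<le> card U * card V ^ (w - 1)"
proof -
  have "{W \<in> [V]\<^bsup>w\<^esup>. W \<inter> U \<noteq> {}} = (\<Union>u\<in>U. {W \<in> [V]\<^bsup>w\<^esup>. u \<in> W})" by blast
  then have "card {W \<in> [V]\<^bsup>w\<^esup>. W \<inter> U \<noteq> {}} \<le> (\<Sum>u\<in>U. card {W \<in> [V]\<^bsup>w\<^esup>. u \<in> W})"
    using card_UN_le[OF U] by simp
  also have "\<dots> \<le> (\<Sum>u\<in>U. card V ^ (w - 1))" by (intro sum_mono card_containing_le V w)
  finally show ?thesis by simp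
qed

lemma power_split:
  fixes x :: "'b::monoid_mult"
  assumes "w > 0" shows "x * x ^ (w - 1) = x ^ w"
  using assms by (cases w) auto

lemma exists_disjoint_member:
  assumes V: "finite V" and W: "\<W> \<subseteq> [V]\<^bsup>w\<^esup>" "w > 0" and U: "finite U"
    and big: "c * real (card V) ^ w \<le> real (card \<W>)" and small: "real (card U) < c * real (card V)"
    and ne: "card V > 0"
  shows "\<exists>W\<in>\<W>. W \<inter> U = {}"
proof (rule ccontr)
  assume "\<not> ?thesis"
  then have "\<W> \<subseteq> {W \<in> [V]\<^bsup>w\<^esup>. W \<inter> U \<noteq> {}}" using W by blast
  then have "card \<W> \<le> card {W \<in> [V]\<^bsup>w\<^esup>. W \<inter> U \<noteq> {}}"
    using finite_imp_finite_nsets[OF V] by (intro card_mono) auto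
  also have "\<dots> \<le> card U * card V ^ (w - 1)" by (rule card_meeting_le[OF V W(2) U])
  finally have "card \<W> \<le> card U * card V ^ (w - 1)" .
  then have "real (card \<W>) \<le> real (card U * card V ^ (w - 1))" by (rule of_nat_mono)
  then have "real (card \<W>) \<le> real (card U) * real (card V) ^ (w - 1)" by simp
  also have "\<dots> < c * real (card V) * real (card V) ^ (w - 1)"
    using small ne by (intro mult_strict_right_mono) auto
  also have "\<dots> = c * real (card V) ^ w" by (simp only: mult.assoc power_split[OF W(2)])
  finally show False using big by simp
qed

lemma choose_ge_power:
  assumes x: "x \<le> real N" "0 \<le> x" and j: "j \<le> N" "j \<le> k" and k: "k > 0"
  shows "(x / real k) ^ j \<le> real (N choose j)"
proof (cases "j = 0")
  case False
  have "(x / real k) ^ j \<le> (real N / real j) ^ j"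
    using x j False k by (intro power_mono frac_le) auto
  also have "\<dots> \<le> real (N choose j)" by (rule binomial_ge_n_over_k_pow_k[OF j(1)])
  finally show ?thesis .
qed auto

lemma choose_mult_ge:
  assumes a: "x \<le> real N1" "x \<le> real N2" "0 \<le> x" "i + j \<le> k" "real k \<le> x" "k > 0"
  shows "(x / real k) ^ (i + j) \<le> real ((N1 choose i) * (N2 choose j))"
proof -
  have "i \<le> N1" "j \<le> N2" using a by linarith+
  then have "(x / real k) ^ i \<le> real (N1 choose i)" "(x / real k) ^ j \<le> real (N2 choose j)"
    using a by (auto intro: choose_ge_power)
  then show ?thesis using a by (auto simp: power_add intro: mult_mono)
qed

lemma card_typed_sets_ge:
  assumes U: "finite U" and x: "x \<le> real (card (U \<inter> A))" "x \<le> real (card (U - A))" "real k \<le> x"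
    and w: "i \<le> w" "w \<le> k" "0 < k"
  shows "(x / real k) ^ w \<le> real (card {Y \<in> [U]\<^bsup>w\<^esup>. card (Y \<inter> A) = i})"
proof -
  have "(x / real k) ^ (i + (w - i)) \<le> real ((card (U \<inter> A) choose i) * (card (U - A) choose (w - i)))"
    using x w by (intro choose_mult_ge) auto
  also have "\<dots> = real (card {Y. Y \<subseteq> U \<and> card (Y \<inter> A) = i \<and> card (Y - A) = w - i})"
    by (simp add: card_typed_subsets[OF U])
  also have "\<dots> \<le> real (card {Y \<in> [U]\<^bsup>w\<^esup>. card (Y \<inter> A) = i})"
  proof (intro of_nat_mono card_mono)
    show "finite {Y \<in> [U]\<^bsup>w\<^esup>. card (Y \<inter> A) = i}" using finite_imp_finite_nsets[OF U] by simp
    show "{Y. Y \<subseteq> U \<and> card (Y \<inter> A) = i \<and> card (Y - A) = w - i} \<subseteq> {Y \<in> [U]\<^bsup>w\<^esup>. card (Y \<inter> A) = i}"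
    proof clarify
      fix Y assume Y: "Y \<subseteq> U" "i = card (Y \<inter> A)" "card (Y - A) = w - card (Y \<inter> A)"
      have f: "finite Y" using Y(1) U finite_subset by blast
      have "card Y = card (Y \<inter> A) + card (Y - A)" by (rule card_Int_Diff[OF f])
      then show "Y \<in> [U]\<^bsup>w\<^esup> \<and> card (Y \<inter> A) = card (Y \<inter> A)" using Y w f by (simp add: nsets_def)
    qed
  qed
  finally show ?thesis using w by simp
qed

lemma parity_sets_many:
  assumes U: "finite U" and x: "x \<le> real (card (U \<inter> A))" "x \<le> real (card (U - A))" "real k \<le> x"
    and w: "0 < w" "w \<le> k"
  shows "(x / real k) ^ w \<le> real (card {Y \<in> [U]\<^bsup>w\<^esup>. even (card (Y \<inter> A) + c)})"
proof -
  define i where "i = (if even c then 0 else 1 :: nat)"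
  have i: "i \<le> w" "even (i + c)" using w by (auto simp: i_def)
  have "(x / real k) ^ w \<le> real (card {Y \<in> [U]\<^bsup>w\<^esup>. card (Y \<inter> A) = i})"
    using x w i by (intro card_typed_sets_ge U) auto
  also have "\<dots> \<le> real (card {Y \<in> [U]\<^bsup>w\<^esup>. even (card (Y \<inter> A) + c)})"
    using i finite_imp_finite_nsets[OF U] by (intro of_nat_mono card_mono) auto
  finally show ?thesis .
qed

text \<open>Here \<open>V1\<close> consists of the vertices that meet few right edges missing from \<open>H\<close>.
  An edge is right if it belongs to the parity graph: \<open>p = 1\<close> for
  $\mathcal{B}_{n,k}(A, V \setminus A)$ and \<open>p = 0\<close> for its complement.\<close>

locale near_parity =
  fixes V A V1 :: "'a set" and H :: "'a set set" and k l m p :: nat and g \<eta> \<delta> :: real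
  assumes finV: "finite V" and AV: "A \<subseteq> V" and V1V: "V1 \<subseteq> V" and HV: "H \<subseteq> [V]\<^bsup>k\<^esup>"
    and klm: "k = l + m" "m \<le> l" "m > 0" "k \<ge> 7"
    and gpos: "g > 0" and \<eta>pos: "\<eta> > 0" and \<delta>pos: "\<delta> > 0"
    and gsmall: "g \<le> (1 / (4 * real k)) ^ k" and \<eta>small: "36 * \<eta> \<le> g"
    and \<delta>small: "8 * 2 ^ k * \<delta> \<le> g * \<eta>"
    and nbig: "1000 * real k \<le> g * real (card V)"
    and A1: "real (card V) \<le> 3 * real (card (V1 \<inter> A))"
    and B1: "real (card V) \<le> 3 * real (card (V1 - A))"
    and missing: "\<And>v. v \<in> V1 \<Longrightarrow>
      real (card {e \<in> [V1]\<^bsup>k\<^esup>. v \<in> e \<and> even (card (e \<inter> A) + p) \<and> e \<notin> H}) \<le> \<delta> * real (card V) ^ (k - 1)"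
    and bad: "\<And>v. v \<in> V - V1 \<Longrightarrow>
      2 * g * real (card V) ^ (k - 1) \<le> real (card {X \<in> [V1]\<^bsup>(k - 1)\<^esup>. insert v X \<in> H \<and>
        even (card (insert v X \<inter> A) + p) \<and> X \<inter> A \<noteq> {} \<and> X - A \<noteq> {}})"
    and codegree: "\<And>Z. Z \<in> [V]\<^bsup>l\<^esup> \<Longrightarrow>
      2 * g * real (card V) ^ m \<le> real (card {W \<in> [V1]\<^bsup>m\<^esup>. W \<inter> Z = {} \<and> Z \<union> W \<in> H})"
begin

abbreviation n :: nat where "n \<equiv> card V"

abbreviation right :: "'a set \<Rightarrow> bool" where "right e \<equiv> even (card (e \<inter> A) + p)"

definition blocked :: "'a set \<Rightarrow> 'a set set" where
  "blocked W = {Z \<in> [V1]\<^bsup>(k - card W)\<^esup>. Z \<inter> W = {} \<and> right (W \<union> Z) \<and> W \<union> Z \<notin> H}"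

text \<open>Blocks at the ends of paths are kept typical: almost every completion of the right
  parity is then an edge, so the path can be continued and joined to others.\<close>

definition typical :: "'a set \<Rightarrow> bool" where
  "typical W \<longleftrightarrow> W \<subseteq> V1 \<and> real (card (blocked W)) \<le> \<eta> * real n ^ (k - card W)"

definition miss :: "'a set set" where
  "miss = {e \<in> [V1]\<^bsup>k\<^esup>. right e \<and> e \<notin> H}"

lemma kpos: "k > 0" using klm by simp

lemma npos: "n > 0"
proof (rule ccontr)
  assume "\<not> n > 0"
  then show False using nbig klm(4) by simp
qed

lemma finV1: "finite V1" using finV V1V finite_subset by blast

lemma V1_nsets: "[V1]\<^bsup>w\<^esup> \<subseteq> [V]\<^bsup>w\<^esup>" using V1V by (auto simp: nsets_def)

lemma fin_nsets: "finite ([V]\<^bsup>w\<^esup>)" "finite ([V1]\<^bsup>w\<^esup>)"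
  using finV finV1 by (simp_all add: finite_imp_finite_nsets)

lemma finH: "finite H" using HV fin_nsets finite_subset by blast

lemma g_less_1: "g \<le> 1"
proof -
  have "(1 / (4 * real k)) ^ k \<le> 1" using kpos by (intro power_le_one) (auto simp: field_simps)
  then show ?thesis using gsmall by linarith
qed

lemma n_ge_3k: "real k \<le> real n / 3"
  using nbig g_less_1 mult_right_mono[OF g_less_1, of "real n"] by linarith

lemma card_miss: "real (card miss) \<le> \<delta> * real n ^ k"
proof -
  have "miss \<subseteq> (\<Union>v\<in>V1. {e \<in> [V1]\<^bsup>k\<^esup>. v \<in> e \<and> right e \<and> e \<notin> H})"
  proof
    fix e assume e: "e \<in> miss"
    then have "e \<noteq> {}" "e \<subseteq> V1" using kpos by (auto simp: miss_def nsets_def)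
    then show "e \<in> (\<Union>v\<in>V1. {e \<in> [V1]\<^bsup>k\<^esup>. v \<in> e \<and> right e \<and> e \<notin> H})"
      using e by (auto simp: miss_def)
  qed
  then have "card miss \<le> card (\<Union>v\<in>V1. {e \<in> [V1]\<^bsup>k\<^esup>. v \<in> e \<and> right e \<and> e \<notin> H})"
    using finV1 fin_nsets by (intro card_mono) auto
  also have "\<dots> \<le> (\<Sum>v\<in>V1. card {e \<in> [V1]\<^bsup>k\<^esup>. v \<in> e \<and> right e \<and> e \<notin> H})"
    by (rule card_UN_le[OF finV1])
  finally have "real (card miss) \<le> (\<Sum>v\<in>V1. real (card {e \<in> [V1]\<^bsup>k\<^esup>. v \<in> e \<and> right e \<and> e \<notin> H}))"
    by (simp only: of_nat_le_iff flip: of_nat_sum)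
  also have "\<dots> \<le> (\<Sum>v\<in>V1. \<delta> * real n ^ (k - 1))" by (intro sum_mono missing)
  also have "\<dots> = real (card V1) * (\<delta> * real n ^ (k - 1))" by simp
  also have "\<dots> \<le> real n * (\<delta> * real n ^ (k - 1))"
    using card_mono[OF finV V1V] \<delta>pos by (intro mult_right_mono) auto
  also have "\<dots> = \<delta> * (real n * real n ^ (k - 1))" by (simp only: mult_ac)
  also have "\<dots> = \<delta> * real n ^ k" by (simp only: power_split[OF kpos])
  finally show ?thesis .
qed

text \<open>Double counting of pairs of an atypical set and a missing edge above it: every atypical
  set has more than \<eta> n^(k-w) such edges, and a missing edge has at most 2^k subsets. The bound
  on \<delta> is made for this quotient.\<close>

lemma card_atypical:
  assumes w: "0 < w" "w < k"
  shows "real (card {W \<in> [V1]\<^bsup>w\<^esup>. \<not> typical W}) \<le> g / 8 * real n ^ w"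
proof -
  define T where "T = {W \<in> [V1]\<^bsup>w\<^esup>. \<not> typical W}"
  have finT: "finite T" using fin_nsets by (simp add: T_def)
  have finZ: "finite (blocked W)" for W using fin_nsets by (simp add: blocked_def)
  have lower: "\<eta> * real n ^ (k - w) \<le> real (card (blocked W))" if "W \<in> T" for W
    using that by (auto simp: T_def typical_def nsets_def)
  have "inj_on (\<lambda>(W, Z). (W \<union> Z, W)) (Sigma T blocked)"
    by (rule inj_on_inverseI[where g = "\<lambda>(e, W). (W, e - W)"]) (auto simp: blocked_def)
  moreover have "(\<lambda>(W, Z). (W \<union> Z, W)) ` Sigma T blocked \<subseteq> Sigma miss Pow"
  proof clarify
    fix W Z assume W: "W \<in> T" and Z: "Z \<in> blocked W"
    have "finite W" "finite Z" "card W = w" "card Z = k - w" "W \<inter> Z = {}" "W \<union> Z \<subseteq> V1"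
      using W Z by (auto simp: T_def blocked_def nsets_def)
    then have "W \<union> Z \<in> [V1]\<^bsup>k\<^esup>" using w by (simp add: nsets_def card_Un_disjoint)
    then show "W \<union> Z \<in> miss \<and> W \<in> Pow (W \<union> Z)" using Z by (auto simp: miss_def blocked_def)
  qed
  moreover have finmiss: "finite miss" using fin_nsets by (simp add: miss_def)
  moreover have "finite (Sigma miss Pow)"
    using finmiss by (intro finite_SigmaI) (auto simp: miss_def nsets_def)
  ultimately have "card (Sigma T blocked) \<le> card (Sigma miss Pow)"
    by (intro card_inj_on_le)
  also have "\<dots> = (\<Sum>e\<in>miss. 2 ^ k)"
    using finmiss by (subst card_SigmaI) (auto simp: miss_def nsets_def card_Pow)
  finally have up: "card (Sigma T blocked) \<le> card miss * 2 ^ k" by simp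
  have "real (card T) * (\<eta> * real n ^ (k - w)) = (\<Sum>W\<in>T. \<eta> * real n ^ (k - w))" by simp
  also have "\<dots> \<le> (\<Sum>W\<in>T. real (card (blocked W)))" by (intro sum_mono lower)
  also have "\<dots> = real (card (Sigma T blocked))" using finT finZ by (simp add: card_SigmaI)
  also have "\<dots> \<le> real (card miss) * 2 ^ k" using up by (metis of_nat_le_iff of_nat_mult of_nat_numeral of_nat_power)
  also have "\<dots> \<le> \<delta> * real n ^ k * 2 ^ k" using card_miss by (intro mult_right_mono) auto
  also have "\<dots> = (2 ^ k * \<delta>) * real n ^ k" by (simp only: mult_ac)
  also have "\<dots> \<le> (g * \<eta> / 8) * real n ^ k" using \<delta>small by (intro mult_right_mono) auto
  also have "\<dots> = (g / 8 * real n ^ w) * (\<eta> * real n ^ (k - w))"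
  proof -
    have "real n ^ k = real n ^ w * real n ^ (k - w)" using w by (simp flip: power_add)
    then show ?thesis by simp
  qed
  finally have "real (card T) * (\<eta> * real n ^ (k - w)) \<le> (g / 8 * real n ^ w) * (\<eta> * real n ^ (k - w))" .
  moreover have "\<eta> * real n ^ (k - w) > 0" using \<eta>pos npos by simp
  ultimately show ?thesis unfolding T_def by (meson mult_le_cancel_right_pos)
qed

text \<open>Of the density \<open>g / 4\<close>, at most \<open>g / 8\<close> is atypical, and
  \<open>U\<close> is too small to meet all the remaining sets.\<close>

lemma exists_typical:
  assumes W: "\<W> \<subseteq> [V1]\<^bsup>w\<^esup>" and w: "0 < w" "w < k" and U: "finite U"
    and big: "g / 4 * real n ^ w \<le> real (card \<W>)" and small: "real (card U) < g / 8 * real n"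
  shows "\<exists>W\<in>\<W>. typical W \<and> W \<inter> U = {}"
proof -
  have fin: "finite \<W>" using W fin_nsets finite_subset by blast
  have "\<exists>W\<in>{W \<in> \<W>. typical W}. W \<inter> U = {}"
  proof (rule exists_disjoint_member[OF finV _ w(1) U _ small npos])
    show "{W \<in> \<W>. typical W} \<subseteq> [V]\<^bsup>w\<^esup>" using W V1_nsets by blast
    have "\<W> \<subseteq> {W \<in> \<W>. typical W} \<union> {W \<in> [V1]\<^bsup>w\<^esup>. \<not> typical W}" using W by blast
    then have "card \<W> \<le> card ({W \<in> \<W>. typical W} \<union> {W \<in> [V1]\<^bsup>w\<^esup>. \<not> typical W})"
      using fin fin_nsets by (intro card_mono) auto
    also have "\<dots> \<le> card {W \<in> \<W>. typical W} + card {W \<in> [V1]\<^bsup>w\<^esup>. \<not> typical W}" by (rule card_Un_le)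
    finally have "real (card \<W>) \<le> real (card {W \<in> \<W>. typical W}) + real (card {W \<in> [V1]\<^bsup>w\<^esup>. \<not> typical W})"
      by linarith
    then show "g / 8 * real n ^ w \<le> real (card {W \<in> \<W>. typical W})"
      using card_atypical[OF w] big by simp
  qed
  then show ?thesis by blast
qed

lemma typed_many:
  assumes w: "0 < w" "w \<le> k"
  shows "g * real n ^ w \<le> real (card {Y \<in> [V1]\<^bsup>w\<^esup>. even (card (Y \<inter> A) + c)})"
proof -
  have "g * real n ^ w \<le> (1 / (3 * real k)) ^ w * real n ^ w"
  proof (intro mult_right_mono)
    have "(1 / (4 * real k)) ^ k \<le> (1 / (4 * real k)) ^ w"
      using w kpos by (intro power_decreasing) (auto simp: field_simps)
    also have "\<dots> \<le> (1 / (3 * real k)) ^ w"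
      using kpos by (intro power_mono) (auto simp: field_simps)
    finally show "g \<le> (1 / (3 * real k)) ^ w" using gsmall by linarith
  qed simp
  also have "\<dots> = (real n / 3 / real k) ^ w"
    by (simp add: power_divide power_mult_distrib)
  also have "\<dots> \<le> real (card {Y \<in> [V1]\<^bsup>w\<^esup>. even (card (Y \<inter> A) + c)})"
    using A1 B1 n_ge_3k w kpos by (intro parity_sets_many finV1) auto
  finally show ?thesis .
qed

lemma typical_subset: "typical W \<Longrightarrow> W \<subseteq> V1 \<and> finite W"
  unfolding typical_def using finV1 finite_subset by blast

text \<open>The candidates of the parity \<open>c\<close> have density at least \<open>g\<close>,
  while the two blocked families take at most 2 * \<eta> of it. The sets \<open>W\<close> and
  \<open>W'\<close> may overlap or coincide.\<close>

lemma common_extension: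
  assumes W: "typical W" "typical W'" "card W = w" "card W' = w" "0 < w" "w < k"
    and par: "even (c + card (W \<inter> A) + p)" "even (c + card (W' \<inter> A) + p)"
    and U: "finite U" "real (card U) < g / 16 * real n"
  shows "\<exists>Y. typical Y \<and> Y \<subseteq> V1 \<and> card Y = k - w \<and> even (card (Y \<inter> A) + c) \<and> Y \<inter> U = {} \<and>
    Y \<inter> W = {} \<and> Y \<inter> W' = {} \<and> W \<union> Y \<in> H \<and> W' \<union> Y \<in> H"
proof -
  define Q where "Q = {Y \<in> [V1]\<^bsup>(k - w)\<^esup>. even (card (Y \<inter> A) + c)}"
  have fin: "finite W" "finite W'" using W typical_subset by blast+
  have w': "0 < k - w" "k - w < k" using W by auto
  have Nle: "real (card (blocked W)) \<le> \<eta> * real n ^ (k - w)" "real (card (blocked W')) \<le> \<eta> * real n ^ (k - w)"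
    using W by (auto simp: typical_def)
  have finN: "finite (blocked X)" for X using fin_nsets by (simp add: blocked_def)
  have finQ: "finite Q" using fin_nsets by (simp add: Q_def)
  have "\<exists>Y\<in>Q - blocked W - blocked W'. typical Y \<and> Y \<inter> (U \<union> W \<union> W') = {}"
  proof (rule exists_typical[OF _ w'])
    show "Q - blocked W - blocked W' \<subseteq> [V1]\<^bsup>(k - w)\<^esup>" by (auto simp: Q_def)
    show "finite (U \<union> W \<union> W')" using U fin by simp
    have "g * real n ^ (k - w) \<le> real (card Q)"
      unfolding Q_def by (rule typed_many) (use w' in auto)
    moreover have "real (card Q) \<le> real (card (Q - blocked W - blocked W')) + real (card (blocked W)) + real (card (blocked W'))"
    proof -
      have "card Q \<le> card ((Q - blocked W - blocked W') \<union> blocked W \<union> blocked W')" using finN finQ by (intro card_mono) auto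
      also have "\<dots> \<le> card (Q - blocked W - blocked W') + card (blocked W) + card (blocked W')"
        by (meson card_Un_le order.trans add_right_mono)
      finally show ?thesis by linarith
    qed
    moreover have "\<eta> * real n ^ (k - w) \<le> g / 8 * real n ^ (k - w)"
      using \<eta>small \<eta>pos by (intro mult_right_mono) auto
    moreover have "0 \<le> g * real n ^ (k - w)" using gpos by simp
    ultimately show "g / 4 * real n ^ (k - w) \<le> real (card (Q - blocked W - blocked W'))"
      using Nle by (simp add: field_simps)
    have "card (U \<union> W \<union> W') \<le> card U + w + w"
      using card_Un_le[of "U \<union> W" W'] card_Un_le[of U W] W by linarith
    then show "real (card (U \<union> W \<union> W')) < g / 8 * real n"
      using U nbig W by linarith
  qed
  then obtain Y where Y: "Y \<in> Q" "Y \<notin> blocked W" "Y \<notin> blocked W'" "typical Y" "Y \<inter> (U \<union> W \<union> W') = {}" by blast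
  have YV: "Y \<subseteq> V1" "finite Y" "card Y = k - w" "even (card (Y \<inter> A) + c)"
    using Y(1) by (auto simp: Q_def nsets_def)
  have rt: "right (X \<union> Y)" if "X = W \<or> X = W'" for X
  proof -
    have "(X \<union> Y) \<inter> A = (X \<inter> A) \<union> (Y \<inter> A)" by blast
    moreover have "(X \<inter> A) \<inter> (Y \<inter> A) = {}" using that Y(5) by blast
    moreover have "finite X" using that fin by blast
    ultimately have "card ((X \<union> Y) \<inter> A) = card (X \<inter> A) + card (Y \<inter> A)"
      using YV(2) by (simp add: card_Un_disjoint)
    then show ?thesis using par YV(4) that by auto
  qed
  have Yn: "Y \<in> [V1]\<^bsup>(k - w)\<^esup>" using Y(1) by (simp add: Q_def)
  have "W \<union> Y \<in> H"
  proof (rule ccontr)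
    assume "W \<union> Y \<notin> H"
    then have "Y \<in> blocked W" using rt[of W] Yn Y(5) by (auto simp: blocked_def W(3,4))
    then show False using Y(2) by simp
  qed
  moreover have "W' \<union> Y \<in> H"
  proof (rule ccontr)
    assume "W' \<union> Y \<notin> H"
    then have "Y \<in> blocked W'" using rt[of W'] Yn Y(5) by (auto simp: blocked_def W(3,4))
    then show False using Y(3) by simp
  qed
  moreover have "Y \<inter> U = {}" "Y \<inter> W = {}" "Y \<inter> W' = {}" using Y(5) by auto
  ultimately show ?thesis using Y(4) YV by blast
qed

end

section \<open>Paths of blocks\<close>

lemma card_Un_inter:
  assumes "finite X" "finite Y" "X \<inter> Y = {}"
  shows "card ((X \<union> Y) \<inter> A) = card (X \<inter> A) + card (Y \<inter> A)"
proof -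
  have "(X \<union> Y) \<inter> A = (X \<inter> A) \<union> (Y \<inter> A)" "(X \<inter> A) \<inter> (Y \<inter> A) = {}" using assms by auto
  then show ?thesis using assms by (simp add: card_Un_disjoint)
qed

lemma card_inter_split:
  assumes "finite e" "R \<subseteq> e"
  shows "card (e \<inter> A) = card ((e - R) \<inter> A) + card (R \<inter> A)"
  using card_Un_inter[of "e - R" R A] assms finite_subset by (auto simp: Un_absorb2)

text \<open>A set of \<open>j - 1\<close> elements is completed either by a vertex of
  \<open>A\<close> or by one outside \<open>A\<close>, whichever gives the parity. This is why edges
  at exceptional vertices are required to meet both classes.\<close>

lemma subset_with_parity:
  assumes e: "finite e" "e \<inter> A \<noteq> {}" "e - A \<noteq> {}" and j: "0 < j" "j < card e"
  shows "\<exists>L\<subseteq>e. card L = j \<and> even (card (L \<inter> A) + c)"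
proof -
  obtain x y where xy: "x \<in> e" "x \<in> A" "y \<in> e" "y \<notin> A" using e by blast
  have "card {x, y} = 2" using xy by (metis card_2_iff)
  then have "card (e - {x, y}) = card e - 2" using e xy by (subst card_Diff_subset) auto
  then have "j - 1 \<le> card (e - {x, y})" using j by linarith
  then obtain K where K: "K \<subseteq> e - {x, y}" "card K = j - 1" "finite K"
    using obtain_subset_with_card_n by metis
  have "x \<notin> K" "y \<notin> K" using K(1) by auto
  then have cK: "card (insert x K) = j" "card (insert y K) = j"
    using K(2,3) j by (simp_all add: card_insert_disjoint)
  show ?thesis
  proof (cases "even (card (K \<inter> A) + c)")
    case True
    have "insert y K \<inter> A = K \<inter> A" using xy by auto
    then show ?thesis using True K xy cK by (intro exI[of _ "insert y K"]) auto
  next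
    case False
    have "insert x K \<inter> A = insert x (K \<inter> A)" using xy by auto
    then have "card (insert x K \<inter> A) = Suc (card (K \<inter> A))" using K(3) \<open>x \<notin> K\<close> by simp
    then show ?thesis using False K xy cK by (intro exI[of _ "insert x K"]) auto
  qed
qed

context near_parity
begin

definition role_size :: "bool \<Rightarrow> nat" where
  "role_size r = (if r then l else m)"

definition role_parity :: "nat \<Rightarrow> nat \<Rightarrow> bool \<Rightarrow> nat" where
  "role_parity a b r = (if r then a else b)"

fun shape :: "bool \<Rightarrow> 'a set list \<Rightarrow> bool" where
  "shape r [] \<longleftrightarrow> True"
| "shape r (W # xs) \<longleftrightarrow> W \<subseteq> V \<and> card W = role_size r \<and> shape (\<not> r) xs"

fun parity_sum :: "nat \<Rightarrow> nat \<Rightarrow> bool \<Rightarrow> 'a set list \<Rightarrow> nat" where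
  "parity_sum a b r [] = 0"
| "parity_sum a b r (W # xs) = role_parity a b r + parity_sum a b (\<not> r) xs"

definition A_sum :: "'a set list \<Rightarrow> nat" where
  "A_sum xs = sum_list (map (\<lambda>W. card (W \<inter> A)) xs)"

definition verts :: "'a set list \<Rightarrow> 'a set" where
  "verts xs = \<Union> (set xs)"

text \<open>A path lists the blocks of a segment of a Hamilton cycle; \<open>r\<close> tells whether the first one
  plays the role of some \<open>L i\<close> (and not of some \<open>R i\<close>). At both ends the number of vertices
  in \<open>A\<close> has the parity \<open>a\<close> (for an \<open>L i\<close>) or \<open>b\<close> (for an \<open>R i\<close>), whereas \<open>w\<close> records the parity
  of the number of blocks in between that violate this.\<close>

definition path :: "nat \<Rightarrow> nat \<Rightarrow> bool \<Rightarrow> nat \<Rightarrow> 'a set list \<Rightarrow> bool" where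
  "path a b r w xs \<longleftrightarrow> xs \<noteq> [] \<and> shape r xs \<and> sorted_wrt (\<lambda>X Y. X \<inter> Y = {}) xs \<and>
     successively (\<lambda>X Y. X \<union> Y \<in> H) xs \<and> typical (hd xs) \<and> typical (last xs) \<and>
     even (card (hd xs \<inter> A) + role_parity a b r) \<and>
     even (card (last xs \<inter> A) + role_parity a b (r = odd (length xs))) \<and>
     even (A_sum xs + parity_sum a b r xs + w)"

lemma role_size_bounds: "0 < role_size r" "role_size r < k" "role_size r + role_size (\<not> r) = k"
  "k - role_size r = role_size (\<not> r)"
  using klm by (auto simp: role_size_def)

lemma role_parity_not: "even (a + b + p) \<Longrightarrow> even (role_parity a b (\<not> r) + role_parity a b r + p)"
  by (auto simp: role_parity_def add_ac)

text \<open>\<open>r = even (length xs)\<close> is \<open>r\<close> flipped \<open>length xs\<close>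
  times, the role of the first block after \<open>xs\<close>; correspondingly the last block of
  \<open>xs\<close> has the role \<open>r = odd (length xs)\<close>.\<close>

lemma shape_append: "shape r (xs @ ys) \<longleftrightarrow> shape r xs \<and> shape (r = even (length xs)) ys"
proof (induction xs arbitrary: r)
  case (Cons W xs)
  have "((\<not> r) = even (length xs)) = (r = even (length (W # xs)))" by auto
  then show ?case using Cons[of "\<not> r"] by simp
qed simp

lemma parity_sum_append:
  "parity_sum a b r (xs @ ys) = parity_sum a b r xs + parity_sum a b (r = even (length xs)) ys"
proof (induction xs arbitrary: r)
  case (Cons W xs)
  have "((\<not> r) = even (length xs)) = (r = even (length (W # xs)))" by auto
  then show ?case using Cons[of "\<not> r"] by simp
qed simp

lemma verts_append: "verts (xs @ ys) = verts xs \<union> verts ys"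
  by (auto simp: verts_def)

lemma shape_verts:
  assumes "shape r xs"
  shows "verts xs \<subseteq> V \<and> finite (verts xs) \<and> card (verts xs) \<le> k * length xs"
  using assms
proof (induction xs arbitrary: r)
  case Nil
  then show ?case by (simp add: verts_def)
next
  case (Cons W xs)
  have IH: "verts xs \<subseteq> V" "finite (verts xs)" "card (verts xs) \<le> k * length xs"
    using Cons by auto
  have W: "W \<subseteq> V" "card W \<le> k" using Cons.prems role_size_bounds(2)[of r] by auto
  have "verts (W # xs) = W \<union> verts xs" by (auto simp: verts_def)
  moreover have "card (W \<union> verts xs) \<le> card W + card (verts xs)" by (rule card_Un_le)
  ultimately show ?case using IH W finV finite_subset by auto
qed

lemma path_verts:
  assumes "path a b r w xs"
  shows "verts xs \<subseteq> V" "finite (verts xs)" "card (verts xs) \<le> k * length xs"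
  using shape_verts assms unfolding path_def by blast+

lemma path_ends:
  assumes "path a b r w xs"
  shows "hd xs \<in> set xs" "last xs \<in> set xs" "card (hd xs) = role_size r"
    "card (last xs) = role_size (r = odd (length xs))"
proof -
  have ne: "xs \<noteq> []" and sh: "shape r xs" using assms by (auto simp: path_def)
  show "hd xs \<in> set xs" "last xs \<in> set xs" using ne by auto
  show "card (hd xs) = role_size r" using ne sh by (cases xs) auto
  have "shape r (butlast xs @ [last xs])" using ne sh by simp
  then have "card (last xs) = role_size (r = even (length (butlast xs)))" by (simp only: shape_append shape.simps)
  moreover have "even (length (butlast xs)) \<longleftrightarrow> odd (length xs)" using ne by (cases xs) auto
  ultimately show "card (last xs) = role_size (r = odd (length xs))" by simp
qed

lemma path_single:
  assumes "typical W" "card W = role_size r" "even (card (W \<inter> A) + role_parity a b r)"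
  shows "path a b r 0 [W]"
  using assms typical_subset[OF assms(1)] V1V by (auto simp: path_def A_sum_def)

lemma path_append:
  assumes xs: "path a b r w xs" and ys: "path a b (r = even (length xs)) w' ys"
    and e: "last xs \<union> hd ys \<in> H" and disj: "verts xs \<inter> verts ys = {}"
  shows "path a b r (w + w') (xs @ ys)"
proof -
  have ne: "xs \<noteq> []" "ys \<noteq> []" using xs ys by (auto simp: path_def)
  have "(r = even (length xs)) = odd (length ys) \<longleftrightarrow> r = odd (length (xs @ ys))" by auto
  moreover have "sorted_wrt (\<lambda>X Y. X \<inter> Y = {}) (xs @ ys)"
    using xs ys disj by (auto simp: sorted_wrt_append path_def verts_def)
  moreover have "successively (\<lambda>X Y. X \<union> Y \<in> H) (xs @ ys)"
    using xs ys e by (auto simp: successively_append_iff path_def)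
  moreover have "A_sum (xs @ ys) = A_sum xs + A_sum ys" by (simp add: A_sum_def)
  ultimately show ?thesis
    using xs ys ne unfolding path_def shape_append parity_sum_append by auto
qed

text \<open>The two blocks to be joined have the same role, hence the same size and parity, and both
  are typical; a common extension fits between them.\<close>

lemma connect_same_role:
  assumes ab: "even (a + b + p)" and xs: "path a b r w xs" and ys: "path a b (r = odd (length xs)) w' ys"
    and disj: "verts xs \<inter> verts ys = {}"
    and small: "real (card (verts xs \<union> verts ys)) < g / 16 * real n"
  shows "\<exists>Y. path a b r (w + w') (xs @ [Y] @ ys) \<and> Y \<subseteq> V1"
proof -
  let ?r = "r = odd (length xs)"
  have ends: "typical (last xs)" "typical (hd ys)" "card (last xs) = role_size ?r" "card (hd ys) = role_size ?r"
    "even (card (last xs \<inter> A) + role_parity a b ?r)" "even (card (hd ys \<inter> A) + role_parity a b ?r)"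
    using xs ys path_ends[OF xs] path_ends[OF ys] by (auto simp: path_def)
  have par: "even (role_parity a b (\<not> ?r) + card (last xs \<inter> A) + p)" "even (role_parity a b (\<not> ?r) + card (hd ys \<inter> A) + p)"
    using role_parity_not[OF ab, of ?r] ends(5,6) by presburger+
  obtain Y where Y: "typical Y" "Y \<subseteq> V1" "card Y = k - role_size ?r" "even (card (Y \<inter> A) + role_parity a b (\<not> ?r))"
    "Y \<inter> (verts xs \<union> verts ys) = {}" "last xs \<union> Y \<in> H" "hd ys \<union> Y \<in> H"
    using common_extension[OF ends(1-4) role_size_bounds(1,2) par _ small]
      path_verts(2)[OF xs] path_verts(2)[OF ys] by blast
  have "path a b (\<not> ?r) 0 [Y]"
    using Y role_size_bounds by (intro path_single) auto
  then have "path a b r (w + 0) (xs @ [Y])"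
    using xs Y(5,6) by (intro path_append) (auto simp: verts_def)
  then have "path a b r (w + 0 + w') ((xs @ [Y]) @ ys)"
    by (rule path_append) (use ys Y(5,7) disj in \<open>auto simp: verts_def Un_commute\<close>)
  then show ?thesis using Y(2) by auto
qed

lemma extend_by_one:
  assumes ab: "even (a + b + p)" and xs: "path a b r w xs" and U: "finite U"
    and small: "real (card (verts xs \<union> U)) < g / 16 * real n"
  shows "\<exists>Y. path a b r w (xs @ [Y]) \<and> Y \<subseteq> V1 \<and> Y \<inter> U = {}"
proof -
  let ?r = "r = odd (length xs)"
  have ends: "typical (last xs)" "card (last xs) = role_size ?r"
    "even (card (last xs \<inter> A) + role_parity a b ?r)"
    using xs path_ends[OF xs] by (auto simp: path_def)
  have par: "even (role_parity a b (\<not> ?r) + card (last xs \<inter> A) + p)"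
    using role_parity_not[OF ab, of ?r] ends(3) by presburger
  \<comment> \<open>The common extension of the last block with itself.\<close>
  obtain Y where Y: "typical Y" "Y \<subseteq> V1" "card Y = k - role_size ?r" "even (card (Y \<inter> A) + role_parity a b (\<not> ?r))"
    "Y \<inter> (verts xs \<union> U) = {}" "last xs \<union> Y \<in> H"
    using common_extension[OF ends(1,1,2,2) role_size_bounds(1,2) par par _ small]
      path_verts(2)[OF xs] U by blast
  have "path a b (\<not> ?r) 0 [Y]"
    using Y role_size_bounds by (intro path_single) auto
  then have "path a b r (w + 0) (xs @ [Y])"
    using xs Y(5,6) by (intro path_append) (auto simp: verts_def)
  then show ?thesis using Y(2,5) by auto
qed

text \<open>One block joins the paths; another one is put before it if the roles would not alternate
  otherwise.\<close>

lemma connect: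
  assumes ab: "even (a + b + p)" and xs: "path a b r w xs" and ys: "path a b r' w' ys"
    and disj: "verts xs \<inter> verts ys = {}"
    and small: "real (card (verts xs \<union> verts ys) + k) < g / 16 * real n"
  shows "\<exists>cs. path a b r (w + w') (xs @ cs @ ys) \<and> length cs \<le> 2 \<and> verts cs \<subseteq> V1"
proof (cases "r' = (r = odd (length xs))")
  case True
  have "real (card (verts xs \<union> verts ys)) < g / 16 * real n" using small by linarith
  from connect_same_role[OF ab xs _ disj this, of w'] ys True
  obtain Y where "path a b r (w + w') (xs @ [Y] @ ys)" "Y \<subseteq> V1" by blast
  then show ?thesis by (intro exI[of _ "[Y]"]) (auto simp: verts_def)
next
  case False
  have "real (card (verts xs \<union> verts ys)) < g / 16 * real n" using small by linarith
  from extend_by_one[OF ab xs path_verts(2)[OF ys] this]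
  obtain Y where Y: "path a b r w (xs @ [Y])" "Y \<subseteq> V1" "Y \<inter> verts ys = {}" by blast
  have "card Y \<le> k"
    using path_ends(4)[OF Y(1)] role_size_bounds(2)[of "r = odd (length (xs @ [Y]))"] by simp
  moreover have "verts (xs @ [Y]) \<union> verts ys = (verts xs \<union> verts ys) \<union> Y" by (auto simp: verts_def)
  ultimately have "card (verts (xs @ [Y]) \<union> verts ys) \<le> card (verts xs \<union> verts ys) + k"
    using card_Un_le[of "verts xs \<union> verts ys" Y] by simp
  then have sm: "real (card (verts (xs @ [Y]) \<union> verts ys)) < g / 16 * real n" using small by linarith
  have "r' = (r = odd (length (xs @ [Y])))" using False by auto
  then have "path a b (r = odd (length (xs @ [Y]))) w' ys" using ys by simp
  moreover have "verts (xs @ [Y]) \<inter> verts ys = {}" using disj Y(3) by (auto simp: verts_def)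
  ultimately obtain Y' where "path a b r (w + w') ((xs @ [Y]) @ [Y'] @ ys)" "Y' \<subseteq> V1"
    using connect_same_role[OF ab Y(1) _ _ sm] by blast
  then show ?thesis using Y(2) by (intro exI[of _ "[Y, Y']"]) (auto simp: verts_def)
qed

section \<open>Absorbing the exceptional vertices\<close>

text \<open>Every right mixed edge at \<open>v\<close> is cut into a part of size \<open>l\<close>
  and parity \<open>a\<close> and a part of size \<open>m\<close> and parity \<open>b\<close>. By
  pigeonhole one part \<open>Z\<close> containing \<open>v\<close> has many partners, and two
  disjoint typical partners form the ends of \<open>[W0, Z, W1]\<close>.\<close>

lemma bad_segment:
  assumes ab: "even (a + b + p)" and v: "v \<in> V - V1" and U: "finite U" "v \<notin> U"
    and small: "real (card U) < g / 16 * real n"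
  shows "\<exists>r xs. path a b r 0 xs \<and> length xs = 3 \<and> v \<in> verts xs \<and> verts xs \<subseteq> insert v V1 \<and> verts xs \<inter> U = {}"
proof -
  define X0 where "X0 = {X \<in> [V1]\<^bsup>(k - 1)\<^esup>. insert v X \<in> H \<and> right (insert v X) \<and> X \<inter> A \<noteq> {} \<and> X - A \<noteq> {}}"
  define XX where "XX = {X \<in> X0. X \<inter> U = {}}"
  have finX: "finite X0" "finite XX" using fin_nsets by (auto simp: X0_def XX_def)
  have k1: "k - 1 > 0" using klm by simp
  have bigX: "g * real n ^ (k - 1) < real (card XX)"
  proof -
    have "X0 \<subseteq> XX \<union> {W \<in> [V]\<^bsup>(k - 1)\<^esup>. W \<inter> U \<noteq> {}}" using V1_nsets by (auto simp: X0_def XX_def)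
    then have "card X0 \<le> card (XX \<union> {W \<in> [V]\<^bsup>(k - 1)\<^esup>. W \<inter> U \<noteq> {}})"
      using finX fin_nsets by (intro card_mono) auto
    also have "\<dots> \<le> card XX + card {W \<in> [V]\<^bsup>(k - 1)\<^esup>. W \<inter> U \<noteq> {}}" by (rule card_Un_le)
    also have "\<dots> \<le> card XX + card U * n ^ (k - 1 - 1)"
      using card_meeting_le[OF finV k1 U(1)] by simp
    finally have "real (card X0) \<le> real (card XX + card U * n ^ (k - 1 - 1))" by (rule of_nat_mono)
    also have "\<dots> = real (card XX) + real (card U) * real n ^ (k - 1 - 1)" by simp
    also have "real (card U) * real n ^ (k - 1 - 1) < g * real n * real n ^ (k - 1 - 1)"
      using small npos gpos by (intro mult_strict_right_mono) (auto intro: less_le_trans)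
    also have "g * real n * real n ^ (k - 1 - 1) = g * real n ^ (k - 1)"
      by (simp only: mult.assoc power_split[OF k1])
    finally show ?thesis using bad[OF v] unfolding X0_def by linarith
  qed
  have facts: "finite X" "v \<notin> X" "card X = k - 1" "X \<subseteq> V1" "X \<inter> U = {}" "insert v X \<in> H" "right (insert v X)"
    "insert v X \<inter> A \<noteq> {}" "insert v X - A \<noteq> {}" "card (insert v X) = k" if "X \<in> XX" for X
  proof -
    show f: "finite X" "v \<notin> X" "card X = k - 1" "X \<subseteq> V1" "X \<inter> U = {}" "insert v X \<in> H" "right (insert v X)"
      "insert v X \<inter> A \<noteq> {}" "insert v X - A \<noteq> {}"
      using that v by (auto simp: XX_def X0_def nsets_def)
    show "card (insert v X) = k" using f(1-3) kpos by simp
  qed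
  have "\<exists>L\<subseteq>insert v X. card L = l \<and> even (card (L \<inter> A) + a)" if X: "X \<in> XX" for X
    by (rule subset_with_parity) (use facts[OF X] klm in auto)
  then obtain Lf where Lf: "\<And>X. X \<in> XX \<Longrightarrow> Lf X \<subseteq> insert v X \<and> card (Lf X) = l \<and> even (card (Lf X \<inter> A) + a)"
    by metis
  \<comment> \<open>\<rho> records which role the part with \<open>v\<close> takes;
    \<open>Zf\<close> is this part and \<open>Wf\<close> the other one.\<close>
  define \<rho> where "\<rho> X = (v \<in> Lf X)" for X
  define Zf where "Zf X = (if \<rho> X then Lf X else insert v X - Lf X)" for X
  define Wf where "Wf X = insert v X - Zf X" for X
  have parts: "v \<in> Zf X" "card (Zf X) = role_size (\<rho> X)" "even (card (Zf X \<inter> A) + role_parity a b (\<rho> X))"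
    "card (Wf X) = role_size (\<not> \<rho> X)" "even (card (Wf X \<inter> A) + role_parity a b (\<not> \<rho> X))"
    "Zf X \<union> Wf X = insert v X" "Zf X \<inter> Wf X = {}" "Wf X \<subseteq> V1" "Zf X \<subseteq> insert v V1" "v \<notin> Wf X"
    if X: "X \<in> XX" for X
  proof -
    note f = facts[OF X] and L = Lf[OF X]
    have fin: "finite (insert v X)" using f(1) by simp
    have cR: "card (insert v X - Lf X) = m"
      using f(10) L klm(1) fin finite_subset by (subst card_Diff_subset) auto
    have "card (insert v X \<inter> A) = card ((insert v X - Lf X) \<inter> A) + card (Lf X \<inter> A)"
      using card_inter_split[OF fin] L by blast
    then have pR: "even (card ((insert v X - Lf X) \<inter> A) + b)"
      using f(7) L[THEN conjunct2, THEN conjunct2] ab by presburger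
    have W: "Wf X = (if \<rho> X then insert v X - Lf X else Lf X)"
      using L by (auto simp: Wf_def Zf_def)
    show vZ: "v \<in> Zf X" by (auto simp: Zf_def \<rho>_def)
    show "card (Zf X) = role_size (\<rho> X)" "card (Wf X) = role_size (\<not> \<rho> X)"
      using cR L W by (auto simp: Zf_def role_size_def)
    show "even (card (Zf X \<inter> A) + role_parity a b (\<rho> X))" "even (card (Wf X \<inter> A) + role_parity a b (\<not> \<rho> X))"
      using pR L W by (auto simp: Zf_def role_parity_def)
    show "Zf X \<union> Wf X = insert v X" "Zf X \<inter> Wf X = {}" "v \<notin> Wf X"
      using L vZ by (auto simp: Wf_def Zf_def)
    show "Wf X \<subseteq> V1" "Zf X \<subseteq> insert v V1" using f(4) L vZ by (auto simp: Wf_def Zf_def)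
  qed
  define fib where "fib r Z' = {X \<in> XX. \<rho> X = r \<and> Zf X - {v} = Z'}" for r Z'
  \<comment> \<open>If every \<open>Z'\<close> had few partners, each of the two roles would account
    for at most \<open>g / 2 * n ^ (k - 1)\<close> edges, contradicting \<open>bigX\<close>.\<close>
  have "\<exists>r. \<exists>Z'\<in>[V]\<^bsup>(role_size r - 1)\<^esup>. g / 2 * real n ^ role_size (\<not> r) \<le> real (card (fib r Z'))"
  proof (rule ccontr)
    assume neg: "\<not> ?thesis"
    have one: "real (card {X \<in> XX. \<rho> X = r}) \<le> g / 2 * real n ^ (k - 1)" for r
    proof -
      have "{X \<in> XX. \<rho> X = r} \<subseteq> (\<Union>Z'\<in>[V]\<^bsup>(role_size r - 1)\<^esup>. fib r Z')"
      proof
        fix X assume X: "X \<in> {X \<in> XX. \<rho> X = r}"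
        then have XX: "X \<in> XX" by simp
        have fz: "finite (Zf X)" using parts(9)[OF XX] finV1 finite_subset by blast
        have "Zf X - {v} \<in> [V]\<^bsup>(role_size r - 1)\<^esup>"
          using parts(1,2,9)[OF XX] X fz V1V by (auto simp: nsets_def)
        then show "X \<in> (\<Union>Z'\<in>[V]\<^bsup>(role_size r - 1)\<^esup>. fib r Z')" using X by (auto simp: fib_def)
      qed
      then have "card {X \<in> XX. \<rho> X = r} \<le> card (\<Union>Z'\<in>[V]\<^bsup>(role_size r - 1)\<^esup>. fib r Z')"
        using finX fin_nsets by (intro card_mono) (auto simp: fib_def)
      also have "\<dots> \<le> (\<Sum>Z'\<in>[V]\<^bsup>(role_size r - 1)\<^esup>. card (fib r Z'))" by (rule card_UN_le[OF fin_nsets(1)])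
      finally have "real (card {X \<in> XX. \<rho> X = r}) \<le> (\<Sum>Z'\<in>[V]\<^bsup>(role_size r - 1)\<^esup>. real (card (fib r Z')))"
        by (simp only: of_nat_le_iff flip: of_nat_sum)
      also have "\<dots> \<le> (\<Sum>Z'\<in>[V]\<^bsup>(role_size r - 1)\<^esup>. g / 2 * real n ^ role_size (\<not> r))"
        using neg by (intro sum_mono) (auto simp: not_le intro: less_imp_le)
      also have "\<dots> = real (card ([V]\<^bsup>(role_size r - 1)\<^esup>)) * (g / 2 * real n ^ role_size (\<not> r))" by simp
      also have "\<dots> \<le> real n ^ (role_size r - 1) * (g / 2 * real n ^ role_size (\<not> r))"
      proof (rule mult_right_mono)
        show "real (card ([V]\<^bsup>(role_size r - 1)\<^esup>)) \<le> real n ^ (role_size r - 1)"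
          using card_nsets_le[OF finV, of "role_size r - 1"] by (metis of_nat_le_iff of_nat_power)
      qed (use gpos in simp)
      also have "\<dots> = g / 2 * (real n ^ (role_size r - 1 + role_size (\<not> r)))" by (simp add: power_add)
      also have "role_size r - 1 + role_size (\<not> r) = k - 1" using role_size_bounds[of r] by linarith
      finally show ?thesis .
    qed
    have "card XX \<le> card ({X \<in> XX. \<rho> X = True} \<union> {X \<in> XX. \<rho> X = False})" using finX by (intro card_mono) auto
    also have "\<dots> \<le> card {X \<in> XX. \<rho> X = True} + card {X \<in> XX. \<rho> X = False}" by (rule card_Un_le)
    finally show False using one[of True] one[of False] bigX by linarith
  qed
  then obtain r Z' where big: "g / 2 * real n ^ role_size (\<not> r) \<le> real (card (fib r Z'))" by blast
  have pos: "0 < real n ^ role_size (\<not> r)" using npos by simp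
  then have "0 < g / 2 * real n ^ role_size (\<not> r)" using gpos by simp
  then have "card (fib r Z') > 0" using big by linarith
  then obtain X1 where X1: "X1 \<in> fib r Z'" by fastforce
  define Z where "Z = insert v Z'"
  have ZX: "Zf X = Z" "X \<in> XX" "\<rho> X = r" if "X \<in> fib r Z'" for X
    using that parts(1)[of X] by (auto simp: fib_def Z_def)
  have X1X: "X1 \<in> XX" "Zf X1 = Z" "\<rho> X1 = r" using ZX[OF X1] by auto
  define \<W> where "\<W> = Wf ` fib r Z'"
  have inj: "inj_on Wf (fib r Z')"
  proof (rule inj_onI)
    fix X Y assume XY: "X \<in> fib r Z'" "Y \<in> fib r Z'" "Wf X = Wf Y"
    have "insert v X = insert v Y"
      using parts(6)[OF ZX(2)[OF XY(1)]] parts(6)[OF ZX(2)[OF XY(2)]] ZX(1)[OF XY(1)] ZX(1)[OF XY(2)] XY(3) by simp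
    then show "X = Y" using facts(2)[OF ZX(2)[OF XY(1)]] facts(2)[OF ZX(2)[OF XY(2)]] by (metis Diff_insert_absorb)
  qed
  have cW: "card \<W> = card (fib r Z')" unfolding \<W>_def by (rule card_image[OF inj])
  have W: "W \<subseteq> V1" "card W = role_size (\<not> r)" "even (card (W \<inter> A) + role_parity a b (\<not> r))" "Z \<union> W \<in> H"
    "Z \<inter> W = {}" "W \<inter> U = {}" if W_in: "W \<in> \<W>" for W
  proof -
    obtain X where X: "X \<in> fib r Z'" "W = Wf X" using W_in by (auto simp: \<W>_def)
    note z = ZX[OF X(1)]
    note pt = parts[OF z(2)]
    show "W \<subseteq> V1" "card W = role_size (\<not> r)" "even (card (W \<inter> A) + role_parity a b (\<not> r))" "Z \<inter> W = {}"
      using pt z X(2) by simp_all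
    show "Z \<union> W \<in> H" using pt(6) facts(6)[OF z(2)] z(1) X(2) by simp
    have "Wf X \<subseteq> insert v X" using pt(6) by (metis Un_upper2)
    then have "W \<subseteq> X" using pt(10) X(2) by (simp add: subset_insert)
    then show "W \<inter> U = {}" using facts(5)[OF z(2)] by blast
  qed
  have Wn: "\<W> \<subseteq> [V1]\<^bsup>(role_size (\<not> r))\<^esup>"
    using W finV1 finite_subset by (fastforce simp: nsets_def)
  have bigW: "g / 4 * real n ^ role_size (\<not> r) \<le> real (card \<W>)"
    using big mult_pos_pos[OF gpos pos] unfolding cW by (simp add: field_simps)
  have sm: "real (card U) < g / 8 * real n"
    using small mult_nonneg_nonneg[of g "real n"] gpos by simp
  obtain W0 where W0: "W0 \<in> \<W>" "typical W0"
    using exists_typical[OF Wn role_size_bounds(1,2) U(1) bigW sm] by blast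
  have "finite (U \<union> W0)" using U W(1)[OF W0(1)] finV1 finite_subset by blast
  moreover have "real (card (U \<union> W0)) < g / 8 * real n"
  proof -
    have "card (U \<union> W0) \<le> card U + k"
      using card_Un_le[of U W0] W(2)[OF W0(1)] role_size_bounds(2)[of "\<not> r"] by linarith
    then show ?thesis using small nbig by linarith
  qed
  ultimately obtain W1 where W1: "W1 \<in> \<W>" "typical W1" "W1 \<inter> (U \<union> W0) = {}"
    using exists_typical[OF Wn role_size_bounds(1,2) _ bigW] by blast
  have ZV: "Z \<subseteq> insert v V1" "v \<in> Z" "card Z = role_size r" "even (card (Z \<inter> A) + role_parity a b r)"
    using parts(1,2,3,9)[OF X1X(1)] X1X by auto
  have ZU: "Z \<inter> U = {}"
  proof -
    have "Z - {v} \<subseteq> X1" using parts(6)[OF X1X(1)] X1X(2) by blast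
    then show ?thesis using facts(5)[OF X1X(1)] U(2) by blast
  qed
  have "path a b (\<not> r) 0 [W0, Z, W1]"
    unfolding path_def
    using W0 W1 W[OF W0(1)] W[OF W1(1)] ZV V1V v
    by (auto simp: A_sum_def Un_commute Int_commute)
  moreover have "v \<in> verts [W0, Z, W1]" "verts [W0, Z, W1] \<subseteq> insert v V1" "verts [W0, Z, W1] \<inter> U = {}"
    using ZV(1,2) ZU W(1,6)[OF W0(1)] W(1,6)[OF W1(1)] by (auto simp: verts_def)
  ultimately show ?thesis by (intro exI[of _ "\<not> r"] exI[of _ "[W0, Z, W1]"]) simp
qed

text \<open>Each vertex costs at most five blocks, three for its segment and two for the connection.
  A vertex may also be covered already, for instance by the segment with wrong edges at the
  beginning.\<close>

lemma cover_bad: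
  assumes ab: "even (a + b + p)" and xs: "path a b r w xs" and B: "finite B" "B \<subseteq> V - V1"
    and small: "real (k * (length xs + 5 * card B)) < g / 16 * real n"
  shows "\<exists>ys. path a b r w ys \<and> verts xs \<union> B \<subseteq> verts ys \<and> length ys \<le> length xs + 5 * card B"
  using B small
proof (induction B rule: finite_induct)
  case empty
  show ?case using xs by (intro exI[of _ xs]) simp
next
  case (insert v B)
  have cB: "card (insert v B) = card B + 1" using insert by simp
  have "k * (length xs + 5 * card B) \<le> k * (length xs + 5 * card (insert v B))" using cB by simp
  then have "real (k * (length xs + 5 * card B)) < g / 16 * real n"
    using insert.prems(2) by linarith
  then obtain ys where ys: "path a b r w ys" "verts xs \<union> B \<subseteq> verts ys" "length ys \<le> length xs + 5 * card B"
    using insert by blast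
  show ?case
  proof (cases "v \<in> verts ys")
    case True
    then show ?thesis using ys cB by (intro exI[of _ ys]) auto
  next
    case False
    have cy: "card (verts ys) \<le> k * (length xs + 5 * card B)"
      using path_verts(3)[OF ys(1)] ys(3) by (meson le_trans mult_le_mono2)
    then have "real (card (verts ys)) < g / 16 * real n"
      using \<open>real (k * (length xs + 5 * card B)) < g / 16 * real n\<close> by linarith
    then obtain r' zs where zs: "path a b r' 0 zs" "length zs = 3" "v \<in> verts zs" "verts zs \<inter> verts ys = {}"
      using bad_segment[OF ab _ path_verts(2)[OF ys(1)] False] insert.prems(1) by blast
    have "card (verts ys \<union> verts zs) + k \<le> k * (length xs + 5 * card B) + k * 3 + k"
      using card_Un_le[of "verts ys" "verts zs"] path_verts(3)[OF zs(1)] zs(2) cy by simp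
    also have "\<dots> \<le> k * (length xs + 5 * card (insert v B))" using cB by (simp add: algebra_simps)
    finally have "real (card (verts ys \<union> verts zs) + k) < g / 16 * real n"
      using insert.prems(2) by linarith
    then obtain cs where cs: "path a b r (w + 0) (ys @ cs @ zs)" "length cs \<le> 2"
      using connect[OF ab ys(1) zs(1)] zs(4) by blast
    have "verts xs \<union> insert v B \<subseteq> verts (ys @ cs @ zs)"
      using ys(2) zs(3) by (auto simp: verts_append)
    moreover have "length (ys @ cs @ zs) \<le> length xs + 5 * card (insert v B)"
      using ys(3) cs(2) zs(2) cB by simp
    ultimately show ?thesis using cs(1) by (intro exI[of _ "ys @ cs @ zs"]) simp
  qed
qed


section \<open>Segments that shift the parity\<close>

lemma path_triple:
  assumes ab: "even (a + b + p)" and W: "typical W" "typical W'" "card W = role_size (\<not> r)" "card W' = role_size (\<not> r)"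
    "even (card (W \<inter> A) + role_parity a b (\<not> r))" "even (card (W' \<inter> A) + role_parity a b (\<not> r))"
    and Z: "Z \<subseteq> V" "card Z = role_size r" "even (card (Z \<inter> A) + role_parity a b r + w)"
    and H: "Z \<union> W \<in> H" "Z \<union> W' \<in> H" and disj: "Z \<inter> W = {}" "Z \<inter> W' = {}" "W \<inter> W' = {}"
  shows "path a b (\<not> r) w [W, Z, W']"
proof -
  have "W \<subseteq> V" "W' \<subseteq> V" using W typical_subset V1V by blast+
  moreover have "even (card (W \<inter> A) + (card (Z \<inter> A) + card (W' \<inter> A)) +
      (role_parity a b (\<not> r) + (role_parity a b r + role_parity a b (\<not> r))) + w)"
    using W(5,6) Z(3) by presburger
  ultimately show ?thesis
    using assms by (simp add: path_def A_sum_def Un_commute Int_commute)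
qed

text \<open>Counting \<open>A\<close>-vertices around the cycle shows that the wrong edges come in pairs: an odd number of
  them has the form \<open>L i \<union> R i\<close> and an odd number the form \<open>R i \<union> L (i + 1)\<close>. Hence a segment that
  shifts the parity needs two wrong edges that share exactly one block or no vertex at all.\<close>

lemma wrong_segment_extension:
  assumes Z: "Z \<in> [V]\<^bsup>l\<^esup>"
    and many: "g * real n ^ m \<le> real (card {W \<in> [V1]\<^bsup>m\<^esup>. W \<inter> Z = {} \<and> Z \<union> W \<in> H \<and> \<not> right (Z \<union> W)})"
  shows "\<exists>a b xs. even (a + b + p) \<and> path a b False 1 xs \<and> length xs \<le> 9"
proof -
  define \<W> where "\<W> = {W \<in> [V1]\<^bsup>m\<^esup>. W \<inter> Z = {} \<and> Z \<union> W \<in> H \<and> \<not> right (Z \<union> W)}"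
  \<comment> \<open>\<open>b\<close> is the parity forced on every \<open>W\<close> that forms a
    wrong edge with \<open>Z\<close>. With \<open>a = p + b\<close> the block \<open>Z\<close>
    violates \<open>a\<close>, and it is the only violation on the path, whose two edges are both
    wrong.\<close>
  define b where "b = p + 1 + card (Z \<inter> A)"
  define a where "a = p + b"
  have ab: "even (a + b + p)" unfolding a_def by presburger
  have Zf: "finite Z" "Z \<subseteq> V" "card Z = l" using Z by (auto simp: nsets_def)
  have sub: "\<W> \<subseteq> [V1]\<^bsup>m\<^esup>" by (auto simp: \<W>_def)
  have m: "0 < m" "m < k" using klm by auto
  have "0 \<le> g * real n ^ m" using gpos by simp
  then have big: "g / 4 * real n ^ m \<le> real (card \<W>)" using many by (simp add: \<W>_def)
  have sm: "real j < g / 8 * real n" if "j \<le> 2 * k" for j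
    using nbig that kpos by linarith
  obtain W where W: "W \<in> \<W>" "typical W"
    using exists_typical[OF sub m, of "{}"] big sm[of 0] by auto
  have cW: "card W = m" "finite W" using W(1) by (auto simp: \<W>_def nsets_def)
  obtain W' where W': "W' \<in> \<W>" "typical W'" "W' \<inter> W = {}"
    using exists_typical[OF sub m cW(2) big sm] cW m by auto
  have par: "even (card (X \<inter> A) + b)" if "X \<in> \<W>" for X
  proof -
    have "finite X" "X \<inter> Z = {}" "\<not> right (Z \<union> X)" using that by (auto simp: \<W>_def nsets_def)
    moreover from this have "card ((Z \<union> X) \<inter> A) = card (Z \<inter> A) + card (X \<inter> A)"
      using Zf(1) by (intro card_Un_inter) auto
    ultimately show ?thesis unfolding b_def by presburger
  qed
  have "path a b (\<not> True) 1 [W, Z, W']"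
    by (rule path_triple[OF ab W(2) W'(2)])
      (use W(1) W' Zf par in \<open>auto simp: role_size_def role_parity_def \<W>_def nsets_def a_def b_def\<close>)
  then show ?thesis using ab by (intro exI[of _ a] exI[of _ b] exI[of _ "[W, Z, W']"]) simp
qed

definition right_rich :: "'a set \<Rightarrow> bool" where
  "right_rich Z \<longleftrightarrow>
    g * real n ^ m \<le> real (card {W \<in> [V1]\<^bsup>m\<^esup>. W \<inter> Z = {} \<and> Z \<union> W \<in> H \<and> right (Z \<union> W)})"

lemma right_extension:
  assumes many: "\<And>Z. Z \<in> [V]\<^bsup>l\<^esup> \<Longrightarrow> right_rich Z"
    and Z: "Z \<in> [V]\<^bsup>l\<^esup>" and U: "finite U" "card U \<le> 6 * k"
  shows "\<exists>W. typical W \<and> W \<subseteq> V1 \<and> finite W \<and> card W = m \<and> W \<inter> Z = {} \<and> W \<inter> U = {} \<and> Z \<union> W \<in> H \<and>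
    even (card (Z \<inter> A) + card (W \<inter> A) + p)"
proof -
  define \<W> where "\<W> = {W \<in> [V1]\<^bsup>m\<^esup>. W \<inter> Z = {} \<and> Z \<union> W \<in> H \<and> right (Z \<union> W)}"
  have sub: "\<W> \<subseteq> [V1]\<^bsup>m\<^esup>" by (auto simp: \<W>_def)
  have m: "0 < m" "m < k" using klm by auto
  have "0 \<le> g * real n ^ m" using gpos by simp
  then have big: "g / 4 * real n ^ m \<le> real (card \<W>)" using many[OF Z] by (simp add: \<W>_def right_rich_def)
  have "real (card U) < g / 8 * real n"
    using nbig U kpos by linarith
  then obtain W where W: "W \<in> \<W>" "typical W" "W \<inter> U = {}"
    using exists_typical[OF sub m U(1) big] by auto
  have "finite Z" using Z by (auto simp: nsets_def)
  then have "even (card (Z \<inter> A) + card (W \<inter> A) + p)"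
    using W(1) card_Un_inter[of Z W A] by (auto simp: \<W>_def nsets_def Int_commute)
  then show ?thesis using W by (intro exI[of _ W]) (auto simp: \<W>_def nsets_def)
qed

text \<open>The shared block \<open>R\<close> is the only violation: as both edges are wrong,
  \<open>L\<close> and \<open>L'\<close> have the same parity, which is taken as \<open>a\<close>,
  and their right extensions \<open>W\<close> and \<open>W'\<close> then have the parity
  \<open>b\<close>.\<close>

lemma wrong_segment_common:
  assumes many: "\<And>Z. Z \<in> [V]\<^bsup>l\<^esup> \<Longrightarrow> right_rich Z"
    and e: "e \<in> H" "f \<in> H" "\<not> right e" "\<not> right f" and c: "card (e \<inter> f) = m"
  shows "\<exists>a b xs. even (a + b + p) \<and> path a b False 1 xs \<and> length xs \<le> 9"
proof -
  define R where "R = e \<inter> f"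
  define L where "L = e - R"
  define L' where "L' = f - R"
  have ef: "e \<subseteq> V" "f \<subseteq> V" "finite e" "finite f" "card e = k" "card f = k"
    using e HV by (auto simp: nsets_def)
  have R: "finite R" "card R = m" "R \<subseteq> V" "R \<subseteq> e" "R \<subseteq> f" using ef c by (auto simp: R_def)
  have L: "L \<in> [V]\<^bsup>l\<^esup>" "L' \<in> [V]\<^bsup>l\<^esup>"
    using ef R klm by (auto simp: L_def L'_def nsets_def card_Diff_subset)
  have LL: "L \<inter> L' = {}" "L \<inter> R = {}" "L' \<inter> R = {}" "L \<union> R = e" "R \<union> L' = f" by (auto simp: L_def L'_def R_def)
  have par: "card (e \<inter> A) = card (L \<inter> A) + card (R \<inter> A)" "card (f \<inter> A) = card (L' \<inter> A) + card (R \<inter> A)"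
    unfolding L_def L'_def using ef R by (auto intro: card_inter_split)
  define a where "a = card (L \<inter> A)"
  define b where "b = p + a"
  have ab: "even (a + b + p)" unfolding b_def by presburger
  have cU: "card (e \<union> f) \<le> 2 * k" using card_Un_le[of e f] ef by simp
  obtain W where W: "typical W" "W \<subseteq> V1" "finite W" "card W = m" "W \<inter> (e \<union> f) = {}" "L \<union> W \<in> H"
    "even (card (L \<inter> A) + card (W \<inter> A) + p)"
    using right_extension[OF many L(1), of "e \<union> f"] ef cU by auto
  have "card (e \<union> f \<union> W) \<le> 6 * k" using card_Un_le[of "e \<union> f" W] cU W(4) klm by simp
  then obtain W' where W': "typical W'" "W' \<subseteq> V1" "card W' = m" "W' \<inter> (e \<union> f \<union> W) = {}" "L' \<union> W' \<in> H"
    "even (card (L' \<inter> A) + card (W' \<inter> A) + p)"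
    using right_extension[OF many L(2), of "e \<union> f \<union> W"] ef W(3) by auto
  have LV: "L \<subseteq> V" "L' \<subseteq> V" "card L = l" "card L' = l" using L by (auto simp: nsets_def)
  have WV: "W \<subseteq> V" "W' \<subseteq> V" using W W' V1V by auto
  have disj: "W \<inter> L = {}" "W \<inter> R = {}" "W \<inter> L' = {}" "W \<inter> W' = {}" "L \<inter> W' = {}" "R \<inter> W' = {}" "L' \<inter> W' = {}"
    using W(5) W'(4) by (auto simp: L_def L'_def R_def)
  have parL: "odd (card (L \<inter> A) + card (R \<inter> A) + p)" "odd (card (L' \<inter> A) + card (R \<inter> A) + p)"
    using e par by simp_all
  have parW: "even (card (W \<inter> A) + b)" "even (card (W' \<inter> A) + b)"
    using W(7) W'(6) parL unfolding b_def a_def by presburger+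
  have total: "even (card (W \<inter> A) + (card (L \<inter> A) + (card (R \<inter> A) + (card (L' \<inter> A) + card (W' \<inter> A)))) +
      (b + (a + (b + (a + b)))) + 1)"
    using parL parW unfolding b_def a_def by presburger
  have "path a b False 1 [W, L, R, L', W']"
    unfolding path_def
    using W(1,4,6) W'(1,3,5) R LV WV disj LL parW total e
    by (simp add: A_sum_def role_size_def role_parity_def Un_commute Int_commute)
  then show ?thesis using ab by (intro exI[of _ a] exI[of _ b] exI[of _ "[W, L, R, L', W']"]) simp
qed

text \<open>In \<open>[W, S, R, X, Y, X', R', S', W']\<close> only \<open>S \<union> R\<close> and
  \<open>R' \<union> S'\<close> are wrong. The first shifts the parities and the second shifts them
  back, so exactly the five blocks between \<open>S\<close> and \<open>S'\<close> are violations, an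
  odd number. Equal types of \<open>S\<close> and \<open>S'\<close> make both ends fit the same
  \<open>a\<close>, and \<open>l = m\<close> lets the blocks take either role.\<close>

lemma wrong_segment_disjoint:
  assumes many: "\<And>Z. Z \<in> [V]\<^bsup>l\<^esup> \<Longrightarrow> right_rich Z"
    and e: "e \<in> H" "f \<in> H" "\<not> right e" "\<not> right f" and ef0: "e \<inter> f = {}" and lm: "l = m"
    and S: "S \<subseteq> e" "card S = l" "S' \<subseteq> f" "card S' = l" "card (S \<inter> A) = card (S' \<inter> A)"
  shows "\<exists>a b xs. even (a + b + p) \<and> path a b False 1 xs \<and> length xs \<le> 9"
proof -
  define R where "R = e - S"
  define R' where "R' = f - S'"
  have ef: "e \<subseteq> V" "f \<subseteq> V" "finite e" "finite f" "card e = k" "card f = k"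
    using e HV by (auto simp: nsets_def)
  have Sf: "finite S" "finite S'" "S \<subseteq> V" "S' \<subseteq> V" using S ef finite_subset by blast+
  have R: "R \<subseteq> V" "R' \<subseteq> V" "finite R" "finite R'" "card R = m" "card R' = m"
    using ef S Sf klm by (auto simp: R_def R'_def card_Diff_subset)
  have nsets: "S \<in> [V]\<^bsup>l\<^esup>" "S' \<in> [V]\<^bsup>l\<^esup>" "R \<in> [V]\<^bsup>l\<^esup>" "R' \<in> [V]\<^bsup>l\<^esup>"
    using Sf S R lm by (auto simp: nsets_def)
  have par: "card (e \<inter> A) = card (R \<inter> A) + card (S \<inter> A)" "card (f \<inter> A) = card (R' \<inter> A) + card (S' \<inter> A)"
    unfolding R_def R'_def using card_inter_split[OF ef(3) S(1)] card_inter_split[OF ef(4) S(3)] by auto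
  define a where "a = card (S \<inter> A)"
  define b where "b = p + a"
  have ab: "even (a + b + p)" unfolding b_def by presburger
  let ?U = "e \<union> f"
  have cU: "card ?U \<le> 2 * k" using card_Un_le[of e f] ef by simp
  obtain W where W: "typical W" "W \<subseteq> V1" "finite W" "card W = m" "W \<inter> ?U = {}" "S \<union> W \<in> H"
    "even (card (S \<inter> A) + card (W \<inter> A) + p)"
    using right_extension[OF many nsets(1), of ?U] ef cU by auto
  have c1: "card (?U \<union> W) \<le> 3 * k" using card_Un_le[of ?U W] cU W(4) klm by simp
  then obtain W' where W': "typical W'" "W' \<subseteq> V1" "finite W'" "card W' = m" "W' \<inter> (?U \<union> W) = {}" "S' \<union> W' \<in> H"
    "even (card (S' \<inter> A) + card (W' \<inter> A) + p)"
    using right_extension[OF many nsets(2), of "?U \<union> W"] ef W(3) by auto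
  have c2: "card (?U \<union> W \<union> W') \<le> 4 * k" using card_Un_le[of "?U \<union> W" W'] c1 W'(4) klm by simp
  then obtain X where X: "typical X" "X \<subseteq> V1" "finite X" "card X = m" "X \<inter> (?U \<union> W \<union> W') = {}" "R \<union> X \<in> H"
    "even (card (R \<inter> A) + card (X \<inter> A) + p)"
    using right_extension[OF many nsets(3), of "?U \<union> W \<union> W'"] ef W(3) W'(3) by auto
  have c3: "card (?U \<union> W \<union> W' \<union> X) \<le> 5 * k" using card_Un_le[of "?U \<union> W \<union> W'" X] c2 X(4) klm by simp
  then obtain X' where X': "typical X'" "X' \<subseteq> V1" "finite X'" "card X' = m" "X' \<inter> (?U \<union> W \<union> W' \<union> X) = {}" "R' \<union> X' \<in> H"
    "even (card (R' \<inter> A) + card (X' \<inter> A) + p)"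
    using right_extension[OF many nsets(4), of "?U \<union> W \<union> W' \<union> X"] ef W(3) W'(3) X(3) by auto
  have parS: "odd (card (R \<inter> A) + card (S \<inter> A) + p)" "odd (card (R' \<inter> A) + card (S' \<inter> A) + p)"
    using e par by simp_all
  \<comment> \<open>The parity for the middle block \<open>Y\<close>. It suits both neighbours,
    since \<open>R\<close> and \<open>R'\<close>, and therefore \<open>X\<close> and
    \<open>X'\<close>, agree in parity.\<close>
  define c where "c = p + card (X \<inter> A)"
  have pc: "even (c + card (X \<inter> A) + p)" "even (c + card (X' \<inter> A) + p)"
    using X(7) X'(7) parS S(5) unfolding c_def by presburger+
  have "card (?U \<union> W \<union> W' \<union> X \<union> X') \<le> 6 * k" using card_Un_le[of "?U \<union> W \<union> W' \<union> X" X'] c3 X'(4) klm by simp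
  then have sm: "real (card (?U \<union> W \<union> W' \<union> X \<union> X')) < g / 16 * real n"
    using nbig kpos by linarith
  have "finite (?U \<union> W \<union> W' \<union> X \<union> X')" using ef W W' X X' by simp
  moreover have "0 < m" "m < k" using klm by auto
  ultimately obtain Y where Y: "typical Y" "Y \<subseteq> V1" "card Y = k - m" "even (card (Y \<inter> A) + c)"
    "Y \<inter> (?U \<union> W \<union> W' \<union> X \<union> X') = {}" "X \<union> Y \<in> H" "X' \<union> Y \<in> H"
    using common_extension[OF X(1) X'(1) X(4) X'(4) _ _ pc _ sm] by blast
  have cY: "card Y = m" using Y(3) klm lm by simp
  have WV: "W \<subseteq> V" "W' \<subseteq> V" "X \<subseteq> V" "X' \<subseteq> V" "Y \<subseteq> V" using W W' X X' Y V1V by auto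
  have SU: "S \<union> R = e" "S' \<union> R' = f" "S \<inter> R = {}" "S' \<inter> R' = {}" using S by (auto simp: R_def R'_def)
  have sub: "S \<subseteq> e" "R \<subseteq> e" "S' \<subseteq> f" "R' \<subseteq> f" using S by (auto simp: R_def R'_def)
  have disj: "sorted_wrt (\<lambda>X Y. X \<inter> Y = {}) [W, S, R, X, Y, X', R', S', W']"
    using W(5) W'(5) X(5) X'(5) Y(5) SU(3,4) sub ef0 by (simp add: disjoint_iff subset_iff) blast
  have succ: "successively (\<lambda>X Y. X \<union> Y \<in> H) [W, S, R, X, Y, X', R', S', W']"
    using W(6) W'(6) X(6) X'(6) Y(6,7) SU e by (simp add: Un_commute)
  have parW: "even (card (W \<inter> A) + b)" "even (card (W' \<inter> A) + b)"
    using W(7) W'(7) S(5) unfolding b_def a_def by presburger+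
  have total: "even (card (W \<inter> A) + (card (S \<inter> A) + (card (R \<inter> A) + (card (X \<inter> A) + (card (Y \<inter> A) +
      (card (X' \<inter> A) + (card (R' \<inter> A) + (card (S' \<inter> A) + card (W' \<inter> A)))))))) +
      (b + (a + (b + (a + (b + (a + (b + (a + b)))))))) + 1)"
    using parW parS X(7) X'(7) Y(4) S(5) unfolding b_def a_def c_def by presburger
  have rs: "role_size r = m" for r unfolding role_size_def by (simp add: lm)
  have Sm: "card S = m" "card S' = m" using S lm by auto
  have sh: "shape False [W, S, R, X, Y, X', R', S', W']"
    using W(4) W'(4) X(4) X'(4) cY R Sf Sm WV by (simp add: rs)
  have sums: "even (A_sum [W, S, R, X, Y, X', R', S', W'] +
      parity_sum a b False [W, S, R, X, Y, X', R', S', W'] + 1)"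
    using total by (simp only: A_sum_def role_parity_def list.map sum_list.Cons sum_list.Nil
        parity_sum.simps if_True if_False not_True_eq_False not_False_eq_True add_0_right simp_thms)
  have "path a b False 1 [W, S, R, X, Y, X', R', S', W']"
    unfolding path_def
    by (intro conjI sh disj succ sums) (use W(1) W'(1) parW in \<open>simp_all add: role_parity_def\<close>)
  then show ?thesis
    using ab by (intro exI[of _ a] exI[of _ b] exI[of _ "[W, S, R, X, Y, X', R', S', W']"]) simp
qed

end

section \<open>Completing a path to a Hamilton cycle\<close>

lemma distribute:
  fixes cap :: "nat \<Rightarrow> nat"
  assumes "h \<le> (\<Sum>j<N. cap j)"
  shows "\<exists>c. (\<forall>j<N. c j \<le> cap j) \<and> (\<Sum>j<N. c j) = h"
  using assms
proof (induction N arbitrary: h)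
  case (Suc N)
  define x where "x = min h (cap N)"
  have "h - x \<le> (\<Sum>j<N. cap j)" using Suc.prems by (auto simp: x_def)
  then obtain c where c: "\<forall>j<N. c j \<le> cap j" "(\<Sum>j<N. c j) = h - x" using Suc.IH by blast
  have "(\<Sum>j<N. (c(N := x)) j) = (\<Sum>j<N. c j)" by (intro sum.cong) auto
  then show ?case
    using c by (intro exI[of _ "c(N := x)"]) (auto simp: x_def less_Suc_eq)
qed simp

lemma typed_partition:
  fixes c d :: "nat \<Rightarrow> nat"
  assumes "finite S" "(\<Sum>j<N. c j) = card (S \<inter> A)" "(\<Sum>j<N. d j) = card (S - A)"
  shows "\<exists>D. disjoint_family_on D {..<N} \<and> (\<Union>j<N. D j) = S \<and>
    (\<forall>j<N. card (D j \<inter> A) = c j \<and> card (D j - A) = d j)"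
  using assms
proof (induction N arbitrary: S)
  case 0
  then have "S \<inter> A = {}" "S - A = {}" by auto
  then show ?case by (auto simp: disjoint_family_on_def)
next
  case (Suc N)
  have "c N \<le> card (S \<inter> A)" "d N \<le> card (S - A)" using Suc.prems by auto
  then obtain X Y where X: "X \<subseteq> S \<inter> A" "card X = c N" and Y: "Y \<subseteq> S - A" "card Y = d N"
    by (meson obtain_subset_with_card_n)
  define S' where "S' = S - (X \<union> Y)"
  have fin: "finite X" "finite Y" "finite S'" using X Y Suc.prems(1) finite_subset by (auto simp: S'_def)
  have "S' \<inter> A = (S \<inter> A) - X" "S' - A = (S - A) - Y" using X Y by (auto simp: S'_def)
  then have "card (S' \<inter> A) = card (S \<inter> A) - c N" "card (S' - A) = card (S - A) - d N"
    using X Y fin by (simp_all add: card_Diff_subset)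
  then have "\<exists>D. disjoint_family_on D {..<N} \<and> (\<Union>j<N. D j) = S' \<and>
    (\<forall>j<N. card (D j \<inter> A) = c j \<and> card (D j - A) = d j)"
    using Suc.prems fin by (intro Suc.IH) auto
  then obtain D where D: "disjoint_family_on D {..<N}" "(\<Union>j<N. D j) = S'"
    "\<And>j. j < N \<Longrightarrow> card (D j \<inter> A) = c j \<and> card (D j - A) = d j" by blast
  define D' where "D' = D(N := X \<union> Y)"
  have "(X \<union> Y) \<inter> A = X" "(X \<union> Y) - A = Y" using X Y by auto
  then have "card (D' j \<inter> A) = c j \<and> card (D' j - A) = d j" if "j < Suc N" for j
    using that D(3)[of j] X Y by (auto simp: D'_def less_Suc_eq)
  moreover have "(\<Union>j<Suc N. D' j) = (X \<union> Y) \<union> (\<Union>j<N. D j)"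
    by (auto simp: D'_def less_Suc_eq split: if_splits)
  then have "(\<Union>j<Suc N. D' j) = S" using D(2) X Y by (auto simp: S'_def)
  moreover have "disjoint_family_on D' {..<Suc N}"
    unfolding disjoint_family_on_def
  proof (intro ballI impI)
    fix i j assume ij: "i \<in> {..<Suc N}" "j \<in> {..<Suc N}" "i \<noteq> j"
    have DX: "D i' \<inter> (X \<union> Y) = {}" if "i' < N" for i' using D(2) that by (auto simp: S'_def)
    consider "i = N" "j < N" | "j = N" "i < N" | "i < N" "j < N" using ij by fastforce
    then show "D' i \<inter> D' j = {}"
    proof cases
      case 1
      then show ?thesis using DX[of j] by (simp add: D'_def Int_commute)
    next
      case 2
      then show ?thesis using DX[of i] by (simp add: D'_def)
    next
      case 3
      then show ?thesis using disjoint_family_onD[OF D(1), of i j] ij by (simp add: D'_def)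
    qed
  qed
  ultimately show ?case by (intro exI[of _ D']) blast
qed

lemma sum_alternating:
  fixes f :: "bool \<Rightarrow> nat"
  shows "(\<Sum>j<2 * T. f (even j)) = T * (f True + f False)"
  by (induction T) (auto simp: algebra_simps)

lemma sum_Un_le:
  fixes f :: "'b \<Rightarrow> real"
  assumes "finite P" "finite Q" "\<And>x. 0 \<le> f x"
  shows "sum f (P \<union> Q) \<le> sum f P + sum f Q"
proof -
  have "sum f (P \<union> Q) + sum f (P \<inter> Q) = sum f P + sum f Q" by (rule sum.union_inter[OF assms(1,2)])
  then show ?thesis using sum_nonneg[of "P \<inter> Q" f] assms(3) by simp
qed

lemma sum_UN_le:
  fixes f :: "'b \<Rightarrow> real"
  assumes "finite I" "\<And>i. i \<in> I \<Longrightarrow> finite (P i)" "\<And>x. 0 \<le> f x"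
  shows "sum f (\<Union>i\<in>I. P i) \<le> (\<Sum>i\<in>I. sum f (P i))"
  using assms
proof (induction I rule: finite_induct)
  case (insert i I)
  have "sum f (\<Union>i\<in>insert i I. P i) \<le> sum f (P i) + sum f (\<Union>i\<in>I. P i)"
    using sum_Un_le[of "P i" "\<Union>i\<in>I. P i" f] insert by simp
  then show ?case using insert by simp
qed simp

lemma sorted_wrt_disjoint_card:
  assumes "sorted_wrt (\<lambda>X Y. X \<inter> Y = {}) xs" "\<And>X. X \<in> set xs \<Longrightarrow> finite X"
  shows "card (\<Union> (set xs) \<inter> A) = sum_list (map (\<lambda>X. card (X \<inter> A)) xs)"
  using assms
proof (induction xs)
  case (Cons X xs)
  have "\<Union> (set (X # xs)) \<inter> A = (X \<union> \<Union> (set xs)) \<inter> A" by auto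
  moreover have "card ((X \<union> \<Union> (set xs)) \<inter> A) = card (X \<inter> A) + card (\<Union> (set xs) \<inter> A)"
    using Cons.prems by (intro card_Un_inter) auto
  ultimately show ?case using Cons by simp
qed simp

context near_parity
begin

lemma shape_nth:
  "shape r xs \<longleftrightarrow> (\<forall>i<length xs. xs ! i \<subseteq> V \<and> card (xs ! i) = role_size (r = even i))"
proof (induction xs arbitrary: r)
  case (Cons W xs)
  have eq: "((\<not> r) = even i) = (r = even (Suc i))" for i by auto
  show ?case
    unfolding shape.simps Cons.IH eq by (auto simp: nth_Cons split: nat.splits)
qed simp

lemma shape_even_length:
  assumes "shape r xs" "even (length xs)"
  shows "sum_list (map card xs) = k * (length xs div 2) \<and> parity_sum a b r xs = (a + b) * (length xs div 2)"
  using assms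
proof (induction xs rule: induct_list012)
  case (3 X Y zs)
  have "role_parity a b r + role_parity a b (\<not> r) = a + b" by (simp add: role_parity_def)
  then show ?case using 3 role_size_bounds(3)[of r] by (auto simp: algebra_simps)
qed auto

lemma cycle_from_list:
  assumes ys: "shape True ys" "length ys = 2 * t" "t > 0" "sorted_wrt (\<lambda>X Y. X \<inter> Y = {}) ys" "verts ys = V"
    "successively (\<lambda>X Y. X \<union> Y \<in> H) ys" "last ys \<union> hd ys \<in> H"
  shows "has_hamilton_cycle l m V H"
proof -
  define L where "L i = ys ! (2 * i)" for i
  define R where "R i = ys ! (2 * i + 1)" for i
  have dj: "ys ! i \<inter> ys ! j = {}" if "i < 2 * t" "j < 2 * t" "i \<noteq> j" for i j
    using ys(4) that ys(2) unfolding sorted_wrt_iff_nth_less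
    by (metis inf_commute linorder_neqE_nat)
  have sh: "ys ! i \<subseteq> V \<and> card (ys ! i) = role_size (even i)" if "i < 2 * t" for i
    using ys(1,2) that unfolding shape_nth by auto
  have adj: "ys ! i \<union> ys ! Suc i \<in> H" if "Suc i < 2 * t" for i
    using successively_nth[OF ys(6)] that ys(2) by simp
  have "hamilton_cycle l m V H t L R"
    unfolding hamilton_cycle_def
  proof (intro conjI)
    show "t > 0" by (rule ys(3))
    show "\<forall>i<t. L i \<in> [V]\<^bsup>l\<^esup> \<and> R i \<in> [V]\<^bsup>m\<^esup>"
    proof (intro allI impI)
      fix i assume "i < t"
      then have "2 * i < 2 * t" "2 * i + 1 < 2 * t" by auto
      then show "L i \<in> [V]\<^bsup>l\<^esup> \<and> R i \<in> [V]\<^bsup>m\<^esup>"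
        using sh[of "2 * i"] sh[of "2 * i + 1"] finV finite_subset
        by (auto simp: L_def R_def nsets_def role_size_def)
    qed
    show "disjoint_family_on L {..<t}"
      unfolding disjoint_family_on_def L_def by (intro ballI impI dj) auto
    show "disjoint_family_on R {..<t}"
      unfolding disjoint_family_on_def R_def by (intro ballI impI dj) auto
    show "\<forall>i<t. \<forall>j<t. L i \<inter> R j = {}"
      unfolding L_def R_def by (intro allI impI dj) presburger+
    show "(\<Union>i<t. L i \<union> R i) = V"
    proof
      show "(\<Union>i<t. L i \<union> R i) \<subseteq> V"
      proof (rule UN_least)
        fix i assume "i \<in> {..<t}"
        then show "L i \<union> R i \<subseteq> V" using sh[of "2 * i"] sh[of "2 * i + 1"] by (auto simp: L_def R_def)
      qed
      show "V \<subseteq> (\<Union>i<t. L i \<union> R i)"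
      proof
        fix v assume "v \<in> V"
        then obtain j where j: "j < 2 * t" "v \<in> ys ! j"
          using ys(2,5) by (auto simp: verts_def in_set_conv_nth)
        have "j div 2 < t" using j(1) by auto
        moreover have "j = 2 * (j div 2) \<or> j = 2 * (j div 2) + 1" by presburger
        then have "v \<in> L (j div 2) \<union> R (j div 2)" using j(2) by (auto simp: L_def R_def)
        ultimately show "v \<in> (\<Union>i<t. L i \<union> R i)" by blast
      qed
    qed
    show "\<forall>i<t. L i \<union> R i \<in> H \<and> R i \<union> L (Suc i mod t) \<in> H"
    proof (intro allI impI conjI)
      fix i assume i: "i < t"
      show "L i \<union> R i \<in> H" using adj[of "2 * i"] i by (simp add: L_def R_def)
      show "R i \<union> L (Suc i mod t) \<in> H"
      proof (cases "Suc i = t")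
        case True
        have ne: "ys \<noteq> []" using ys(2,3) by auto
        have "2 * t - 1 = 2 * i + 1" using True by linarith
        then have "last ys = ys ! (2 * i + 1)" by (simp only: last_conv_nth[OF ne] ys(2))
        moreover have "hd ys = ys ! 0" using ne by (simp add: hd_conv_nth)
        ultimately show ?thesis using ys(7) True by (simp add: L_def R_def)
      next
        case False
        then have "Suc i < t" using i by simp
        then show ?thesis using adj[of "2 * i + 1"] by (simp add: L_def R_def)
      qed
    qed
  qed
  then show ?thesis by (auto simp: has_hamilton_cycle_def)
qed


text \<open>The blocks of the remaining part of the cycle are placed by the local lemma: the constraint
  \<open>i\<close> is that the image of \<open>E i\<close>, together with the fixed end block \<open>F i\<close>, is an edge.\<close>

lemma random_blocks:
  assumes ab: "even (a + b + p)" and T: "T > 0" "2 * T \<le> n"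
    and X0: "typical X0" "card X0 = m" "even (card (X0 \<inter> A) + b)"
    and X1: "typical X1" "card X1 = l" "even (card (X1 \<inter> A) + a)"
    and S: "S \<subseteq> V1" "S \<inter> X0 = {}" "S \<inter> X1 = {}"
    and large: "real n \<le> 4 * real (card (S \<inter> A))" "real n \<le> 4 * real (card (S - A))"
    and D: "disjoint_family_on D {..<2 * T}" "(\<Union>j<2 * T. D j) = S"
      "\<And>j. j < 2 * T \<Longrightarrow> card (D j) = role_size (even j)"
      "\<And>j. j < 2 * T \<Longrightarrow> even (card (D j \<inter> A) + role_parity a b (even j))"
  shows "\<exists>\<phi>. \<phi> permutes S \<and> (\<forall>v. \<phi> v \<in> A \<longleftrightarrow> v \<in> A) \<and> X0 \<union> \<phi> ` D 0 \<in> H \<and> \<phi> ` D (2 * T - 1) \<union> X1 \<in> H \<and>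
    (\<forall>i. Suc i < 2 * T \<longrightarrow> \<phi> ` D i \<union> \<phi> ` D (Suc i) \<in> H)"
proof -
  have finS: "finite S" using S(1) finV1 finite_subset by blast
  interpret typed_permutations S A by unfold_locales (rule finS)
  have DS: "D j \<subseteq> S" "finite (D j)" if "j < 2 * T" for j
  proof -
    show "D j \<subseteq> S" using D(2) that by auto
    then show "finite (D j)" by (rule finite_subset[OF _ finS])
  qed
  define E where "E i = (if i = 0 then {} else D (i - 1)) \<union> (if i < 2 * T then D i else {})" for i
  define F where "F i = (if i = 0 then X0 else if i = 2 * T then X1 else {})" for i
  \<comment> \<open>The forbidden images of \<open>E i\<close>. Permutations preserve types, so only
    sets of the type of \<open>E i\<close> have to be excluded.\<close>
  define XX where "XX i = {X. X \<subseteq> S \<and> card (X \<inter> A) = card (E i \<inter> A) \<and> card (X - A) = card (E i - A) \<and> F i \<union> X \<notin> H}" for i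
  define \<B> where "\<B> = (\<lambda>(i, X). (E i, X)) ` Sigma {..2 * T} XX"
  define M where "M i = placements (E i)" for i
  have E0: "E 0 = D 0" using T by (simp add: E_def)
  have E1: "E (2 * T) = D (2 * T - 1)" using T by (simp add: E_def)
  have Em: "E (Suc i) = D i \<union> D (Suc i)" if "Suc i < 2 * T" for i using that by (simp add: E_def)
  have ES: "E i \<subseteq> S" if "i \<le> 2 * T" for i
    using that DS(1)[of "i - 1"] DS(1)[of i] by (auto simp: E_def)
  have finE: "finite (E i)" if "i \<le> 2 * T" for i using ES[OF that] finS finite_subset by blast
  have cE: "card (E i) = (if i = 0 then l else if i = 2 * T then m else k)"
    and pE: "even (card (E i \<inter> A) + (if i = 0 then a else if i = 2 * T then b else p))" if i: "i \<le> 2 * T" for i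
  proof -
    consider "i = 0" | "i = 2 * T" "i > 0" | j where "i = Suc j" "Suc j < 2 * T"
      using i by (cases i) fastforce+
    then have "card (E i) = (if i = 0 then l else if i = 2 * T then m else k) \<and>
      even (card (E i \<inter> A) + (if i = 0 then a else if i = 2 * T then b else p))"
    proof cases
      case 1
      then show ?thesis using D(3)[of 0] D(4)[of 0] T E0 by (simp add: role_size_def role_parity_def)
    next
      case 2
      have "2 * T - 1 < 2 * T" "odd (2 * T - 1)" using T by auto
      then show ?thesis using D(3)[of "2 * T - 1"] D(4)[of "2 * T - 1"] E1 2 by (simp add: role_size_def role_parity_def)
    next
      case 3
      have dj: "D j \<inter> D (Suc j) = {}" using disjoint_family_onD[OF D(1), of j "Suc j"] 3 by simp
      have "card (E i) = card (D j) + card (D (Suc j))"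
        using 3 Em[of j] dj DS(2) by (simp add: card_Un_disjoint)
      also have "\<dots> = k" using D(3)[of j] D(3)[of "Suc j"] 3 role_size_bounds(3)[of "even j"] by simp
      finally have c: "card (E i) = k" .
      have "card (E i \<inter> A) = card (D j \<inter> A) + card (D (Suc j) \<inter> A)"
        using 3 Em[of j] dj DS(2) card_Un_inter[of "D j" "D (Suc j)" A] by simp
      moreover have "even (card (D j \<inter> A) + role_parity a b (even j))" using D(4)[of j] 3 by simp
      moreover have "even (card (D (Suc j) \<inter> A) + role_parity a b (\<not> even j))" using D(4)[of "Suc j"] 3 by simp
      ultimately have "even (card (E i \<inter> A) + p)" using role_parity_not[OF ab, of "even j"] by presburger
      then show ?thesis using 3 c by simp
    qed
    then show "card (E i) = (if i = 0 then l else if i = 2 * T then m else k)"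
      "even (card (E i \<inter> A) + (if i = 0 then a else if i = 2 * T then b else p))" by blast+
  qed
  have cEpos: "0 < card (E i)" "card (E i) \<le> k" if "i \<le> 2 * T" for i using cE[OF that] klm by auto
  have Xcard: "card X = card (E i)" "finite X" "X \<subseteq> V1" "X \<in> [V1]\<^bsup>(card (E i))\<^esup>" if "X \<in> XX i" "i \<le> 2 * T" for X i
  proof -
    show f: "finite X" using that finS finite_subset by (auto simp: XX_def)
    show c: "card X = card (E i)"
      using card_Int_Diff[OF f, of A] card_Int_Diff[OF finE[OF that(2)], of A] that(1) by (auto simp: XX_def)
    show "X \<subseteq> V1" using that S(1) by (auto simp: XX_def)
    then show "X \<in> [V1]\<^bsup>(card (E i))\<^esup>" using f c by (simp add: nsets_def)
  qed
  have Xpar: "even (card (X \<inter> A) + (if i = 0 then a else if i = 2 * T then b else p))" if "X \<in> XX i" "i \<le> 2 * T" for X i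
    using pE[OF that(2)] that(1) by (simp add: XX_def)
  have finXX: "finite (XX i)" for i using finS by (simp add: XX_def)
  have XM: "placements X = M i" if "X \<in> XX i" for X i
    using that by (simp add: XX_def M_def placements_def)
  have Mlow: "g * real n ^ card (E i) \<le> real (M i)" if i: "i \<le> 2 * T" for i
  proof -
    have split: "card (E i) = card (E i \<inter> A) + card (E i - A)"
      by (rule card_Int_Diff[OF finE[OF i]])
    have "g * real n ^ card (E i) \<le> (1 / (4 * real k)) ^ card (E i) * real n ^ card (E i)"
    proof (rule mult_right_mono)
      have "(1 / (4 * real k)) ^ k \<le> (1 / (4 * real k)) ^ card (E i)"
        using cEpos[OF i] kpos by (intro power_decreasing) (auto simp: field_simps)
      then show "g \<le> (1 / (4 * real k)) ^ card (E i)" using gsmall by linarith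
    qed simp
    also have "\<dots> = (real n / 4 / real k) ^ card (E i)" by (simp add: power_divide power_mult_distrib)
    also have "\<dots> = (real n / 4 / real k) ^ (card (E i \<inter> A) + card (E i - A))"
      by (rule arg_cong[OF split])
    also have "(real n / 4 / real k) ^ (card (E i \<inter> A) + card (E i - A)) \<le> real (M i)"
      unfolding M_def placements_def
    proof (rule choose_mult_ge)
      show "card (E i \<inter> A) + card (E i - A) \<le> k"
        using split cEpos[OF i] by simp
      show "real k \<le> real n / 4" using nbig g_less_1 mult_right_mono[OF g_less_1, of "real n"] by linarith
    qed (use large kpos in auto)
    finally show ?thesis .
  qed
  have npow: "real n ^ j > 0" for j using npos by simp
  have Mpos: "real (M i) > 0" if "i \<le> 2 * T" for i
    using Mlow[OF that] mult_pos_pos[OF gpos npow[of "card (E i)"]] by linarith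
  have \<delta>\<eta>: "16 * real k * \<delta> \<le> g * \<eta>" "\<delta> \<le> \<eta>" "\<eta> \<le> 1"
  proof -
    have "2 * k \<le> 2 ^ k"
    proof -
      have "2 * j \<le> (2::nat) ^ j" if "j \<ge> 2" for j using that by (induction j rule: dec_induct) auto
      then show ?thesis using klm(4) by simp
    qed
    then have "2 * real k \<le> 2 ^ k" by (metis of_nat_le_iff of_nat_mult of_nat_numeral of_nat_power)
    then have "2 * real k * (8 * \<delta>) \<le> 2 ^ k * (8 * \<delta>)" using \<delta>pos by (intro mult_right_mono) auto
    then show 1: "16 * real k * \<delta> \<le> g * \<eta>" using \<delta>small by (simp add: mult_ac)
    have "g * \<eta> \<le> 1 * \<eta>" using g_less_1 \<eta>pos by (intro mult_right_mono) auto
    moreover have "1 * \<delta> \<le> 16 * real k * \<delta>" using kpos \<delta>pos by (intro mult_right_mono) auto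
    ultimately show "\<delta> \<le> \<eta>" using 1 by linarith
    show "\<eta> \<le> 1" using \<eta>small g_less_1 \<eta>pos by linarith
  qed
  \<comment> \<open>For the two outer constraints it is the typicality of the fixed end block that
    limits the forbidden images.\<close>
  have end_bound: "real (card (XX i)) \<le> \<eta> * real n ^ card (E i)"
    if i: "i \<le> 2 * T" "F i = Y" and Y: "typical Y" "k - card Y = card (E i)" "S \<inter> Y = {}"
      and par: "\<And>X. X \<in> XX i \<Longrightarrow> even (card (Y \<inter> A) + card (X \<inter> A) + p)" for i Y
  proof -
    have "XX i \<subseteq> blocked Y"
    proof
      fix X assume X: "X \<in> XX i"
      have disj: "Y \<inter> X = {}" using X Y(3) by (auto simp: XX_def)
      have "card ((Y \<union> X) \<inter> A) = card (Y \<inter> A) + card (X \<inter> A)"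
        using typical_subset[OF Y(1)] Xcard(2)[OF X i(1)] disj by (intro card_Un_inter) auto
      then show "X \<in> blocked Y"
        using par[OF X] Xcard(4)[OF X i(1)] X i(2) Y(2) disj by (auto simp: XX_def blocked_def)
    qed
    then have "card (XX i) \<le> card (blocked Y)" using fin_nsets by (intro card_mono) (auto simp: blocked_def)
    then show ?thesis using Y(1,2) by (simp add: typical_def)
  qed
  have cXX: "real (card (XX i)) \<le> \<eta> * real n ^ card (E i)" if i: "i \<le> 2 * T" for i
  proof -
    consider "i = 0" | "i = 2 * T" "i > 0" | "0 < i" "i < 2 * T" using i by linarith
    then show ?thesis
    proof cases
      case 1
      show ?thesis
      proof (rule end_bound[OF i _ X0(1) _ S(2)])
        show "even (card (X0 \<inter> A) + card (X \<inter> A) + p)" if "X \<in> XX i" for X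
          using Xpar[OF that i] X0(3) ab 1 by simp presburger
      qed (use cE[OF i] 1 X0(2) klm(1) in \<open>auto simp: F_def\<close>)
    next
      case 2
      show ?thesis
      proof (rule end_bound[OF i _ X1(1) _ S(3)])
        show "even (card (X1 \<inter> A) + card (X \<inter> A) + p)" if "X \<in> XX i" for X
          using Xpar[OF that i] X1(3) ab 2 by simp
      qed (use cE[OF i] 2 X1(2) klm(1) in \<open>auto simp: F_def\<close>)
    next
      case 3
      have "XX i \<subseteq> miss"
      proof
        fix X assume X: "X \<in> XX i"
        show "X \<in> miss" using Xcard(4)[OF X i] Xpar[OF X i] X 3 cE[OF i] by (auto simp: miss_def XX_def F_def)
      qed
      then have "card (XX i) \<le> card miss" using fin_nsets by (intro card_mono) (auto simp: miss_def)
      then have "real (card (XX i)) \<le> \<delta> * real n ^ k" using card_miss by linarith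
      also have "\<dots> \<le> \<eta> * real n ^ k" using \<delta>\<eta>(2) by (intro mult_right_mono) auto
      finally show ?thesis using cE[OF i] 3 by simp
    qed
  qed
  \<comment> \<open>Typicality says nothing about the forbidden images through one vertex, so the
    two outer constraints get only the trivial bound. This suffices: there are just two of them,
    whereas the up to \<open>n\<close> inner constraints gain the factor \<delta>.\<close>
  have cXv: "real (card {X \<in> XX i. v \<in> X}) \<le> (if i = 0 \<or> i = 2 * T then 1 else \<delta>) * real n ^ (card (E i) - 1)"
    if i: "i \<le> 2 * T" and v: "v \<in> S" for i v
  proof (cases "i = 0 \<or> i = 2 * T")
    case True
    have "{X \<in> XX i. v \<in> X} \<subseteq> {X \<in> [V]\<^bsup>(card (E i))\<^esup>. v \<in> X}" using Xcard(4)[OF _ i] V1_nsets by blast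
    then have "card {X \<in> XX i. v \<in> X} \<le> card {X \<in> [V]\<^bsup>(card (E i))\<^esup>. v \<in> X}"
      using fin_nsets by (intro card_mono) auto
    also have "\<dots> \<le> n ^ (card (E i) - 1)" by (rule card_containing_le[OF finV cEpos(1)[OF i]])
    finally have "real (card {X \<in> XX i. v \<in> X}) \<le> real (n ^ (card (E i) - 1))" by (rule of_nat_mono)
    then show ?thesis using True by simp
  next
    case False
    have "{X \<in> XX i. v \<in> X} \<subseteq> {e \<in> [V1]\<^bsup>k\<^esup>. v \<in> e \<and> right e \<and> e \<notin> H}"
    proof
      fix X assume X: "X \<in> {X \<in> XX i. v \<in> X}"
      then have X': "X \<in> XX i" by simp
      show "X \<in> {e \<in> [V1]\<^bsup>k\<^esup>. v \<in> e \<and> right e \<and> e \<notin> H}"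
        using Xcard(4)[OF X' i] Xpar[OF X' i] X False cE[OF i] by (auto simp: XX_def F_def)
    qed
    then have "card {X \<in> XX i. v \<in> X} \<le> card {e \<in> [V1]\<^bsup>k\<^esup>. v \<in> e \<and> right e \<and> e \<notin> H}"
      using fin_nsets by (intro card_mono) auto
    then show ?thesis using missing[of v] v S(1) cE[OF i] False by auto
  qed
  have fin\<B>: "finite \<B>" unfolding \<B>_def using finXX by auto
  have ev: "event B" if B_in: "B \<in> \<B>" for B
  proof -
    obtain i X where "i \<le> 2 * T" "X \<in> XX i" "B = (E i, X)" using B_in by (auto simp: \<B>_def)
    then show ?thesis using ES cEpos(1)[of i] by (auto simp: event_def XX_def)
  qed
  have ratio1: "real (card (XX i)) / real (M i) \<le> \<eta> / g" if i: "i \<le> 2 * T" for i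
  proof -
    have "real (card (XX i)) / real (M i) \<le> (\<eta> * real n ^ card (E i)) / (g * real n ^ card (E i))"
      using cXX[OF i] Mlow[OF i] gpos npow[of "card (E i)"] \<eta>pos by (intro frac_le) auto
    also have "\<dots> = \<eta> / g" using npos by simp
    finally show ?thesis .
  qed
  have ratio2: "real (card {X \<in> XX i. v \<in> X}) / real (M i) \<le> (if i = 0 \<or> i = 2 * T then 1 else \<delta>) / (g * real n)"
    if i: "i \<le> 2 * T" and v: "v \<in> S" for i v
  proof -
    let ?c = "if i = 0 \<or> i = 2 * T then 1 else \<delta>" and ?e = "card (E i)"
    have "real (card {X \<in> XX i. v \<in> X}) / real (M i) \<le> (?c * real n ^ (?e - 1)) / (g * real n ^ ?e)"
      using cXv[OF i v] Mlow[OF i] gpos npow[of "card (E i)"] \<delta>pos by (intro frac_le) auto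
    also have "real n ^ ?e = real n * real n ^ (?e - 1)" by (rule power_split[OF cEpos(1)[OF i], symmetric])
    also have "(?c * real n ^ (?e - 1)) / (g * (real n * real n ^ (?e - 1))) = ?c / (g * real n)"
      using npos by simp
    finally show ?thesis .
  qed
  \<comment> \<open>A conflict arises either from overlapping domains, possible for at most three
    indices and contributing 3 * \<eta> / g, or from a common vertex of the images, summed over the
    at most \<open>k\<close> vertices of \<open>X\<close>. In total at most 1/12 + 1/500 +
    1/16.\<close>
  have sparse: "(\<Sum>C | C \<in> \<B> \<and> conflict B C. 1 / real (placements (snd C))) \<le> 1/4" if B: "B \<in> \<B>" for B
  proof -
    obtain i X where iX: "i \<le> 2 * T" "X \<in> XX i" "B = (E i, X)" using B by (auto simp: \<B>_def)
    define f where "f = (\<lambda>(j, Y::'a set). 1 / real (M j))"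
    have f0: "0 \<le> f x" for x by (auto simp: f_def split: prod.splits)
    define P where "P = {(j, Y). j \<le> 2 * T \<and> Y \<in> XX j \<and> conflict B (E j, Y)}"
    define J where "J = {j. j \<le> 2 * T \<and> E i \<inter> E j \<noteq> {}}"
    define P1 where "P1 = Sigma J XX"
    define P2 where "P2 v = Sigma {..2 * T} (\<lambda>j. {Y \<in> XX j. v \<in> Y})" for v
    have finX: "finite X" "card X \<le> k" "X \<subseteq> S"
      using Xcard(1,2)[OF iX(2,1)] cEpos(2)[OF iX(1)] iX(2) by (auto simp: XX_def)
    have finJ: "finite J" by (rule finite_subset[of _ "{..2 * T}"]) (auto simp: J_def)
    have fin: "finite P" "finite P1" "finite (P2 v)" for v
    proof -
      show "finite P" by (rule finite_subset[of _ "Sigma {..2 * T} XX"]) (use finXX in \<open>auto simp: P_def\<close>)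
      show "finite P1" "finite (P2 v)" using finXX finJ by (auto simp: P1_def P2_def)
    qed
    have "{C. C \<in> \<B> \<and> conflict B C} = (\<lambda>(i, X). (E i, X)) ` P" by (auto simp: \<B>_def P_def)
    then have "(\<Sum>C | C \<in> \<B> \<and> conflict B C. 1 / real (placements (snd C))) \<le>
        sum ((\<lambda>C. 1 / real (placements (snd C))) \<circ> (\<lambda>(i, X). (E i, X))) P"
      using sum_image_le[OF fin(1), of "\<lambda>C. 1 / real (placements (snd C))" "\<lambda>(i, X). (E i, X)"] by simp
    also have "\<dots> = sum f P"
      by (rule sum.cong) (auto simp: P_def f_def XM)
    also have "\<dots> \<le> sum f (P1 \<union> (\<Union>v\<in>X. P2 v))"
    proof (rule sum_mono2)
      show "finite (P1 \<union> (\<Union>v\<in>X. P2 v))" using fin finX by simp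
      show "P \<subseteq> P1 \<union> (\<Union>v\<in>X. P2 v)"
        by (auto simp: P_def P1_def P2_def J_def conflict_def iX(3))
    qed (use f0 in auto)
    also have "\<dots> \<le> sum f P1 + sum f (\<Union>v\<in>X. P2 v)" using fin finX f0 by (intro sum_Un_le) auto
    also have "sum f (\<Union>v\<in>X. P2 v) \<le> (\<Sum>v\<in>X. sum f (P2 v))" using fin finX f0 by (intro sum_UN_le) auto
    also have "sum f P1 \<le> 3 * (\<eta> / g)"
    proof -
      have "sum f P1 = (\<Sum>j\<in>J. \<Sum>Y\<in>XX j. 1 / real (M j))"
        unfolding P1_def f_def using finJ finXX by (subst sum.Sigma) auto
      also have "\<dots> = (\<Sum>j\<in>J. real (card (XX j)) / real (M j))" by simp
      also have "\<dots> \<le> (\<Sum>j\<in>J. \<eta> / g)" by (intro sum_mono ratio1) (auto simp: J_def)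
      also have "\<dots> = real (card J) * (\<eta> / g)" by simp
      also have "\<dots> \<le> 3 * (\<eta> / g)"
      proof (rule mult_right_mono)
        \<comment> \<open>Each \<open>E i\<close> consists of at most two consecutive blocks of a
          disjoint family, so only neighbouring constraints overlap.\<close>
        have "J \<subseteq> {i - 1, i, i + 1}"
        proof
          fix j assume "j \<in> J"
          then obtain v where v: "v \<in> E i" "v \<in> E j" and j: "j \<le> 2 * T" by (auto simp: J_def)
          obtain i' where i': "v \<in> D i'" "i' < 2 * T" "i' = i \<or> Suc i' = i"
            using v(1) iX(1) by (auto simp: E_def split: if_splits)
          obtain j' where j': "v \<in> D j'" "j' < 2 * T" "j' = j \<or> Suc j' = j"
            using v(2) j by (auto simp: E_def split: if_splits)
          have "i' = j'" using disjoint_family_onD[OF D(1), of i' j'] i' j' by auto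
          then show "j \<in> {i - 1, i, i + 1}" using i'(3) j'(3) by auto
        qed
        then have "card J \<le> card {i - 1, i, i + 1}" by (intro card_mono) auto
        also have "\<dots> \<le> 3" by (simp add: card_insert_if)
        finally show "real (card J) \<le> 3" by simp
      qed (use gpos \<eta>pos in auto)
      finally show ?thesis .
    qed
    also have "(\<Sum>v\<in>X. sum f (P2 v)) \<le> (\<Sum>v\<in>X. 2 / (g * real n) + \<delta> / g)"
    proof (rule sum_mono)
      fix v assume "v \<in> X"
      then have v: "v \<in> S" using finX by blast
      have "sum f (P2 v) = (\<Sum>j\<le>2 * T. \<Sum>Y | Y \<in> XX j \<and> v \<in> Y. 1 / real (M j))"
        unfolding P2_def f_def using finXX by (subst sum.Sigma) auto
      also have "\<dots> = (\<Sum>j\<le>2 * T. real (card {Y \<in> XX j. v \<in> Y}) / real (M j))" by simp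
      also have "\<dots> \<le> (\<Sum>j\<le>2 * T. (if j = 0 \<or> j = 2 * T then 1 else \<delta>) / (g * real n))"
        by (intro sum_mono ratio2 v) auto
      also have "{..2 * T} = {0, 2 * T} \<union> {0<..<2 * T}" using T by auto
      also have "(\<Sum>j\<in>{0, 2 * T} \<union> {0<..<2 * T}. (if j = 0 \<or> j = 2 * T then 1 else \<delta>) / (g * real n)) =
          (\<Sum>j\<in>{0, 2 * T}. (if j = 0 \<or> j = 2 * T then 1 else \<delta>) / (g * real n)) +
          (\<Sum>j\<in>{0<..<2 * T}. (if j = 0 \<or> j = 2 * T then 1 else \<delta>) / (g * real n))"
        by (rule sum.union_disjoint) auto
      also have "(\<Sum>j\<in>{0, 2 * T}. (if j = 0 \<or> j = 2 * T then 1 else \<delta>) / (g * real n)) = 2 / (g * real n)"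
        using T by simp
      also have "(\<Sum>j\<in>{0<..<2 * T}. (if j = 0 \<or> j = 2 * T then 1 else \<delta>) / (g * real n)) = (\<Sum>j\<in>{0<..<2 * T}. \<delta> / (g * real n))"
        by (rule sum.cong) auto
      also have "\<dots> = real (2 * T - 1) * (\<delta> / (g * real n))" by simp
      also have "\<dots> \<le> real n * (\<delta> / (g * real n))"
        using T(2) gpos \<delta>pos by (intro mult_right_mono) auto
      also have "\<dots> = \<delta> / g" using npos by simp
      finally show "sum f (P2 v) \<le> 2 / (g * real n) + \<delta> / g" by simp
    qed
    also have "(\<Sum>v\<in>X. 2 / (g * real n) + \<delta> / g) = real (card X) * (2 / (g * real n) + \<delta> / g)" by simp
    also have "\<dots> \<le> real k * (2 / (g * real n) + \<delta> / g)"
      using finX(2) gpos \<delta>pos by (intro mult_right_mono) auto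
    also have "real k * (2 / (g * real n) + \<delta> / g) = 2 * real k / (g * real n) + real k * \<delta> / g"
      by (simp add: algebra_simps)
    also have "2 * real k / (g * real n) \<le> 1 / 500"
    proof -
      have "g * real n > 0" using gpos npos by simp
      then show ?thesis using nbig by (simp add: field_simps)
    qed
    also have "real k * \<delta> / g \<le> 1 / 16"
    proof -
      have "16 * (real k * \<delta>) \<le> g" using \<delta>\<eta>(1) mult_left_mono[OF \<delta>\<eta>(3), of g] gpos by linarith
      then show ?thesis using gpos by (simp add: field_simps)
    qed
    also have "3 * (\<eta> / g) \<le> 1 / 12" using \<eta>small gpos by (simp add: field_simps)
    finally show ?thesis by simp
  qed
  have "avoiding \<B> \<noteq> {}" by (rule avoiding_nonempty[OF fin\<B> ev sparse])
  then obtain \<phi> where \<phi>: "\<phi> \<in> avoiding \<B>" by blast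
  have perm: "\<phi> permutes S" and types: "\<And>v. \<phi> v \<in> A \<longleftrightarrow> v \<in> A" using \<phi> by (auto simp: avoiding_def perms_def)
  have edge: "F i \<union> \<phi> ` E i \<in> H" if i: "i \<le> 2 * T" for i
  proof (rule ccontr)
    assume neg: "F i \<union> \<phi> ` E i \<notin> H"
    have inj: "inj_on \<phi> X" for X using permutes_inj[OF perm] inj_on_subset by blast
    have "\<phi> ` E i \<inter> A = \<phi> ` (E i \<inter> A)" "\<phi> ` E i - A = \<phi> ` (E i - A)" using types by auto
    then have "card (\<phi> ` E i \<inter> A) = card (E i \<inter> A)" "card (\<phi> ` E i - A) = card (E i - A)"
      using card_image[OF inj] by simp_all
    moreover have "\<phi> ` E i \<subseteq> S" using ES[OF i] permutes_image[OF perm] by blast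
    ultimately have "\<phi> ` E i \<in> XX i" using neg by (simp add: XX_def)
    then have "(E i, \<phi> ` E i) \<in> \<B>" using i by (auto simp: \<B>_def)
    then show False using \<phi> by (auto simp: avoiding_def)
  qed
  have "\<phi> ` D i \<union> \<phi> ` D (Suc i) \<in> H" if "Suc i < 2 * T" for i
    using edge[of "Suc i"] Em[OF that] that by (simp add: F_def image_Un)
  moreover have "X0 \<union> \<phi> ` D 0 \<in> H" using edge[of 0] E0 by (simp add: F_def)
  moreover have "\<phi> ` D (2 * T - 1) \<union> X1 \<in> H" using edge[of "2 * T"] E1 T by (simp add: F_def Un_commute)
  ultimately show ?thesis using perm types by blast
qed


text \<open>The uncovered vertices are cut into \<open>2 * T\<close> blocks with the sizes and
  parities of their roles, and \<open>random_blocks\<close> turns this into the rest of the cycle.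
  Such a cutting exists because \<open>par\<close> gives the number of remaining
  \<open>A\<close>-vertices the correct parity and both classes are large.\<close>

lemma path_completes:
  assumes ab: "even (a + b + p)" and xs: "path a b True w xs" "even (length xs)"
    and cover: "V - V1 \<subseteq> verts xs" and n: "n = k * t" and small: "100 * card (verts xs) \<le> n"
    and par: "even (card A + p * t + w)"
  shows "has_hamilton_cycle l m V H"
proof -
  define q where "q = length xs div 2"
  define T where "T = t - q"
  define S where "S = V - verts xs"
  define \<alpha> where "\<alpha> = a mod 2"
  define \<beta> where "\<beta> = b mod 2"
  have ne: "xs \<noteq> []" and sh: "shape True xs" and srt: "sorted_wrt (\<lambda>X Y. X \<inter> Y = {}) xs"
    and suc: "successively (\<lambda>X Y. X \<union> Y \<in> H) xs" and ty: "typical (hd xs)" "typical (last xs)"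
    and asum: "even (A_sum xs + parity_sum a b True xs + w)"
    using xs by (auto simp: path_def)
  have vV: "verts xs \<subseteq> V" and finv: "finite (verts xs)" using path_verts[OF xs(1)] by auto
  have finX: "finite X" if "X \<in> set xs" for X
    using that finv finite_subset[of X "verts xs"] by (auto simp: verts_def)
  have lx: "length xs = 2 * q" using xs(2) by (simp add: q_def)
  have cv: "card (verts xs) = k * q"
    using sorted_wrt_disjoint_card[OF srt finX, of UNIV] shape_even_length[OF sh xs(2), of a b]
    by (simp add: verts_def q_def)
  have cvA: "card (verts xs \<inter> A) = A_sum xs"
    using sorted_wrt_disjoint_card[OF srt finX, of A] by (simp add: verts_def A_sum_def)
  have "k * q < k * t" using small cv n npos by linarith
  then have qt: "q < t" by simp
  have T: "T > 0" "t = T + q" using qt by (auto simp: T_def)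
  have SV1: "S \<subseteq> V1" using cover by (auto simp: S_def)
  have finS: "finite S" using finV by (simp add: S_def)
  have cS: "card S = k * T"
    using vV finv cv n T(2) by (simp add: S_def card_Diff_subset algebra_simps)
  define x where "x = card (S \<inter> A)"
  define y where "y = card (S - A)"
  have xy: "x + y = k * T"
    using card_Int_Diff[OF finS, of A] cS by (simp add: x_def y_def)
  have "card (V1 \<inter> A) \<le> card ((S \<inter> A) \<union> verts xs)"
    using finS finv V1V by (intro card_mono) (auto simp: S_def)
  then have x1: "card (V1 \<inter> A) \<le> x + card (verts xs)"
    using card_Un_le[of "S \<inter> A" "verts xs"] by (simp add: x_def)
  have "card (V1 - A) \<le> card ((S - A) \<union> verts xs)"
    using finS finv V1V by (intro card_mono) (auto simp: S_def)
  then have y1: "card (V1 - A) \<le> y + card (verts xs)"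
    using card_Un_le[of "S - A" "verts xs"] by (simp add: y_def)
  have x2: "97 * n \<le> 300 * x" using A1 x1 small by linarith
  have y2: "97 * n \<le> 300 * y" using B1 y1 small by linarith
  \<comment> \<open>With k \<ge> 7 the number \<open>2 * T\<close> of blocks is at most 2n/7, below
    the 97n/300 vertices left in each class: every block can get a vertex of its own from either
    class.\<close>
  have kT: "7 * T \<le> n"
  proof -
    have "7 * T \<le> k * T" using klm(4) by simp
    also have "\<dots> \<le> k * t" using T(2) by simp
    finally show ?thesis using n by simp
  qed
  have x3: "2 * T \<le> x" and y3: "2 * T \<le> y" using x2 y2 kT by linarith+
  have ab2: "\<alpha> \<le> 1" "\<beta> \<le> 1" "even (a + \<alpha>)" "even (b + \<beta>)" by (auto simp: \<alpha>_def \<beta>_def)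
  \<comment> \<open>Modulo 2 the path uses \<open>p * q + w\<close> vertices of \<open>A\<close>,
    and \<open>A\<close> has \<open>p * t + w\<close> by \<open>par\<close>. So \<open>p * T\<close>
    remain, and \<alpha> + \<beta> agrees with \<open>p\<close>.\<close>
  have evx: "even (x + T * (\<alpha> + \<beta>))"
  proof -
    have "card A = card (verts xs \<inter> A) + x"
    proof -
      have "A = (verts xs \<inter> A) \<union> (S \<inter> A)" "(verts xs \<inter> A) \<inter> (S \<inter> A) = {}" using AV by (auto simp: S_def)
      then show ?thesis using card_Un_disjoint[of "verts xs \<inter> A" "S \<inter> A"] finv finS by (simp add: x_def)
    qed
    then have e3: "even (A_sum xs + x + (p * T + p * q) + w)"
      using par T(2) cvA by (simp add: distrib_left)
    have e2: "even (A_sum xs + (a + b) * q + w)"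
      using asum shape_even_length[OF sh xs(2), of a b] by (simp add: q_def)
    have "even ((a + b + p) * q)" using ab by simp
    then have e1: "even ((a + b) * q + p * q)" by (simp add: distrib_right)
    have "even (a + b + p + (a + \<alpha>) + (b + \<beta>))" using ab ab2 by presburger
    then have "even (\<alpha> + \<beta> + p)" by presburger
    then have "even (T * (\<alpha> + \<beta> + p))" by simp
    then have e4: "even (T * (\<alpha> + \<beta>) + p * T)" by (simp add: distrib_left mult.commute)
    show ?thesis using e1 e2 e3 e4 by presburger
  qed
  define rp where "rp r = (if r then \<alpha> else \<beta>)" for r
  \<comment> \<open>Each block first receives the 0 or 1 vertices of \<open>A\<close> that its
    parity demands. The remaining \<open>A\<close>-vertices are handed out in pairs;
    \<open>cap j\<close> is the number of pairs for which block \<open>j\<close> has room.\<close>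
  define cap where "cap j = (role_size (even j) - rp (even j)) div 2" for j :: nat
  define h where "h = (x - T * (\<alpha> + \<beta>)) div 2"
  have "T * (\<alpha> + \<beta>) \<le> T * 2" using ab2 by (intro mult_le_mono2) linarith
  then have base: "T * (\<alpha> + \<beta>) \<le> x" using x3 by linarith
  then have h2: "2 * h + T * (\<alpha> + \<beta>) = x" using evx by (simp add: h_def)
  \<comment> \<open>Rounding wastes at most one place per block, \<open>2 * T\<close> in total, and
    at least as many vertices outside \<open>A\<close> have to be placed anyway.\<close>
  have "h \<le> (\<Sum>j<2 * T. cap j)"
  proof -
    let ?c = "(l - \<alpha>) div 2 + (m - \<beta>) div 2"
    have "(\<Sum>j<2 * T. cap j) = T * ?c"
      unfolding cap_def using sum_alternating[of "\<lambda>r. (role_size r - rp r) div 2" T] by (simp add: role_size_def rp_def)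
    moreover have "k \<le> 2 * ?c + (\<alpha> + \<beta>) + 2"
    proof -
      have "l - \<alpha> \<le> 2 * ((l - \<alpha>) div 2) + 1" "m - \<beta> \<le> 2 * ((m - \<beta>) div 2) + 1" by presburger+
      moreover have "\<alpha> \<le> l" "\<beta> \<le> m" using klm ab2 by linarith+
      then have "l - \<alpha> + \<alpha> = l" "m - \<beta> + \<beta> = m" by simp_all
      ultimately show ?thesis using klm(1) unfolding distrib_left by linarith
    qed
    then have "T * k \<le> T * (2 * ?c + (\<alpha> + \<beta>) + 2)" by (rule mult_le_mono2)
    then have "k * T \<le> 2 * (T * ?c) + T * (\<alpha> + \<beta>) + 2 * T" by (simp add: algebra_simps)
    ultimately show ?thesis using h2 xy y3 by linarith
  qed
  then obtain hh where hh: "\<And>j. j < 2 * T \<Longrightarrow> hh j \<le> cap j" "(\<Sum>j<2 * T. hh j) = h"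
    using distribute by blast
  define c where "c j = rp (even j) + 2 * hh j" for j
  define d where "d j = role_size (even j) - c j" for j
  have cle: "c j \<le> role_size (even j)" if "j < 2 * T" for j
  proof -
    have "rp (even j) \<le> role_size (even j)" using ab2 role_size_bounds(1)[of "even j"] by (auto simp: rp_def)
    then show ?thesis using hh(1)[OF that] by (simp add: c_def cap_def)
  qed
  have sc: "(\<Sum>j<2 * T. c j) = card (S \<inter> A)"
  proof -
    have "(\<Sum>j<2 * T. c j) = T * (\<alpha> + \<beta>) + 2 * h"
      unfolding c_def sum.distrib using sum_alternating[of rp T] hh(2) by (simp add: rp_def flip: sum_distrib_left)
    then show ?thesis using h2 by (simp add: x_def)
  qed
  have "(\<Sum>j<2 * T. c j) + (\<Sum>j<2 * T. d j) = (\<Sum>j<2 * T. role_size (even j))"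
    unfolding sum.distrib[symmetric] by (intro sum.cong) (auto simp: d_def cle)
  also have "\<dots> = T * k" using sum_alternating[of role_size T] role_size_bounds(3)[of True] by simp
  finally have sd: "(\<Sum>j<2 * T. d j) = card (S - A)"
    using sc xy by (simp add: x_def y_def mult.commute)
  obtain D where D: "disjoint_family_on D {..<2 * T}" "(\<Union>j<2 * T. D j) = S"
    "\<And>j. j < 2 * T \<Longrightarrow> card (D j \<inter> A) = c j \<and> card (D j - A) = d j"
    using typed_partition[OF finS sc sd] by blast
  have DS: "D j \<subseteq> S" "finite (D j)" if "j < 2 * T" for j
  proof -
    show "D j \<subseteq> S" using D(2) that by auto
    then show "finite (D j)" by (rule finite_subset[OF _ finS])
  qed
  have cD: "card (D j) = role_size (even j)" if "j < 2 * T" for j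
    using card_Int_Diff[OF DS(2)[OF that], of A] D(3)[OF that] cle[OF that] by (simp add: d_def)
  have pD: "even (card (D j \<inter> A) + role_parity a b (even j))" if "j < 2 * T" for j
    using D(3)[OF that] ab2(3,4) by (auto simp: c_def rp_def role_parity_def)
  have ends: "card (last xs) = m" "card (hd xs) = l" "even (card (last xs \<inter> A) + b)" "even (card (hd xs \<inter> A) + a)"
    "S \<inter> last xs = {}" "S \<inter> hd xs = {}"
    using path_ends[OF xs(1)] xs by (auto simp: path_def role_size_def role_parity_def S_def verts_def)
  have large: "real n \<le> 4 * real (card (S \<inter> A))" "real n \<le> 4 * real (card (S - A))"
    using x2 y2 unfolding x_def y_def by linarith+
  have "2 * T \<le> n" using kT by linarith
  then obtain \<phi> where \<phi>: "\<phi> permutes S" "last xs \<union> \<phi> ` D 0 \<in> H" "\<phi> ` D (2 * T - 1) \<union> hd xs \<in> H"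
    "\<And>i. Suc i < 2 * T \<Longrightarrow> \<phi> ` D i \<union> \<phi> ` D (Suc i) \<in> H"
    using random_blocks[OF ab T(1) _ ty(2) ends(1,3) ty(1) ends(2,4) SV1 ends(5,6) large D(1,2) cD pD] by blast
  define zs where "zs = map (\<lambda>j. \<phi> ` D j) [0..<2 * T]"
  have inj: "inj_on \<phi> X" for X using permutes_inj[OF \<phi>(1)] inj_on_subset by blast
  have \<phi>S: "\<phi> ` D j \<subseteq> S" if "j < 2 * T" for j
    using DS(1)[OF that] permutes_image[OF \<phi>(1)] by blast
  have znth: "zs ! j = \<phi> ` D j" if "j < 2 * T" for j
    using that by (auto simp: zs_def)
  have zsne: "zs \<noteq> []" and lzs: "length zs = 2 * T" using T(1) by (auto simp: zs_def)
  have vz: "verts zs = S"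
  proof -
    have "verts zs = \<phi> ` (\<Union>j<2 * T. D j)"
      unfolding image_UN by (simp add: verts_def zs_def lessThan_atLeast0)
    then show ?thesis using D(2) permutes_image[OF \<phi>(1)] by simp
  qed
  show ?thesis
  proof (rule cycle_from_list[of "xs @ zs" t])
    have "shape True zs"
      unfolding shape_nth
    proof (intro allI impI)
      fix i assume "i < length zs"
      then have i: "i < 2 * T" by (simp add: lzs)
      show "zs ! i \<subseteq> V \<and> card (zs ! i) = role_size (True = even i)"
        using znth[OF i] \<phi>S[OF i] cD[OF i] card_image[OF inj] by (auto simp: S_def)
    qed
    then show "shape True (xs @ zs)" using sh xs(2) by (simp add: shape_append)
    show "length (xs @ zs) = 2 * t" using lx lzs T(2) by simp
    show "t > 0" using qt by simp
    have "sorted_wrt (\<lambda>X Y. X \<inter> Y = {}) zs"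
      unfolding sorted_wrt_iff_nth_less
    proof (intro allI impI)
      fix i j assume ij: "i < j" "j < length zs"
      then have "\<phi> ` D i \<inter> \<phi> ` D j = \<phi> ` (D i \<inter> D j)" using inj[of UNIV] by (simp add: image_Int)
      then show "zs ! i \<inter> zs ! j = {}"
        using ij znth[of i] znth[of j] lzs disjoint_family_onD[OF D(1), of i j] by simp
    qed
    moreover have "X \<inter> Y = {}" if "X \<in> set xs" "Y \<in> set zs" for X Y
    proof -
      have "X \<subseteq> verts xs" "Y \<subseteq> verts zs" using that by (auto simp: verts_def)
      then show ?thesis using vz by (auto simp: S_def)
    qed
    ultimately show "sorted_wrt (\<lambda>X Y. X \<inter> Y = {}) (xs @ zs)" using srt by (simp add: sorted_wrt_append)
    show "verts (xs @ zs) = V" using vV vz by (auto simp: verts_append S_def)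
    have "successively (\<lambda>X Y. X \<union> Y \<in> H) zs"
      unfolding successively_conv_nth using \<phi>(4) znth by (simp add: lzs)
    moreover have "hd zs = \<phi> ` D 0" using znth[of 0] T(1) zsne by (simp add: hd_conv_nth)
    ultimately show "successively (\<lambda>X Y. X \<union> Y \<in> H) (xs @ zs)"
      using suc \<phi>(2) by (simp add: successively_append_iff)
    have "last zs = \<phi> ` D (2 * T - 1)" using znth[of "2 * T - 1"] T(1) zsne by (simp add: last_conv_nth lzs)
    then show "last (xs @ zs) \<union> hd (xs @ zs) \<in> H" using \<phi>(3) zsne ne by simp
  qed
qed

text \<open>A cycle in which every \<open>L i \<union> R i\<close> is right needs
  \<open>card A\<close> and \<open>p * t\<close> to agree modulo 2. If they do, any typical block
  starts the path; if not, a segment with \<open>w = 1\<close> is included. The initial length is at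
  most 12 = 1 + 2 + 9.\<close>

lemma near_parity_hamilton:
  assumes n: "n = k * t" and small: "real (k * (20 + 5 * card (V - V1))) < g / 16 * real n"
    and wrong: "odd (card A + p * t) \<Longrightarrow> \<exists>a b xs. even (a + b + p) \<and> path a b False 1 xs \<and> length xs \<le> 9"
  shows "has_hamilton_cycle l m V H"
proof -
  let ?B = "V - V1"
  \<comment> \<open>A first block in the role of some \<open>L i\<close>, so that the final list
    begins as \<open>path_completes\<close> expects.\<close>
  have start: "\<exists>L. path a b True 0 [L] \<and> L \<inter> U = {} \<and> card L \<le> k"
    if U: "finite U" "real (card U) < g / 8 * real n" for a b U
  proof -
    define \<W> where "\<W> = {Y \<in> [V1]\<^bsup>l\<^esup>. even (card (Y \<inter> A) + a)}"
    have l: "0 < l" "l < k" using klm by auto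
    have "0 \<le> g * real n ^ l" using gpos by simp
    then have "g / 4 * real n ^ l \<le> real (card \<W>)"
      using typed_many[of l a] l by (simp add: \<W>_def)
    moreover have sub: "\<W> \<subseteq> [V1]\<^bsup>l\<^esup>" by (auto simp: \<W>_def)
    ultimately obtain L where L: "L \<in> \<W>" "typical L" "L \<inter> U = {}"
      using exists_typical[OF sub l U(1) _ U(2)] by blast
    have "card L = l" "even (card (L \<inter> A) + a)" using L(1) by (auto simp: \<W>_def nsets_def)
    then have "path a b True 0 [L]" using L(2) by (intro path_single) (auto simp: role_size_def role_parity_def)
    then show ?thesis using L(3) \<open>card L = l\<close> l by auto
  qed
  have gn: "g * real n > 0" using gpos npos by simp
  have "\<exists>a b w xs. even (a + b + p) \<and> path a b True w xs \<and> length xs \<le> 12 \<and> even (card A + p * t + w)"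
  proof (cases "even (card A + p * t)")
    case True
    obtain L where "path 0 p True 0 [L]" using start[of "{}" 0 p] gn by auto
    then show ?thesis using True by (intro exI[of _ 0] exI[of _ p] exI[of _ 0] exI[of _ "[L]"]) auto
  next
    case False
    then obtain a b zs where zs: "even (a + b + p)" "path a b False 1 zs" "length zs \<le> 9" using wrong by blast
    have "card (verts zs) \<le> k * 9" using path_verts(3)[OF zs(2)] zs(3) by (meson le_trans mult_le_mono2)
    then have cz: "real (card (verts zs)) \<le> 9 * real k" by simp
    have "9 * real k < g / 8 * real n" using nbig kpos by linarith
    then obtain L where L: "path a b True 0 [L]" "L \<inter> verts zs = {}" "card L \<le> k"
      using start[OF path_verts(2)[OF zs(2)]] cz by (meson le_less_trans)
    have vL: "verts [L] = L" by (simp add: verts_def)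
    have "card (verts [L] \<union> verts zs) + k \<le> 11 * k"
      using card_Un_le[of L "verts zs"] L(3) \<open>card (verts zs) \<le> k * 9\<close> vL by simp
    then have "real (card (verts [L] \<union> verts zs) + k) < g / 16 * real n" using nbig kpos by linarith
    then obtain cs where cs: "path a b True (0 + 1) ([L] @ cs @ zs)" "length cs \<le> 2"
      using connect[OF zs(1) L(1) zs(2)] L(2) vL by auto
    have "even (card A + p * t + (0 + 1))" using False by simp
    moreover have "length ([L] @ cs @ zs) \<le> 12" using cs(2) zs(3) by simp
    ultimately show ?thesis using zs(1) cs(1) by blast
  qed
  then obtain a b w xs where xs: "even (a + b + p)" "path a b True w xs" "length xs \<le> 12" "even (card A + p * t + w)"
    by blast
  have finB: "finite ?B" using finV by simp
  have "k * (length xs + 5 * card ?B) \<le> k * (20 + 5 * card ?B)" using xs(3) by (intro mult_le_mono2) simp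
  then have "real (k * (length xs + 5 * card ?B)) < g / 16 * real n" using small by linarith
  then obtain ys where ys: "path a b True w ys" "?B \<subseteq> verts ys" "length ys \<le> 12 + 5 * card ?B"
    using cover_bad[OF xs(1,2) finB order.refl] xs(3) by fastforce
  \<comment> \<open>The path must end with an \<open>R\<close>-block; one more block corrects an odd
    length.\<close>
  have "\<exists>ys. path a b True w ys \<and> ?B \<subseteq> verts ys \<and> length ys \<le> 20 + 5 * card ?B \<and> even (length ys)"
  proof (cases "even (length ys)")
    case False
    have "card (verts ys) \<le> k * (12 + 5 * card ?B)"
      using path_verts(3)[OF ys(1)] ys(3) by (meson le_trans mult_le_mono2)
    also have "\<dots> \<le> k * (20 + 5 * card ?B)" by simp
    finally have "real (card (verts ys \<union> {})) < g / 16 * real n" using small by (simp del: of_nat_mult of_nat_add)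
    from extend_by_one[OF xs(1) ys(1) _ this] obtain Y where "path a b True w (ys @ [Y])" by auto
    then show ?thesis
      using ys(2,3) False by (intro exI[of _ "ys @ [Y]"]) (auto simp: verts_append)
  qed (use ys in fastforce)
  then obtain ys where ys: "path a b True w ys" "?B \<subseteq> verts ys" "length ys \<le> 20 + 5 * card ?B" "even (length ys)"
    by blast
  have "card (verts ys) \<le> k * (20 + 5 * card ?B)"
    using path_verts(3)[OF ys(1)] ys(3) by (meson le_trans mult_le_mono2)
  then have "real (card (verts ys)) < g / 16 * real n" using small by linarith
  also have "g / 16 * real n \<le> 1 / 448 * real n"
  proof (rule mult_right_mono)
    have "(1 / (4 * real k)) ^ k \<le> (1 / (4 * real k)) ^ 1"
      using kpos by (intro power_decreasing) (auto simp: field_simps)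
    also have "\<dots> \<le> 1 / 28" using klm(4) by (simp add: field_simps)
    finally show "g / 16 \<le> 1 / 448" using gsmall by simp
  qed simp
  finally have "100 * card (verts ys) \<le> n" by linarith
  then show ?thesis by (intro path_completes[OF xs(1) ys(1,4,2) n _ xs(4)])
qed

end

section \<open>Degrees of parity graphs and the parity obstruction\<close>

text \<open>If no l-set has many wrong extensions, the codegree condition makes every l-set
  \<open>right_rich\<close>. On the other hand each of the at least \<open>g * n ^ l\<close> sets of
  the type of \<open>S0\<close> lies in a wrong edge, so there are more than
  \<open>C * n ^ (l - 1)\<close> wrong edges, and \<open>FF\<close> supplies two with a usable
  intersection.\<close>

lemma (in near_parity) wrong_segment:
  fixes C :: nat
  assumes FF: "\<And>F. F \<subseteq> [V]\<^bsup>k\<^esup> \<Longrightarrow> card F > C * n ^ (l - 1) \<Longrightarrow>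
      \<exists>e\<in>F. \<exists>f\<in>F. e \<noteq> f \<and> (card (e \<inter> f) = m \<or> (l = m \<and> e \<inter> f = {}))"
    and S0: "S0 \<in> [V]\<^bsup>l\<^esup>"
    and wrong: "\<And>S. S \<in> [V]\<^bsup>l\<^esup> \<Longrightarrow> card (S \<inter> A) = card (S0 \<inter> A) \<Longrightarrow> \<exists>e\<in>H. S \<subseteq> e \<and> \<not> right e"
    and big: "real C * 2 ^ k < g * real n"
  shows "\<exists>a b xs. even (a + b + p) \<and> path a b False 1 xs \<and> length xs \<le> 9"
proof (cases "\<exists>Z\<in>[V]\<^bsup>l\<^esup>. g * real n ^ m \<le> real (card {W \<in> [V1]\<^bsup>m\<^esup>. W \<inter> Z = {} \<and> Z \<union> W \<in> H \<and> \<not> right (Z \<union> W)})")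
  case True
  then show ?thesis using wrong_segment_extension by blast
next
  case False
  have many: "right_rich Z" if Z: "Z \<in> [V]\<^bsup>l\<^esup>" for Z
  proof -
    let ?Q = "{W \<in> [V1]\<^bsup>m\<^esup>. W \<inter> Z = {} \<and> Z \<union> W \<in> H}"
    let ?R = "{W \<in> [V1]\<^bsup>m\<^esup>. W \<inter> Z = {} \<and> Z \<union> W \<in> H \<and> right (Z \<union> W)}"
    let ?N = "{W \<in> [V1]\<^bsup>m\<^esup>. W \<inter> Z = {} \<and> Z \<union> W \<in> H \<and> \<not> right (Z \<union> W)}"
    have "card ?Q \<le> card (?R \<union> ?N)" using fin_nsets by (intro card_mono) auto
    also have "\<dots> \<le> card ?R + card ?N" by (rule card_Un_le)
    finally have "real (card ?Q) \<le> real (card ?R) + real (card ?N)" by linarith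
    moreover have "real (card ?N) < g * real n ^ m" using False Z by (auto simp: not_le)
    ultimately show ?thesis using codegree[OF Z] unfolding right_rich_def by linarith
  qed
  define s where "s = card (S0 \<inter> A)"
  define SS where "SS = {S \<in> [V]\<^bsup>l\<^esup>. card (S \<inter> A) = s}"
  \<comment> \<open>Only wrong edges above an l-set of the fixed type are kept, so that two disjoint
    ones contain l-sets of equal type, as \<open>wrong_segment_disjoint\<close> demands.\<close>
  define F where "F = {e \<in> H. \<not> right e \<and> (\<exists>S\<in>SS. S \<subseteq> e)}"
  have finF: "finite F" using finH by (simp add: F_def)
  have FV: "F \<subseteq> [V]\<^bsup>k\<^esup>" using HV by (auto simp: F_def)
  have sl: "s \<le> l"
  proof -
    have "finite S0" "card S0 = l" using S0 by (auto simp: nsets_def)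
    then show ?thesis using card_mono[of S0 "S0 \<inter> A"] by (simp add: s_def)
  qed
  have lower: "g * real n ^ l \<le> real (card SS)"
  proof -
    have "g * real n ^ l \<le> (1 / (3 * real k)) ^ l * real n ^ l"
    proof (intro mult_right_mono)
      have "(1 / (4 * real k)) ^ k \<le> (1 / (4 * real k)) ^ l"
        using klm kpos by (intro power_decreasing) (auto simp: field_simps)
      also have "\<dots> \<le> (1 / (3 * real k)) ^ l"
        using kpos by (intro power_mono) (auto simp: field_simps)
      finally show "g \<le> (1 / (3 * real k)) ^ l" using gsmall by linarith
    qed simp
    also have "\<dots> = (real n / 3 / real k) ^ l" by (simp add: power_divide power_mult_distrib)
    also have "\<dots> \<le> real (card {Y \<in> [V]\<^bsup>l\<^esup>. card (Y \<inter> A) = s})"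
    proof (rule card_typed_sets_ge[OF finV])
      have "card (V1 \<inter> A) \<le> card (V \<inter> A)" "card (V1 - A) \<le> card (V - A)"
        using finV V1V by (auto intro!: card_mono)
      then show "real n / 3 \<le> real (card (V \<inter> A))" "real n / 3 \<le> real (card (V - A))"
        using A1 B1 by linarith+
    qed (use n_ge_3k klm sl in auto)
    finally show ?thesis by (simp add: SS_def)
  qed
  have "SS \<subseteq> (\<Union>e\<in>F. Pow e)"
  proof
    fix S assume S: "S \<in> SS"
    then obtain e where "e \<in> H" "S \<subseteq> e" "\<not> right e" using wrong[of S] by (auto simp: SS_def s_def)
    then show "S \<in> (\<Union>e\<in>F. Pow e)" using S by (auto simp: F_def)
  qed
  then have "card SS \<le> card (\<Union>e\<in>F. Pow e)"
    using finF FV by (intro card_mono) (auto simp: nsets_def)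
  also have "\<dots> \<le> (\<Sum>e\<in>F. card (Pow e))" by (rule card_UN_le[OF finF])
  also have "\<dots> = (\<Sum>e\<in>F. 2 ^ k)" using FV by (intro sum.cong) (auto simp: nsets_def card_Pow)
  finally have "card SS \<le> card F * 2 ^ k" by simp
  then have "real (card SS) \<le> real (card F * 2 ^ k)" by (rule of_nat_mono)
  then have upper: "real (card SS) \<le> real (card F) * 2 ^ k" by simp
  have "real (C * n ^ (l - 1)) * 2 ^ k = (real C * 2 ^ k) * real n ^ (l - 1)" by simp
  also have "\<dots> < g * real n * real n ^ (l - 1)" using big npos by (intro mult_strict_right_mono) auto
  also have "\<dots> = g * real n ^ l" using klm by (simp only: mult.assoc power_split)
  finally have "real (C * n ^ (l - 1)) * 2 ^ k < real (card F) * 2 ^ k" using lower upper by linarith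
  then have "C * n ^ (l - 1) < card F" by (simp only: mult_less_cancel_right_pos zero_less_power zero_less_numeral of_nat_less_iff)
  then obtain e f where ef: "e \<in> F" "f \<in> F" "e \<noteq> f" "card (e \<inter> f) = m \<or> (l = m \<and> e \<inter> f = {})"
    using FF[OF FV] by blast
  have H: "e \<in> H" "f \<in> H" "\<not> right e" "\<not> right f" using ef by (auto simp: F_def)
  from ef(4) show ?thesis
  proof
    assume "card (e \<inter> f) = m"
    then show ?thesis using wrong_segment_common[OF many H] by blast
  next
    assume d: "l = m \<and> e \<inter> f = {}"
    obtain S S' where S: "S \<in> SS" "S \<subseteq> e" and S': "S' \<in> SS" "S' \<subseteq> f" using ef by (auto simp: F_def)
    have "card S = l" "card S' = l" "card (S \<inter> A) = card (S' \<inter> A)" using S S' by (auto simp: SS_def nsets_def)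
    then show ?thesis using wrong_segment_disjoint[OF many H, of S S'] S(2) S'(2) d by blast
  qed
qed

section \<open>Parity graphs and the extremal threshold\<close>

definition parity_graph :: "nat \<Rightarrow> nat \<Rightarrow> 'a set \<Rightarrow> 'a set \<Rightarrow> 'a set set" where
  "parity_graph p k V A = {e \<in> [V]\<^bsup>k\<^esup>. even (card (e \<inter> A) + p)}"

lemma odd_graph_parity: "A \<union> B = V \<Longrightarrow> odd_graph k A B = parity_graph 1 k V A"
  and even_graph_parity: "A \<union> B = V \<Longrightarrow> even_graph k A B = parity_graph 0 k V A"
  by (auto simp: odd_graph_def even_graph_def parity_graph_def)

lemma parity_graph_image:
  assumes f: "bij_betw f V V'" and A: "A \<subseteq> V"
  shows "(\<lambda>e. f ` e) ` parity_graph p k V A = parity_graph p k V' (f ` A)"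
proof -
  have inj: "inj_on f V" and im: "f ` V = V'" using f by (auto simp: bij_betw_def)
  have *: "f ` e \<in> parity_graph p k V' (f ` A) \<longleftrightarrow> e \<in> parity_graph p k V A" if e: "e \<subseteq> V" for e
  proof -
    have "inj_on f e" "inj_on f (e \<inter> A)" using inj e by (meson inj_on_subset le_infI1)+
    moreover have "f ` e \<inter> f ` A = f ` (e \<inter> A)" using inj_on_image_Int[OF inj e A] by simp
    ultimately show ?thesis
      using e im by (auto simp: parity_graph_def nsets_def card_image finite_image_iff)
  qed
  show ?thesis
  proof
    show "(\<lambda>e. f ` e) ` parity_graph p k V A \<subseteq> parity_graph p k V' (f ` A)"
    proof
      fix e' assume "e' \<in> (\<lambda>e. f ` e) ` parity_graph p k V A"
      then obtain e where "e \<in> parity_graph p k V A" "e' = f ` e" by blast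
      then show "e' \<in> parity_graph p k V' (f ` A)" using *[of e] by (auto simp: parity_graph_def nsets_def)
    qed
    show "parity_graph p k V' (f ` A) \<subseteq> (\<lambda>e. f ` e) ` parity_graph p k V A"
    proof
      fix e' assume e': "e' \<in> parity_graph p k V' (f ` A)"
      then have "e' \<subseteq> f ` V" using im by (auto simp: parity_graph_def nsets_def)
      then obtain e where "e \<subseteq> V" "e' = f ` e" by (auto simp: subset_image_iff)
      then show "e' \<in> (\<lambda>e. f ` e) ` parity_graph p k V A" using * e' by blast
    qed
  qed
qed

lemma parity_graph_deg_le:
  assumes f: "bij_betw f V V'" and A: "A \<subseteq> V" and V': "finite V'"
  shows "deg (parity_graph p k V A) S \<le> deg (parity_graph p k V' (f ` A)) (f ` S)"
  unfolding deg_def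
proof (rule card_inj_on_le[where f = "\<lambda>e. f ` e"])
  have inj: "inj_on f V" using f by (auto simp: bij_betw_def)
  show "inj_on ((`) f) {e \<in> parity_graph p k V A. S \<subseteq> e}"
    by (rule inj_onI) (use inj_on_image_eq_iff[OF inj] in \<open>auto simp: parity_graph_def nsets_def\<close>)
  show "(`) f ` {e \<in> parity_graph p k V A. S \<subseteq> e} \<subseteq> {e \<in> parity_graph p k V' (f ` A). f ` S \<subseteq> e}"
    using parity_graph_image[OF f A, of p k] by auto
  show "finite {e \<in> parity_graph p k V' (f ` A). f ` S \<subseteq> e}"
    using finite_imp_finite_nsets[OF V', of k] by (simp add: parity_graph_def)
qed

lemma finite_nsets_nonempty:
  assumes "finite V" "l \<le> card V"
  shows "finite ([V]\<^bsup>l\<^esup>)" "[V]\<^bsup>l\<^esup> \<noteq> {}"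
proof -
  show "finite ([V]\<^bsup>l\<^esup>)" using assms by (simp add: finite_imp_finite_nsets)
  obtain S where "S \<subseteq> V" "card S = l" "finite S" using obtain_subset_with_card_n[OF assms(2)] assms(1) finite_subset by metis
  then show "[V]\<^bsup>l\<^esup> \<noteq> {}" by (auto simp: nsets_def)
qed

lemma min_degree_le: "finite V \<Longrightarrow> S \<in> [V]\<^bsup>l\<^esup> \<Longrightarrow> min_degree l V G \<le> deg G S"
  unfolding min_degree_def by (intro Min_le) (auto simp: finite_imp_finite_nsets)

lemma min_degree_attained:
  assumes "finite V" "l \<le> card V"
  obtains S where "S \<in> [V]\<^bsup>l\<^esup>" "deg G S = min_degree l V G"
proof -
  have "Min (deg G ` [V]\<^bsup>l\<^esup>) \<in> deg G ` [V]\<^bsup>l\<^esup>" using finite_nsets_nonempty[OF assms] by (intro Min_in) auto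
  then show ?thesis using that by (auto simp: min_degree_def)
qed

text \<open>The oddness assumption is the membership condition of \<open>H_ext\<close> for
  \<open>p = 0\<close> and \<open>p = 1\<close> at once, when \<open>k\<close> divides
  \<open>n\<close>. A bijection carries the graph from \<open>V\<close> to the vertex set on which
  \<open>ext_threshold\<close> is defined.\<close>

lemma ext_threshold_ge:
  fixes V A :: "'a set"
  assumes V: "finite V" "card V = n" "l \<le> n" and A: "A \<subseteq> V" and p: "p \<le> 1" "odd (card A + p * (n div k))"
  shows "min_degree l V (parity_graph p k V A) \<le> ext_threshold n k l"
proof -
  obtain f where f: "bij_betw f V {..<n}" using V by (metis card_lessThan finite_lessThan finite_same_card_bij)
  define A' where "A' = f ` A"
  define B' where "B' = {..<n} - A'"
  have A': "A' \<subseteq> {..<n}" using f A by (auto simp: A'_def bij_betw_def)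
  have cA: "card A' = card A"
    unfolding A'_def using f A by (meson bij_betw_imp_inj_on card_image inj_on_subset)
  have AB: "A' \<union> B' = {..<n}" "bipartition {..<n} A' B'" using A' by (auto simp: B'_def bipartition_def)
  have "p = 0 \<or> p = 1" using p by auto
  then have mem: "parity_graph p k {..<n} A' \<in> H_ext {..<n} k"
  proof
    assume "p = 0"
    then have "parity_graph p k {..<n} A' = even_graph k A' B'" "odd (card A')"
      using even_graph_parity[OF AB(1)] p(2) cA by auto
    then show ?thesis using AB(2) unfolding H_ext_def by blast
  next
    assume "p = 1"
    then have "parity_graph p k {..<n} A' = odd_graph k A' B'" "odd (int (card {..<n} div k) - int (card A'))"
      using odd_graph_parity[OF AB(1)] p(2) cA by auto
    then show ?thesis using AB(2) unfolding H_ext_def by blast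
  qed
  have "H_ext {..<n} k \<subseteq> Pow (Pow {..<n})"
    by (auto simp: H_ext_def odd_graph_def even_graph_def bipartition_def nsets_def)
  then have "finite (H_ext {..<n} k)" by (rule finite_subset) simp
  then have le: "min_degree l {..<n} (parity_graph p k {..<n} A') \<le> ext_threshold n k l"
    unfolding ext_threshold_def using mem by (intro Max_ge) auto
  obtain S' where S': "S' \<in> [{..<n}]\<^bsup>l\<^esup>" "deg (parity_graph p k {..<n} A') S' = min_degree l {..<n} (parity_graph p k {..<n} A')"
    using min_degree_attained[of "{..<n}" l] V(3) by auto
  have "S' \<subseteq> f ` V" using S'(1) f by (auto simp: nsets_def bij_betw_def)
  then obtain S where S: "S \<subseteq> V" "S' = f ` S" by (auto simp: subset_image_iff)
  have "card S = l" using S S'(1) f by (metis (mono_tags, lifting) bij_betw_imp_inj_on card_image inj_on_subset mem_Collect_eq nsets_def)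
  then have "S \<in> [V]\<^bsup>l\<^esup>" using S(1) V(1) finite_subset by (auto simp: nsets_def)
  then have "min_degree l V (parity_graph p k V A) \<le> deg (parity_graph p k V A) S" by (rule min_degree_le[OF V(1)])
  also have "\<dots> \<le> deg (parity_graph p k {..<n} A') S'"
    unfolding S(2) A'_def by (rule parity_graph_deg_le[OF f A]) simp
  finally show ?thesis using S'(2) le by simp
qed

text \<open>A permutation that exchanges \<open>S\<close> for \<open>S'\<close> and preserves
  \<open>A\<close> is an automorphism of the parity graph. Hence a minimum degree attained at one
  set is attained at all sets of its type.\<close>

lemma deg_type_le:
  assumes V: "finite V" and A: "A \<subseteq> V" and S: "S \<subseteq> V" "S' \<subseteq> V" "card S = card S'" "card (S \<inter> A) = card (S' \<inter> A)"
  shows "deg (parity_graph p k V A) S \<le> deg (parity_graph p k V A) S'"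
proof -
  have f: "finite S" "finite S'" using S V finite_subset by blast+
  have "card S = card (S \<inter> A) + card (S - A)" "card S' = card (S' \<inter> A) + card (S' - A)"
    by (rule card_Int_Diff, rule f)+
  then have "card (S' - A) = card (S - A)" using S by linarith
  then obtain \<tau> where \<tau>: "\<tau> permutes V" "\<And>v. \<tau> v \<in> A \<longleftrightarrow> v \<in> A" "\<tau> ` S = S'"
    using type_preserving_exchange[OF S(1) V S(2)] S(4) by metis
  have "\<tau> ` A = A"
  proof
    show "\<tau> ` A \<subseteq> A" using \<tau>(2) by blast
    show "A \<subseteq> \<tau> ` A"
    proof
      fix v assume v: "v \<in> A"
      then have "v \<in> \<tau> ` V" using A permutes_image[OF \<tau>(1)] by blast
      then show "v \<in> \<tau> ` A" using \<tau>(2) v by blast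
    qed
  qed
  then show ?thesis
    using parity_graph_deg_le[OF permutes_imp_bij[OF \<tau>(1)] A V, of p k S] \<tau>(3) by simp
qed

lemma extensions_eq_deg:
  assumes V: "finite V" and H: "H \<subseteq> [V]\<^bsup>k\<^esup>" and k: "k = l + m" and Z: "Z \<in> [V]\<^bsup>l\<^esup>"
  shows "card {W \<in> [V]\<^bsup>m\<^esup>. W \<inter> Z = {} \<and> Z \<union> W \<in> H} = deg H Z"
  unfolding deg_def
proof (rule bij_betw_same_card[of "\<lambda>W. Z \<union> W"])
  have Zf: "finite Z" "card Z = l" "Z \<subseteq> V" using Z by (auto simp: nsets_def)
  show "bij_betw (\<lambda>W. Z \<union> W) {W \<in> [V]\<^bsup>m\<^esup>. W \<inter> Z = {} \<and> Z \<union> W \<in> H} {e \<in> H. Z \<subseteq> e}"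
  proof (rule bij_betw_byWitness[where f' = "\<lambda>e. e - Z"])
    show "(\<lambda>e. e - Z) ` {e \<in> H. Z \<subseteq> e} \<subseteq> {W \<in> [V]\<^bsup>m\<^esup>. W \<inter> Z = {} \<and> Z \<union> W \<in> H}"
    proof clarify
      fix e assume e: "e \<in> H" "Z \<subseteq> e"
      then have "e \<subseteq> V" "finite e" "card e = k" using H by (auto simp: nsets_def)
      then have "e - Z \<in> [V]\<^bsup>m\<^esup>" using e Zf k by (auto simp: nsets_def card_Diff_subset)
      moreover have "Z \<union> (e - Z) = e" using e by blast
      ultimately show "e - Z \<in> [V]\<^bsup>m\<^esup> \<and> (e - Z) \<inter> Z = {} \<and> Z \<union> (e - Z) \<in> H" using e by auto
    qed
  qed auto
qed

lemma parity_graph_degree_ge: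
  assumes V: "finite V" and k: "k = l + m" "m > 0" and x: "real k \<le> x"
    and A: "x + real l \<le> real (card A)" "x + real l \<le> real (card (V - A))" "A \<subseteq> V"
  shows "(x / real k) ^ m \<le> real (min_degree l V (parity_graph p k V A))"
proof -
  have fA: "finite A" using A(3) V finite_subset by blast
  have "real l \<le> real (card V)" using card_mono[OF V A(3)] A(1) x by linarith
  then have "l \<le> card V" by simp
  then obtain S where S: "S \<in> [V]\<^bsup>l\<^esup>" "deg (parity_graph p k V A) S = min_degree l V (parity_graph p k V A)"
    by (rule min_degree_attained[OF V])
  have Sf: "finite S" "card S = l" "S \<subseteq> V" using S(1) by (auto simp: nsets_def)
  have "card A - card S \<le> card (A - S)" "card (V - A) - card S \<le> card (V - A - S)"
    using Sf by (auto intro: diff_card_le_card_Diff)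
  then have "card A \<le> card (A - S) + l" "card (V - A) \<le> card (V - A - S) + l"
    unfolding le_diff_conv Sf(2) by simp_all
  moreover have "(V - S) \<inter> A = A - S" "(V - S) - A = V - A - S" using A(3) by auto
  ultimately have "card A \<le> card ((V - S) \<inter> A) + l" "card (V - A) \<le> card ((V - S) - A) + l" by simp_all
  then have big: "x \<le> real (card ((V - S) \<inter> A))" "x \<le> real (card ((V - S) - A))"
    using A(1,2) by linarith+
  have "(x / real k) ^ m \<le> real (card {Y \<in> [V - S]\<^bsup>m\<^esup>. even (card (Y \<inter> A) + (card (S \<inter> A) + p))})"
    using V big x k by (intro parity_sets_many) auto
  also have "\<dots> \<le> real (card {W \<in> [V]\<^bsup>m\<^esup>. W \<inter> S = {} \<and> S \<union> W \<in> parity_graph p k V A})"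
  proof (intro of_nat_mono card_mono subsetI)
    show "finite {W \<in> [V]\<^bsup>m\<^esup>. W \<inter> S = {} \<and> S \<union> W \<in> parity_graph p k V A}"
      using finite_imp_finite_nsets[OF V] by simp
    fix Y assume Y: "Y \<in> {Y \<in> [V - S]\<^bsup>m\<^esup>. even (card (Y \<inter> A) + (card (S \<inter> A) + p))}"
    then have Yf: "finite Y" "card Y = m" "Y \<subseteq> V" "Y \<inter> S = {}" by (auto simp: nsets_def)
    have "card ((S \<union> Y) \<inter> A) = card (S \<inter> A) + card (Y \<inter> A)"
      using Sf Yf by (intro card_Un_inter) auto
    then have "S \<union> Y \<in> parity_graph p k V A"
      using Y Yf Sf k by (auto simp: parity_graph_def nsets_def card_Un_disjoint Int_commute)
    then show "Y \<in> {W \<in> [V]\<^bsup>m\<^esup>. W \<inter> S = {} \<and> S \<union> W \<in> parity_graph p k V A}"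
      using Yf by (auto simp: nsets_def)
  qed
  also have "card {W \<in> [V]\<^bsup>m\<^esup>. W \<inter> S = {} \<and> S \<union> W \<in> parity_graph p k V A} = deg (parity_graph p k V A) S"
    by (rule extensions_eq_deg[OF V _ k(1) S(1)]) (auto simp: parity_graph_def)
  finally show ?thesis using S(2) by simp
qed

text \<open>A nearly balanced partition of the obstructing parity already gives an extremal graph of
  positive relative degree; thus the degree hypothesis implies a codegree of order n^m.\<close>

lemma ext_threshold_lower:
  assumes V: "finite (V :: 'a set)" "card V = n" and k: "k = l + m" "m > 0" and n: "16 * k \<le> n"
  shows "(1 / (4 * real k)) ^ m * real n ^ m \<le> real (ext_threshold n k l)"
proof -
  define t where "t = n div k"
  \<comment> \<open>One of the consecutive numbers \<open>n div 2\<close> and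
    \<open>n div 2 + 1\<close> has the required parity, and both leave about n/2 vertices in each
    class.\<close>
  have "\<exists>a. n \<le> 2 * a + 1 \<and> 2 * a \<le> n + 2 \<and> odd (a + t)"
    by (cases "odd (n div 2 + t)") (intro exI[of _ "n div 2"], presburger, intro exI[of _ "n div 2 + 1"], presburger)
  then obtain a where a: "n \<le> 2 * a + 1" "2 * a \<le> n + 2" "odd (a + t)" by blast
  have "a \<le> card V" using a V n k by linarith
  then obtain A where A: "A \<subseteq> V" "card A = a" using obtain_subset_with_card_n by metis
  have cB: "card (V - A) = n - a" using A V finite_subset by (metis card_Diff_subset)
  have "(1 / (4 * real k)) ^ m * real n ^ m = (real n / 4 / real k) ^ m"
    by (simp add: power_divide power_mult_distrib)
  also have "\<dots> \<le> real (min_degree l V (parity_graph 1 k V A))"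
  proof (rule parity_graph_degree_ge[OF V(1) k])
    have n': "16 * real k \<le> real n" using n by (metis of_nat_le_iff of_nat_mult of_nat_numeral)
    show "real k \<le> real n / 4" using n' by simp
    have lk: "real l \<le> real k" "1 \<le> real k" using k by auto
    have "real n \<le> 2 * real a + 1" "2 * real a \<le> real n + 2" using a by linarith+
    moreover have "real (n - a) = real n - real a" using \<open>a \<le> card V\<close> V(2) by simp
    ultimately show "real n / 4 + real l \<le> real (card A)" "real n / 4 + real l \<le> real (card (V - A))"
      using n' lk A(2) cB by linarith+
  qed (rule A)
  also have "\<dots> \<le> real (ext_threshold n k l)"
  proof (intro of_nat_mono ext_threshold_ge[OF V])
    show "l \<le> n" using n k by linarith
    show "odd (card A + 1 * (n div k))" using a(3) A(2) by (simp add: t_def)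
  qed (use A in auto)
  finally show ?thesis .
qed

section \<open>Reduction of the theorem to the locale\<close>

text \<open>The vertex \<open>v\<close> is joined with an \<open>(l - 1)\<close>-set having exactly
  one vertex in \<open>A\<close>, which meets both classes because l \<ge> 3, and then the codegree
  supplies the other \<open>m\<close> vertices. A given \<open>X\<close> arises from at most
  \<open>2 ^ (k - 1)\<close> choices of that set.\<close>

lemma mixed_links_many:
  fixes V :: "'a set"
  assumes V: "finite V" "card V = n" and V1: "V1 \<subseteq> V" and v: "v \<in> V - V1" and k: "k = l + m" "3 \<le> l"
    and n: "3 * k \<le> n" "real n \<le> 3 * real (card (V1 \<inter> A))" "real n \<le> 3 * real (card (V1 - A))"
    and codeg: "\<And>Z. Z \<in> [V]\<^bsup>l\<^esup> \<Longrightarrow> d \<le> real (card {W \<in> [V1]\<^bsup>m\<^esup>. W \<inter> Z = {} \<and> Z \<union> W \<in> H})"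
    and d: "0 \<le> d"
  shows "(real n / 3 / real k) ^ (l - 1) * d \<le>
    real (card {X \<in> [V1]\<^bsup>(k - 1)\<^esup>. insert v X \<in> H \<and> X \<inter> A \<noteq> {} \<and> X - A \<noteq> {}}) * 2 ^ (k - 1)"
proof -
  define X where "X = {X \<in> [V1]\<^bsup>(k - 1)\<^esup>. insert v X \<in> H \<and> X \<inter> A \<noteq> {} \<and> X - A \<noteq> {}}"
  define SS where "SS = {S \<in> [V1]\<^bsup>(l - 1)\<^esup>. card (S \<inter> A) = 1}"
  define WW where "WW S = {W \<in> [V1]\<^bsup>m\<^esup>. W \<inter> insert v S = {} \<and> insert v S \<union> W \<in> H}" for S
  have finV1: "finite V1" using V V1 finite_subset by blast
  note fin = finite_imp_finite_nsets[OF finV1]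
  have finX: "finite X" "finite SS" "finite (WW S)" for S using fin by (auto simp: X_def SS_def WW_def)
  have "3 * real k \<le> real n" using n(1) by (metis of_nat_le_iff of_nat_mult of_nat_numeral)
  then have "(real n / 3 / real k) ^ (l - 1) \<le> real (card SS)"
    unfolding SS_def using n k by (intro card_typed_sets_ge finV1) auto
  then have "(real n / 3 / real k) ^ (l - 1) * d \<le> real (card SS) * d" using d by (rule mult_right_mono)
  also have "\<dots> = (\<Sum>S\<in>SS. d)" by simp
  also have "\<dots> \<le> (\<Sum>S\<in>SS. real (card (WW S)))"
  proof (rule sum_mono)
    fix S assume "S \<in> SS"
    then have "insert v S \<in> [V]\<^bsup>l\<^esup>" using v V1 k(2) by (auto simp: SS_def nsets_def card_insert_if)
    then show "d \<le> real (card (WW S))" unfolding WW_def by (rule codeg)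
  qed
  also have "\<dots> = real (card (Sigma SS WW))" using finX by (simp add: card_SigmaI)
  also have "card (Sigma SS WW) \<le> card (Sigma X Pow)"
  proof (rule card_inj_on_le)
    show "inj_on (\<lambda>(S, W). (S \<union> W, S)) (Sigma SS WW)"
      by (rule inj_on_inverseI[where g = "\<lambda>(X, S). (S, X - S)"]) (auto simp: WW_def)
    show "finite (Sigma X Pow)" using finX by (intro finite_SigmaI) (auto simp: X_def nsets_def)
    show "(\<lambda>(S, W). (S \<union> W, S)) ` Sigma SS WW \<subseteq> Sigma X Pow"
    proof clarify
      fix S W assume S: "S \<in> SS" and W: "W \<in> WW S"
      have f: "finite S" "finite W" "card S = l - 1" "card W = m" "S \<inter> W = {}" "S \<subseteq> V1" "W \<subseteq> V1" "card (S \<inter> A) = 1"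
        using S W by (auto simp: SS_def WW_def nsets_def)
      have "S \<union> W \<in> [V1]\<^bsup>(k - 1)\<^esup>" using f k by (simp add: nsets_def card_Un_disjoint)
      moreover have "S \<inter> A \<noteq> {}" using f(8) by auto
      moreover have "S - A \<noteq> {}"
      proof
        assume "S - A = {}"
        then have "S \<inter> A = S" by blast
        then show False using f(3,8) k(2) by simp
      qed
      moreover have "insert v (S \<union> W) \<in> H" using W by (simp add: WW_def)
      ultimately show "S \<union> W \<in> X \<and> S \<in> Pow (S \<union> W)" by (auto simp: X_def)
    qed
  qed
  also have "card (Sigma X Pow) = (\<Sum>e\<in>X. 2 ^ (k - 1))"
    using finX by (subst card_SigmaI) (auto simp: X_def nsets_def card_Pow)
  finally show ?thesis by (simp add: X_def)
qed

text \<open>The degrees in \<open>D\<close> sum to \<open>k * card D\<close>, so only few vertices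
  can have a large one.\<close>

lemma few_bad_vertices:
  assumes V: "finite V" "card V = n" "n > 0" and D: "D \<subseteq> [V]\<^bsup>k\<^esup>" "k > 0"
    and \<delta>: "\<delta> > 0" and small: "real k * real (card D) \<le> \<nu> * \<delta> * real n ^ k"
  shows "real (card {v \<in> V. \<delta> * real n ^ (k - 1) < real (card {e \<in> D. v \<in> e})}) \<le> \<nu> * real n"
proof -
  define V0 where "V0 = {v \<in> V. \<delta> * real n ^ (k - 1) < real (card {e \<in> D. v \<in> e})}"
  have finD: "finite D" using D V finite_imp_finite_nsets finite_subset by metis
  have "real (card V0) * (\<delta> * real n ^ (k - 1)) = (\<Sum>v\<in>V0. \<delta> * real n ^ (k - 1))" by simp
  also have "\<dots> \<le> (\<Sum>v\<in>V0. real (card {e \<in> D. v \<in> e}))" by (intro sum_mono) (auto simp: V0_def)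
  also have "\<dots> \<le> (\<Sum>v\<in>V. real (card {e \<in> D. v \<in> e}))" using V by (intro sum_mono2) (auto simp: V0_def)
  also have "\<dots> = real (\<Sum>v\<in>V. \<Sum>e | e \<in> D \<and> v \<in> e. 1)" by simp
  also have "(\<Sum>v\<in>V. \<Sum>e | e \<in> D \<and> v \<in> e. 1) = (\<Sum>e\<in>D. \<Sum>v | v \<in> V \<and> v \<in> e. (1::nat))"
    by (rule sum.swap_restrict[OF V(1) finD])
  also have "\<dots> = (\<Sum>e\<in>D. k)"
  proof (rule sum.cong[OF refl])
    fix e assume "e \<in> D"
    then have "{v \<in> V. v \<in> e} = e" "card e = k" using D by (auto simp: nsets_def)
    then show "(\<Sum>v | v \<in> V \<and> v \<in> e. (1::nat)) = k" by simp
  qed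
  also have "real \<dots> = real k * real (card D)" by simp
  also have "\<dots> \<le> \<nu> * \<delta> * real n ^ k" by (rule small)
  also have "\<dots> = (\<nu> * real n) * (\<delta> * real n ^ (k - 1))"
    by (simp add: power_split[OF D(2), symmetric])
  finally have "real (card V0) * (\<delta> * real n ^ (k - 1)) \<le> (\<nu> * real n) * (\<delta> * real n ^ (k - 1))" .
  moreover have "\<delta> * real n ^ (k - 1) > 0" using \<delta> V(3) by simp
  ultimately show ?thesis unfolding V0_def by (meson mult_le_cancel_right_pos)
qed

lemma close_to_parity_graph:
  assumes k: "k = l + m" "m \<le> l" "m > 0" "k \<ge> 7"
  shows "\<exists>\<epsilon>>0. \<exists>n0. \<forall>(V :: 'a set) H A0 p. kgraph k V H \<and> n0 \<le> card V \<and> k dvd card V \<and> A0 \<subseteq> V \<and> p \<le> 1 \<and>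
    card V \<le> 2 * card A0 + 1 \<and> 2 * card A0 \<le> card V + 1 \<and>
    real (card (sym_diff (parity_graph p k V A0) H)) \<le> \<epsilon> * real (card V) ^ k \<and>
    ext_threshold (card V) k l < min_degree l V H \<longrightarrow> has_hamilton_cycle l m V H"
proof -
  obtain C where C: "\<And>(V :: 'a set) F. finite V \<Longrightarrow> F \<subseteq> [V]\<^bsup>k\<^esup> \<Longrightarrow> card F > C * card V ^ (l - 1) \<Longrightarrow>
      \<exists>e\<in>F. \<exists>f\<in>F. e \<noteq> f \<and> (card (e \<inter> f) = m \<or> (l = m \<and> e \<inter> f = {}))"
    using forbidden_intersection[OF k(1-3)] by metis
  define c where "c = (1 / (4 * real k)) ^ k"
  \<comment> \<open>By \<open>mixed_links_many\<close> an exceptional vertex lies in mixed edges of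
    density c * c / 2 divided by 2^(k-1), which is 8 * g. Half of them survive the choice of its
    class, and the locale asks for 2 * g.\<close>
  define g where "g = c * c / 2 ^ (k + 3)"
  define \<eta> where "\<eta> = g / 36"
  define \<delta> where "\<delta> = g * \<eta> / (8 * 2 ^ k)"
  \<comment> \<open>Covering \<nu> n exceptional vertices by five blocks each takes at most g n / 40
    vertices, within the budget g n / 16 of \<open>near_parity_hamilton\<close>.\<close>
  define \<nu> where "\<nu> = g / (200 * real k)"
  define \<epsilon> where "\<epsilon> = \<nu> * \<delta> / real k"
  define n0 where "n0 = nat \<lceil>1000 * real k / g\<rceil> + nat \<lceil>real C * 2 ^ k / g\<rceil> + 1"
  have kpos: "real k > 0" using k by simp
  have cpos: "c > 0" using kpos by (simp add: c_def)
  have c1: "c \<le> 1 / 28"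
  proof -
    have "c \<le> (1 / (4 * real k)) ^ 1" unfolding c_def using k by (intro power_decreasing) (auto simp: field_simps)
    also have "\<dots> \<le> 1 / 28" using k(4) by (simp add: field_simps)
    finally show ?thesis .
  qed
  have cpow: "c \<le> (1 / (4 * real k)) ^ j" if "j \<le> k" for j
    unfolding c_def using that k by (intro power_decreasing) (auto simp: field_simps)
  have gpos: "g > 0" using cpos by (simp add: g_def)
  have gc: "8 * g \<le> c"
  proof -
    have "(8::real) \<le> 2 ^ (k + 3)" by (simp add: power_add)
    then have "8 * g \<le> 2 ^ (k + 3) * g" using gpos by (intro mult_right_mono) auto
    also have "\<dots> = c * c" by (simp add: g_def)
    also have "\<dots> \<le> c * 1" using cpos c1 by (intro mult_left_mono) auto
    finally show ?thesis by simp
  qed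
  have pos: "\<eta> > 0" "\<delta> > 0" "\<nu> > 0" "\<epsilon> > 0" using gpos kpos by (simp_all add: \<eta>_def \<delta>_def \<nu>_def \<epsilon>_def)
  have \<nu>g: "\<nu> \<le> g / 1400"
    unfolding \<nu>_def using gpos k(4) by (intro divide_left_mono) auto
  have "has_hamilton_cycle l m V H"
    if K: "kgraph k V H" and n0: "n0 \<le> card V" and dvd: "k dvd card V" and A0: "A0 \<subseteq> V" and p: "p \<le> 1"
      and bal: "card V \<le> 2 * card A0 + 1" "2 * card A0 \<le> card V + 1"
      and close: "real (card (sym_diff (parity_graph p k V A0) H)) \<le> \<epsilon> * real (card V) ^ k"
      and deg: "ext_threshold (card V) k l < min_degree l V H" for V :: "'a set" and H A0 p
  proof -
    let ?n = "card V"
    have finV: "finite V" and HV: "H \<subseteq> [V]\<^bsup>k\<^esup>" using K by (auto simp: kgraph_def)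
    have nb: "1000 * real k \<le> g * real ?n" and Cb: "real C * 2 ^ k < g * real ?n"
    proof -
      have "1000 * real k / g \<le> real n0" "real C * 2 ^ k / g < real n0"
        unfolding n0_def by linarith+
      then have "1000 * real k / g \<le> real ?n" "real C * 2 ^ k / g < real ?n" using n0 by linarith+
      then show "1000 * real k \<le> g * real ?n" "real C * 2 ^ k < g * real ?n"
        using gpos by (simp_all add: field_simps)
    qed
    have g1: "g \<le> 1" using gc c1 cpos by linarith
    have nk: "1000 * real k \<le> real ?n"
      using nb mult_right_mono[OF g1, of "real ?n"] by linarith
    have npos: "?n > 0" using nk kpos by linarith
    define D where "D = sym_diff (parity_graph p k V A0) H"
    have DV: "D \<subseteq> [V]\<^bsup>k\<^esup>" using HV by (auto simp: D_def parity_graph_def)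
    have finD: "finite D" using DV finite_imp_finite_nsets[OF finV] finite_subset by metis
    define V0 where "V0 = {v \<in> V. \<delta> * real ?n ^ (k - 1) < real (card {e \<in> D. v \<in> e})}"
    define V1 where "V1 = V - V0"
    have V1V: "V1 \<subseteq> V" and VV: "V - V1 = V0" by (auto simp: V1_def V0_def)
    have finV1: "finite V1" and finV0: "finite V0" using finV by (auto simp: V1_def V0_def)
    have "real k * real (card D) \<le> \<nu> * \<delta> * real ?n ^ k"
      using close kpos unfolding D_def[symmetric] \<epsilon>_def by (simp add: field_simps)
    then have cV0: "real (card V0) \<le> \<nu> * real ?n"
      unfolding V0_def using k by (intro few_bad_vertices finV DV npos pos) auto
    have \<nu>n: "\<nu> * real ?n \<le> 1 / 100 * real ?n"
      using \<nu>g g1 by (intro mult_right_mono) auto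
    define XX where "XX v = {X \<in> [V1]\<^bsup>(k - 1)\<^esup>. insert v X \<in> H \<and> X \<inter> A0 \<noteq> {} \<and> X - A0 \<noteq> {}}" for v
    define XE where "XE v j = {X \<in> XX v. even (card (X \<inter> A0) + j)}" for v j
    \<comment> \<open>A majority vote: \<open>XE v (1 + p)\<close> contains the links that give
      right edges if \<open>v\<close> is put into \<open>A\<close>, \<open>XE v p\<close> those if
      it is not. Links lie in \<open>V1\<close>, where \<open>A\<close> agrees with
      \<open>A0\<close>, so the votes of different vertices do not interfere.\<close>
    define A where "A = (A0 \<inter> V1) \<union> {v \<in> V0. card (XX v) \<le> 2 * card (XE v (1 + p))}"
    have AV: "A \<subseteq> V" using A0 by (auto simp: A_def V0_def)
    have A_V1: "X \<inter> A = X \<inter> A0" "X - A = X - A0" if "X \<subseteq> V1" for X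
      using that by (auto simp: A_def V1_def)
    have cA: "real ?n \<le> 3 * real (card (V1 \<inter> A0))" "real ?n \<le> 3 * real (card (V1 - A0))"
    proof -
      have "card A0 \<le> card ((V1 \<inter> A0) \<union> V0)" "card (V - A0) \<le> card ((V1 - A0) \<union> V0)"
        using finV1 finV0 A0 by (auto intro!: card_mono simp: V1_def)
      then have "card A0 \<le> card (V1 \<inter> A0) + card V0" "card (V - A0) \<le> card (V1 - A0) + card V0"
        using card_Un_le[of "V1 \<inter> A0" V0] card_Un_le[of "V1 - A0" V0] by linarith+
      moreover have "card (V - A0) + card A0 = ?n"
        using card_Diff_subset[OF finite_subset[OF A0 finV] A0] card_mono[OF finV A0] by simp
      ultimately show "real ?n \<le> 3 * real (card (V1 \<inter> A0))" "real ?n \<le> 3 * real (card (V1 - A0))"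
        using bal cV0 \<nu>n nk k(4) by linarith+
    qed
    have ext: "c * real ?n ^ m \<le> real (ext_threshold ?n k l)"
    proof -
      have "c * real ?n ^ m \<le> (1 / (4 * real k)) ^ m * real ?n ^ m"
        using k by (intro mult_right_mono cpow) auto
      also have "\<dots> \<le> real (ext_threshold ?n k l)"
      proof (rule ext_threshold_lower[OF finV refl k(1,3)])
        have "16 * real k \<le> real ?n" using nk kpos by linarith
        then show "16 * k \<le> ?n" by (metis of_nat_le_iff of_nat_mult of_nat_numeral)
      qed
      finally show ?thesis .
    qed
    \<comment> \<open>The minimum degree exceeds the threshold, of order at least c n^m, and the
      sets meeting \<open>V0\<close> cost at most \<nu> n^m of it.\<close>
    have codeg: "c / 2 * real ?n ^ m \<le> real (card {W \<in> [V1]\<^bsup>m\<^esup>. W \<inter> Z = {} \<and> Z \<union> W \<in> H})"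
      if Z: "Z \<in> [V]\<^bsup>l\<^esup>" for Z
    proof -
      let ?Q = "{W \<in> [V]\<^bsup>m\<^esup>. W \<inter> Z = {} \<and> Z \<union> W \<in> H}"
      let ?P = "{W \<in> [V1]\<^bsup>m\<^esup>. W \<inter> Z = {} \<and> Z \<union> W \<in> H}"
      let ?M = "{W \<in> [V]\<^bsup>m\<^esup>. W \<inter> V0 \<noteq> {}}"
      have "?Q \<subseteq> ?P \<union> ?M" by (auto simp: nsets_def V1_def)
      then have "card ?Q \<le> card (?P \<union> ?M)"
        using finite_imp_finite_nsets[OF finV] finite_imp_finite_nsets[OF finV1] by (intro card_mono) auto
      also have "\<dots> \<le> card ?P + card ?M" by (rule card_Un_le)
      also have "card ?M \<le> card V0 * ?n ^ (m - 1)" by (rule card_meeting_le[OF finV k(3) finV0])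
      finally have "card ?Q \<le> card ?P + card V0 * ?n ^ (m - 1)" by simp
      then have "real (card ?Q) \<le> real (card ?P + card V0 * ?n ^ (m - 1))" by (rule of_nat_mono)
      then have "real (card ?Q) \<le> real (card ?P) + real (card V0) * real ?n ^ (m - 1)" by simp
      also have "real (card V0) * real ?n ^ (m - 1) \<le> \<nu> * real ?n * real ?n ^ (m - 1)"
        using cV0 by (intro mult_right_mono) auto
      also have "\<dots> = \<nu> * real ?n ^ m" by (simp only: mult.assoc power_split[OF k(3)])
      also have "\<dots> \<le> c / 2 * real ?n ^ m"
        using \<nu>g gc gpos by (intro mult_right_mono) auto
      finally have "real (card ?Q) \<le> real (card ?P) + c / 2 * real ?n ^ m" by simp
      moreover have "card ?Q = deg H Z" by (rule extensions_eq_deg[OF finV HV k(1) Z])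
      moreover have "ext_threshold ?n k l \<le> deg H Z"
        using deg min_degree_le[OF finV Z, of H] by linarith
      ultimately show ?thesis using ext by linarith
    qed
    interpret near_parity V A V1 H k l m p g \<eta> \<delta>
    proof
      show "finite V" "A \<subseteq> V" "V1 \<subseteq> V" "H \<subseteq> [V]\<^bsup>k\<^esup>" by fact+
      show "k = l + m" "m \<le> l" "m > 0" "k \<ge> 7" by fact+
      show "g > 0" "\<eta> > 0" "\<delta> > 0" by fact+
      show "g \<le> (1 / (4 * real k)) ^ k" using gc gpos by (simp add: c_def)
      show "36 * \<eta> \<le> g" by (simp add: \<eta>_def)
      show "8 * 2 ^ k * \<delta> \<le> g * \<eta>" by (simp add: \<delta>_def)
      show "1000 * real k \<le> g * real ?n" by fact
      show "real ?n \<le> 3 * real (card (V1 \<inter> A))" "real ?n \<le> 3 * real (card (V1 - A))"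
        using cA A_V1[OF order.refl] by simp_all
      show "real (card {e \<in> [V1]\<^bsup>k\<^esup>. v \<in> e \<and> even (card (e \<inter> A) + p) \<and> e \<notin> H}) \<le> \<delta> * real ?n ^ (k - 1)"
        if v: "v \<in> V1" for v
      proof -
        have "{e \<in> [V1]\<^bsup>k\<^esup>. v \<in> e \<and> even (card (e \<inter> A) + p) \<and> e \<notin> H} \<subseteq> {e \<in> D. v \<in> e}"
        proof clarify
          fix e assume e: "e \<in> [V1]\<^bsup>k\<^esup>" "v \<in> e" "even (card (e \<inter> A) + p)" "e \<notin> H"
          have eV: "e \<subseteq> V1" using e(1) by (auto simp: nsets_def)
          then have "e \<in> parity_graph p k V A0"
            using e A_V1[OF eV] V1V by (auto simp: parity_graph_def nsets_def)
          then show "e \<in> D" using e(4) by (simp add: D_def)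
        qed
        then have "card {e \<in> [V1]\<^bsup>k\<^esup>. v \<in> e \<and> even (card (e \<inter> A) + p) \<and> e \<notin> H} \<le> card {e \<in> D. v \<in> e}"
          using finD by (intro card_mono) auto
        moreover have "real (card {e \<in> D. v \<in> e}) \<le> \<delta> * real ?n ^ (k - 1)"
          using v by (auto simp: V1_def V0_def)
        ultimately show ?thesis by linarith
      qed
      show "2 * g * real ?n ^ m \<le> real (card {W \<in> [V1]\<^bsup>m\<^esup>. W \<inter> Z = {} \<and> Z \<union> W \<in> H})"
        if Z: "Z \<in> [V]\<^bsup>l\<^esup>" for Z
      proof -
        have "2 * g * real ?n ^ m \<le> c / 2 * real ?n ^ m" using gc gpos by (intro mult_right_mono) auto
        then show ?thesis using codeg[OF Z] by linarith
      qed
      show "2 * g * real ?n ^ (k - 1) \<le> real (card {X \<in> [V1]\<^bsup>(k - 1)\<^esup>. insert v X \<in> H \<and>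
          even (card (insert v X \<inter> A) + p) \<and> X \<inter> A \<noteq> {} \<and> X - A \<noteq> {}})"
        if v: "v \<in> V - V1" for v
      proof -
        let ?T = "{X \<in> [V1]\<^bsup>(k - 1)\<^esup>. insert v X \<in> H \<and> even (card (insert v X \<inter> A) + p) \<and> X \<inter> A \<noteq> {} \<and> X - A \<noteq> {}}"
        have finT: "finite ?T" and finXX: "finite (XX v)" and finXE: "finite (XE v j)" for j
          using finite_imp_finite_nsets[OF finV1] by (auto simp: XX_def XE_def)
        have "(real ?n / 3 / real k) ^ (l - 1) * (c / 2 * real ?n ^ m) \<le> real (card (XX v)) * 2 ^ (k - 1)"
          unfolding XX_def
        proof (rule mixed_links_many[OF finV refl V1V v k(1)])
          have "3 * real k \<le> real ?n" using nk kpos by linarith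
          then show "3 * k \<le> ?n" by (metis of_nat_le_iff of_nat_mult of_nat_numeral)
        qed (use k cA codeg cpos in auto)
        moreover have "c * real ?n ^ (l - 1) \<le> (real ?n / 3 / real k) ^ (l - 1)"
        proof -
          have "c * real ?n ^ (l - 1) \<le> (1 / (4 * real k)) ^ (l - 1) * real ?n ^ (l - 1)"
            using k by (intro mult_right_mono cpow) auto
          also have "\<dots> \<le> (1 / (3 * real k)) ^ (l - 1) * real ?n ^ (l - 1)"
            using kpos by (intro mult_right_mono power_mono) (auto simp: field_simps)
          also have "\<dots> = (real ?n / 3 / real k) ^ (l - 1)"
            by (simp add: power_divide power_mult_distrib)
          finally show ?thesis .
        qed
        then have "c * real ?n ^ (l - 1) * (c / 2 * real ?n ^ m) \<le> (real ?n / 3 / real k) ^ (l - 1) * (c / 2 * real ?n ^ m)"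
          using cpos by (intro mult_right_mono) auto
        moreover have "c * real ?n ^ (l - 1) * (c / 2 * real ?n ^ m) = c * c / 2 * real ?n ^ (k - 1)"
        proof -
          have "k - 1 = (l - 1) + m" using k by simp
          then show ?thesis by (simp add: power_add)
        qed
        ultimately have i: "c * c / 2 * real ?n ^ (k - 1) \<le> real (card (XX v)) * 2 ^ (k - 1)" by linarith
        have ii: "c * c = 2 ^ (k - 1) * (16 * g)"
        proof -
          have "(2::real) ^ (k + 3) = 2 ^ (k - 1) * 16"
            using power_split[of k "2::real"] k(4) by (simp add: power_add)
          then show ?thesis by (simp add: g_def)
        qed
        have "2 ^ (k - 1) * (8 * g * real ?n ^ (k - 1)) = c * c / 2 * real ?n ^ (k - 1)"
          unfolding ii by simp
        also note i
        also have "real (card (XX v)) * 2 ^ (k - 1) = 2 ^ (k - 1) * real (card (XX v))" by (rule mult.commute)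
        finally have big: "8 * g * real ?n ^ (k - 1) \<le> real (card (XX v))"
          by (rule mult_left_le_imp_le) simp
        have half: "card (XX v) \<le> 2 * card ?T"
        proof -
          have vX: "X \<subseteq> V1" "finite X" "v \<notin> X" "X \<in> [V1]\<^bsup>(k - 1)\<^esup>" "insert v X \<in> H" "X \<inter> A \<noteq> {}" "X - A \<noteq> {}" if "X \<in> XX v" for X
          proof -
            show 1: "X \<subseteq> V1" "finite X" "X \<in> [V1]\<^bsup>(k - 1)\<^esup>" "insert v X \<in> H" using that by (auto simp: XX_def nsets_def)
            then show "v \<notin> X" using v by blast
            show "X \<inter> A \<noteq> {}" "X - A \<noteq> {}" using that A_V1[OF 1(1)] by (auto simp: XX_def)
          qed
          show ?thesis
          proof (cases "v \<in> A")
            case True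
            have "XE v (1 + p) \<subseteq> ?T"
            proof
              fix X assume X: "X \<in> XE v (1 + p)"
              then have XX: "X \<in> XX v" by (simp add: XE_def)
              have "insert v X \<inter> A = insert v (X \<inter> A0)" using True A_V1[OF vX(1)[OF XX]] by blast
              then have "card (insert v X \<inter> A) = card (X \<inter> A0) + 1" using vX(2,3)[OF XX] by simp
              then have "even (card (insert v X \<inter> A) + p)" using X by (simp add: XE_def)
              then show "X \<in> ?T" using vX(4-7)[OF XX] by simp
            qed
            then have "card (XE v (1 + p)) \<le> card ?T" using finT by (rule card_mono[rotated])
            moreover have "card (XX v) \<le> 2 * card (XE v (1 + p))" using True v by (auto simp: A_def V1_def)
            ultimately show ?thesis by linarith
          next
            case False
            have "XE v p \<subseteq> ?T"
            proof
              fix X assume X: "X \<in> XE v p"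
              then have XX: "X \<in> XX v" by (simp add: XE_def)
              have "insert v X \<inter> A = X \<inter> A0" using False A_V1[OF vX(1)[OF XX]] by blast
              then have "even (card (insert v X \<inter> A) + p)" using X by (simp add: XE_def)
              then show "X \<in> ?T" using vX(4-7)[OF XX] by simp
            qed
            then have "card (XE v p) \<le> card ?T" using finT by (rule card_mono[rotated])
            moreover have "XX v = XE v (1 + p) \<union> XE v p" by (auto simp: XE_def)
            then have "card (XX v) \<le> card (XE v (1 + p)) + card (XE v p)" by (simp add: card_Un_le)
            moreover have "2 * card (XE v (1 + p)) < card (XX v)" using False v VV by (auto simp: A_def)
            ultimately show ?thesis by linarith
          qed
        qed
        then have "real (card (XX v)) \<le> 2 * real (card ?T)" by linarith
        then show ?thesis using big mult_pos_pos[OF gpos, of "real ?n ^ (k - 1)"] npos by simp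
      qed
    qed
    obtain t where t: "?n = k * t" using dvd by (auto elim: dvdE)
    show ?thesis
    proof (rule near_parity_hamilton[OF t])
      have "real k * (5 * real (card V0)) \<le> real k * (5 * (\<nu> * real ?n))"
        using cV0 kpos by (intro mult_left_mono) auto
      also have "\<dots> = g * real ?n / 40" using kpos by (simp add: \<nu>_def)
      finally show "real (k * (20 + 5 * card (V - V1))) < g / 16 * real ?n"
        using nb kpos unfolding VV by (simp add: distrib_left)
      assume odd: "odd (card A + p * t)"
      have ln: "l \<le> ?n" using nk k by linarith
      have "t = ?n div k" using t k by simp
      then have le: "min_degree l V (parity_graph p k V A) \<le> ext_threshold ?n k l"
        using odd by (intro ext_threshold_ge[OF finV refl ln AV p]) simp
      obtain S0 where S0: "S0 \<in> [V]\<^bsup>l\<^esup>" "deg (parity_graph p k V A) S0 = min_degree l V (parity_graph p k V A)"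
        using min_degree_attained[OF finV ln] by blast
      \<comment> \<open>Without a wrong edge above \<open>S\<close>, its degree in \<open>H\<close>
        would be at most its degree in the parity graph. That is at most the degree of
        \<open>S0\<close>, hence at most the threshold, which the minimum degree of \<open>H\<close>
        exceeds.\<close>
      have wrong: "\<exists>e\<in>H. S \<subseteq> e \<and> \<not> right e" if S: "S \<in> [V]\<^bsup>l\<^esup>" "card (S \<inter> A) = card (S0 \<inter> A)" for S
      proof (rule ccontr)
        assume "\<not> ?thesis"
        then have "{e \<in> H. S \<subseteq> e} \<subseteq> {e \<in> parity_graph p k V A. S \<subseteq> e}"
          using HV by (auto simp: parity_graph_def)
        then have "deg H S \<le> deg (parity_graph p k V A) S"
          unfolding deg_def using finite_imp_finite_nsets[OF finV, of k]
          by (intro card_mono) (auto simp: parity_graph_def)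
        also have "\<dots> \<le> deg (parity_graph p k V A) S0"
          using S S0(1) by (intro deg_type_le finV AV) (auto simp: nsets_def)
        finally show False using S0(2) le deg min_degree_le[OF finV S(1), of H] by linarith
      qed
      show "\<exists>a b xs. even (a + b + p) \<and> path a b False 1 xs \<and> length xs \<le> 9"
        by (rule wrong_segment[OF C[OF finV] S0(1) wrong Cb])
    qed
  qed
  then show ?thesis using pos(4) by blast
qed

theorem theorem1p3:
  fixes k l :: nat
  assumes "k \<ge> 7" and "real k / 2 \<le> real l" and "l \<le> k - 1"
  shows "\<exists>\<epsilon>::real. \<epsilon> > 0 \<and> (\<exists>n0::nat. \<forall>n (V :: 'a set) H.
           kgraph k V H \<and> card V = n \<and> n \<ge> n0 \<and> k dvd n \<and>
           (\<exists>A B. balanced_bipartition V A B \<and>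
              (eps_close \<epsilon> k V H V (odd_graph k A B) \<or>
               eps_close \<epsilon> k V H V (even_graph k A B))) \<and>
           min_degree l V H > ext_threshold n k l
           \<longrightarrow> has_hamilton_cycle l (k - l) V H)"
proof -
  have "k = l + (k - l)" "k - l \<le> l" "k - l > 0" "k \<ge> 7" using assms by linarith+
  from close_to_parity_graph[OF this, where 'a = 'a] obtain \<epsilon> n0 where \<epsilon>: "\<epsilon> > 0" and
    main: "\<And>(V :: 'a set) H A0 p. kgraph k V H \<Longrightarrow> n0 \<le> card V \<Longrightarrow> k dvd card V \<Longrightarrow> A0 \<subseteq> V \<Longrightarrow> p \<le> 1 \<Longrightarrow>
      card V \<le> 2 * card A0 + 1 \<Longrightarrow> 2 * card A0 \<le> card V + 1 \<Longrightarrow>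
      real (card (sym_diff (parity_graph p k V A0) H)) \<le> \<epsilon> * real (card V) ^ k \<Longrightarrow>
      ext_threshold (card V) k l < min_degree l V H \<Longrightarrow> has_hamilton_cycle l (k - l) V H"
    by (metis (no_types, lifting))
  have "has_hamilton_cycle l (k - l) V H"
    if K: "kgraph k V H" "n0 \<le> card V" "k dvd card V" and bal: "balanced_bipartition V A B"
      and close: "eps_close \<epsilon> k V H V (odd_graph k A B) \<or> eps_close \<epsilon> k V H V (even_graph k A B)"
      and deg: "min_degree l V H > ext_threshold (card V) k l" for V :: "'a set" and H A B
  proof -
    have AB: "A \<union> B = V" and cA: "int (card A) = \<lceil>real (card V) / 2\<rceil>"
      using bal by (auto simp: balanced_bipartition_def bipartition_def)
    have AV: "A \<subseteq> V" using AB by blast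
    have "real_of_int (int (card A)) \<ge> real (card V) / 2" "real_of_int (int (card A)) < real (card V) / 2 + 1"
      unfolding cA by linarith+
    then have bA: "card V \<le> 2 * card A + 1" "2 * card A \<le> card V + 1" by linarith+
    from close obtain p where p: "p \<le> 1" "eps_close \<epsilon> k V H V (parity_graph p k V A)"
      unfolding odd_graph_parity[OF AB] even_graph_parity[OF AB] by (metis le_numeral_extra(4) zero_le_one)
    then obtain f where f: "bij_betw f V V"
      "real (card (sym_diff ((\<lambda>e. f ` e) ` parity_graph p k V A) H)) \<le> \<epsilon> * real (card V) ^ k"
      unfolding eps_close_def Let_def by blast
    have im: "f ` A \<subseteq> V" "card (f ` A) = card A"
      using bij_betw_imp_surj_on[OF f(1)] AV card_image[OF inj_on_subset[OF bij_betw_imp_inj_on[OF f(1)] AV]]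
      by blast+
    show ?thesis
      using f(2) bA im deg unfolding parity_graph_image[OF f(1) AV] by (intro main[OF K im(1) p(1)]) auto
  qed
  then show ?thesis using \<epsilon> by blast
qed

end
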